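(* Let $k$ be a field and let $X$ be a real analytic manifold endowed with an analytic action $\mu$ of $\mathbb{R}^+$. Assume: (i) every $U\in\mathrm{Op}^c(X_{sa})$ has a finite covering consisting of $\mathbb{R}^+$-connected subanalytic open subsets; (ii) for any $U\in\mathrm{Op}^c(X_{sa})$ we have $\mathbb{R}^+U\in\mathrm{Op}(X_{sa})$; (iii) for any $x\in X$ the set $\mathbb{R}^+x$ is contractible; (iv) there exists a covering $\{V_n\}_{n\in\mathbb{N}}$ of $X_{sa}$ such that $V_n$ is $\mathbb{R}^+$-connected and $V_n\subset\subset V_{n+1}$ for each $n$. Let $\eta_{sa}:X_{sa}\to X_{sa,\mathbb{R}^+}$ be the natural morphism of sites, and let $\widetilde{\eta}_{sa*}:\mathrm{Mod}_{\mathbb{R}^+}(k_{X_{sa}})\to\mathrm{Mod}(k_{X_{sa,\mathbb{R}^+}})$ be the restriction of $\eta_{sa*}$ to conic sheaves. Then the functors $\widetilde{\eta}_{sa*}$ and $\eta_{sa}^{-1}:\mathrm{Mod}(k_{X_{sa,\mathbb{R}^+}})\to\mathrm{Mod}_{\mathbb{R}^+}(k_{X_{sa}})$ are equivalences of categories inverse to each other.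
   Context: $\mathrm{Op}(X_{sa})$ is the category of subanalytic open subsets of $X$ and $\mathrm{Op}^c(X_{sa})$ the subcategory of relatively compact ones. The subanalytic site $X_{sa}$ is $\mathrm{Op}(X_{sa})$ with the topology: $S\subset\mathrm{Op}(X_{sa})$ covers $U$ if for every compact $K\subset X$ there is a finite $S_0\subset S$ with $K\cap\bigcup_{V\in S_0}V=K\cap U$. $\mathrm{Mod}(k_{X_{sa}})$ is the category of sheaves of $k$-modules on $X_{sa}$. For $S\subset X$, $\mathbb{R}^+S=\mu(S,\mathbb{R}^+)$; $S$ is conic if $S=\mathbb{R}^+S$; $S$ is $\mathbb{R}^+$-connected if $S\cap b$ is connected or empty for each orbit $b$ of $\mu$. $V\subset\subset W$ means $V$ is relatively compact in $W$. A sheaf $F$ on $X_{sa}$ is conic if the restriction $\Gamma(\mathbb{R}^+U;F)\to\Gamma(U;F)$ is an isomorphism for each $\mathbb{R}^+$-connected $U\in\mathrm{Op}^c(X_{sa})$ with $\mathbb{R}^+U\in\mathrm{Op}(X_{sa})$. $\mathrm{Mod}_{\mathbb{R}^+}(k_{X_{sa}})$ is the full subcategory of $\mathrm{Mod}(k_{X_{sa}})$ of conic sheaves. $X_{sa,\mathbb{R}^+}$ is the site whose objects are the conic subanalytic open subsets of $X$, with the topology induced by $X_{sa}$; $\mathrm{Mod}(k_{X_{sa,\mathbb{R}^+}})$ is its category of sheaves of $k$-modules. *)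

theory Defs
  imports "HOL-Analysis.Analysis" "HOL-Algebra.Module"
begin

section \<open>Categories, functors and equivalences\<close>

record ('o, 'f) cat =
  Obj :: "'o set"
  Arr :: "'o \<Rightarrow> 'o \<Rightarrow> 'f set"
  Idt :: "'o \<Rightarrow> 'f"
  Cmp :: "'o \<Rightarrow> 'o \<Rightarrow> 'o \<Rightarrow> 'f \<Rightarrow> 'f \<Rightarrow> 'f"

text \<open>\<open>Cmp C A B D g f\<close> is the composite of \<open>f : A \<rightarrow> B\<close> followed by \<open>g : B \<rightarrow> D\<close>.\<close>

definition category :: "('o, 'f) cat \<Rightarrow> bool" where
  "category C \<longleftrightarrow>
     (\<forall>A\<in>Obj C. Idt C A \<in> Arr C A A) \<and>
     (\<forall>A\<in>Obj C. \<forall>B\<in>Obj C. \<forall>D\<in>Obj C. \<forall>f\<in>Arr C A B. \<forall>g\<in>Arr C B D.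
        Cmp C A B D g f \<in> Arr C A D) \<and>
     (\<forall>A\<in>Obj C. \<forall>B\<in>Obj C. \<forall>f\<in>Arr C A B.
        Cmp C A A B f (Idt C A) = f \<and> Cmp C A B B (Idt C B) f = f) \<and>
     (\<forall>A\<in>Obj C. \<forall>B\<in>Obj C. \<forall>D\<in>Obj C. \<forall>E\<in>Obj C.
        \<forall>f\<in>Arr C A B. \<forall>g\<in>Arr C B D. \<forall>h\<in>Arr C D E.
        Cmp C A D E h (Cmp C A B D g f) = Cmp C A B E (Cmp C B D E h g) f)"

definition full_subcat :: "('o, 'f) cat \<Rightarrow> ('o \<Rightarrow> bool) \<Rightarrow> ('o, 'f) cat" where
  "full_subcat C P = C\<lparr>Obj := {A \<in> Obj C. P A}\<rparr>"

record ('o, 'f, 'p, 'g) funct =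
  FObj :: "'o \<Rightarrow> 'p"
  FArr :: "'o \<Rightarrow> 'o \<Rightarrow> 'f \<Rightarrow> 'g"

definition is_functor ::
    "('o, 'f) cat \<Rightarrow> ('p, 'g) cat \<Rightarrow> ('o, 'f, 'p, 'g) funct \<Rightarrow> bool" where
  "is_functor C D F \<longleftrightarrow>
     category C \<and> category D \<and>
     (\<forall>A\<in>Obj C. FObj F A \<in> Obj D) \<and>
     (\<forall>A\<in>Obj C. \<forall>B\<in>Obj C. \<forall>f\<in>Arr C A B. FArr F A B f \<in> Arr D (FObj F A) (FObj F B)) \<and>
     (\<forall>A\<in>Obj C. FArr F A A (Idt C A) = Idt D (FObj F A)) \<and>
     (\<forall>A\<in>Obj C. \<forall>B\<in>Obj C. \<forall>E\<in>Obj C. \<forall>f\<in>Arr C A B. \<forall>g\<in>Arr C B E.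
        FArr F A E (Cmp C A B E g f) =
          Cmp D (FObj F A) (FObj F B) (FObj F E) (FArr F B E g) (FArr F A B f))"

definition id_funct :: "('o, 'f, 'o, 'f) funct" where
  "id_funct = \<lparr>FObj = (\<lambda>A. A), FArr = (\<lambda>A B f. f)\<rparr>"

definition comp_funct ::
    "('p, 'g, 'q, 'h) funct \<Rightarrow> ('o, 'f, 'p, 'g) funct \<Rightarrow> ('o, 'f, 'q, 'h) funct" where
  "comp_funct G F =
     \<lparr>FObj = (\<lambda>A. FObj G (FObj F A)),
      FArr = (\<lambda>A B f. FArr G (FObj F A) (FObj F B) (FArr F A B f))\<rparr>"

definition is_iso :: "('o, 'f) cat \<Rightarrow> 'o \<Rightarrow> 'o \<Rightarrow> 'f \<Rightarrow> bool" where
  "is_iso C A B f \<longleftrightarrow> f \<in> Arr C A B \<and>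
     (\<exists>g\<in>Arr C B A. Cmp C A B A g f = Idt C A \<and> Cmp C B A B f g = Idt C B)"

definition naturally_isomorphic ::
    "('o, 'f) cat \<Rightarrow> ('p, 'g) cat \<Rightarrow> ('o, 'f, 'p, 'g) funct \<Rightarrow> ('o, 'f, 'p, 'g) funct \<Rightarrow> bool" where
  "naturally_isomorphic C D F G \<longleftrightarrow>
     (\<exists>\<tau>. (\<forall>A\<in>Obj C. is_iso D (FObj F A) (FObj G A) (\<tau> A)) \<and>
          (\<forall>A\<in>Obj C. \<forall>B\<in>Obj C. \<forall>f\<in>Arr C A B.
             Cmp D (FObj F A) (FObj F B) (FObj G B) (\<tau> B) (FArr F A B f) =
             Cmp D (FObj F A) (FObj G A) (FObj G B) (FArr G A B f) (\<tau> A)))"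

definition inverse_equivalences ::
    "('o, 'f) cat \<Rightarrow> ('p, 'g) cat \<Rightarrow> ('o, 'f, 'p, 'g) funct \<Rightarrow> ('p, 'g, 'o, 'f) funct \<Rightarrow> bool" where
  "inverse_equivalences C D F G \<longleftrightarrow>
     is_functor C D F \<and> is_functor D C G \<and>
     naturally_isomorphic C C (comp_funct G F) id_funct \<and>
     naturally_isomorphic D D (comp_funct F G) id_funct"


section \<open>Real analytic manifolds\<close>

text \<open>Points of \<open>\<real>\<^sup>n\<close> are the points of \<^const>\<open>Euclidean_space\<close> \<open>n\<close>, that is,
  sequences vanishing from index \<open>n\<close> on. A function is analytic at \<open>a\<close> if near \<open>a\<close> it is the
  (unconditional) sum of a power series, indexed by the multi-indices supported in \<open>{..<n}\<close>.\<close>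

definition real_analytic_at :: "nat \<Rightarrow> ((nat \<Rightarrow> real) \<Rightarrow> real) \<Rightarrow> (nat \<Rightarrow> real) \<Rightarrow> bool" where
  "real_analytic_at n f a \<longleftrightarrow>
     (\<exists>c r. r > 0 \<and>
        (\<forall>x\<in>topspace (Euclidean_space n). (\<forall>i<n. \<bar>x i - a i\<bar> < r) \<longrightarrow>
           ((\<lambda>\<alpha>. c \<alpha> * (\<Prod>i<n. (x i - a i) ^ \<alpha> i)) has_sum f x)
             {\<alpha> :: nat \<Rightarrow> nat. \<forall>i\<ge>n. \<alpha> i = 0}))"

text \<open>A chart \<open>(n, U, \<phi>)\<close> is a homeomorphism \<open>\<phi>\<close> from the open set \<open>U\<close> to an open
  subset of \<open>\<real>\<^sup>n\<close>.\<close>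

type_synonym 'a chart = "nat \<times> 'a set \<times> ('a \<Rightarrow> nat \<Rightarrow> real)"

record 'a mfd =
  mtop :: "'a topology"
  atlas :: "'a chart set"

definition is_chart :: "'a topology \<Rightarrow> 'a chart \<Rightarrow> bool" where
  "is_chart T = (\<lambda>(n, U, \<phi>).
     openin T U \<and> openin (Euclidean_space n) (\<phi> ` U) \<and>
     homeomorphic_map (subtopology T U) (subtopology (Euclidean_space n) (\<phi> ` U)) \<phi>)"

definition analytic_transition :: "'a chart \<Rightarrow> 'a chart \<Rightarrow> bool" where
  "analytic_transition = (\<lambda>(n, U, \<phi>) (m, V, \<psi>).
     \<forall>x\<in>U \<inter> V. \<forall>j<m. real_analytic_at n (\<lambda>y. \<psi> (inv_into U \<phi> y) j) (\<phi> x))"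

definition real_analytic_manifold :: "'a mfd \<Rightarrow> bool" where
  "real_analytic_manifold X \<longleftrightarrow>
     Hausdorff_space (mtop X) \<and>
     (\<forall>c\<in>atlas X. is_chart (mtop X) c) \<and>
     (\<Union>(n, U, \<phi>)\<in>atlas X. U) = topspace (mtop X) \<and>
     (\<forall>c\<in>atlas X. \<forall>d\<in>atlas X. analytic_transition c d)"

definition prod_chart :: "'a chart \<Rightarrow> 'b chart \<Rightarrow> ('a \<times> 'b) chart" where
  "prod_chart = (\<lambda>(n, U, \<phi>) (m, V, \<psi>).
     (n + m, U \<times> V, \<lambda>(x, y) i. if i < n then \<phi> x i else \<psi> y (i - n)))"

definition prod_mfd :: "'a mfd \<Rightarrow> 'b mfd \<Rightarrow> ('a \<times> 'b) mfd" where
  "prod_mfd X Y =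
     \<lparr>mtop = prod_topology (mtop X) (mtop Y),
      atlas = {prod_chart c d | c d. c \<in> atlas X \<and> d \<in> atlas Y}\<rparr>"

definition Rn_mfd :: "nat \<Rightarrow> (nat \<Rightarrow> real) mfd" where
  "Rn_mfd n = \<lparr>mtop = Euclidean_space n, atlas = {(n, topspace (Euclidean_space n), \<lambda>x. x)}\<rparr>"

definition open_interval_mfd :: "real set \<Rightarrow> real mfd" where
  "open_interval_mfd I =
     \<lparr>mtop = subtopology euclideanreal I,
      atlas = {(1, I, \<lambda>t i. if i = 0 then t else 0)}\<rparr>"

abbreviation R_mfd :: "real mfd" where
  "R_mfd \<equiv> open_interval_mfd UNIV"

abbreviation Rpos_mfd :: "real mfd" where
  "Rpos_mfd \<equiv> open_interval_mfd {0<..}"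

definition analytic_map_on :: "'a mfd \<Rightarrow> 'b mfd \<Rightarrow> 'a set \<Rightarrow> ('a \<Rightarrow> 'b) \<Rightarrow> bool" where
  "analytic_map_on X Y W f \<longleftrightarrow>
     openin (mtop X) W \<and> continuous_map (subtopology (mtop X) W) (mtop Y) f \<and>
     (\<forall>x\<in>W. \<forall>(n, U, \<phi>)\<in>atlas X. \<forall>(m, V, \<psi>)\<in>atlas Y. x \<in> U \<and> f x \<in> V \<longrightarrow>
        (\<forall>j<m. real_analytic_at n (\<lambda>y. \<psi> (f (inv_into U \<phi> y)) j) (\<phi> x)))"


section \<open>Subanalytic sets\<close>

definition relatively_compact_in :: "'a topology \<Rightarrow> 'a set \<Rightarrow> 'a set \<Rightarrow> bool" where
  "relatively_compact_in T V W \<longleftrightarrow>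
     V \<subseteq> topspace T \<and> compactin T (T closure_of V) \<and> T closure_of V \<subseteq> W"

text \<open>Locally, a semianalytic set is a finite union of sets
  \<open>{f\<^sub>1 = \<dots> = f\<^sub>p = 0, g\<^sub>1 > 0, \<dots>, g\<^sub>q > 0}\<close>, here encoded by the pairs
  \<open>({f\<^sub>1, \<dots>, f\<^sub>p}, {g\<^sub>1, \<dots>, g\<^sub>q})\<close>. The condition is imposed at all points
  of the manifold, not only at those of the set.\<close>

definition semianalytic :: "'a mfd \<Rightarrow> 'a set \<Rightarrow> bool" where
  "semianalytic X A \<longleftrightarrow>
     A \<subseteq> topspace (mtop X) \<and>
     (\<forall>p\<in>topspace (mtop X). \<exists>W \<F>. openin (mtop X) W \<and> p \<in> W \<and> finite \<F> \<and>
        (\<forall>(E, G)\<in>\<F>. finite E \<and> finite G \<and> (\<forall>f\<in>E \<union> G. analytic_map_on X R_mfd W f)) \<and>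
        A \<inter> W = {x \<in> W. \<exists>(E, G)\<in>\<F>. (\<forall>f\<in>E. f x = 0) \<and> (\<forall>g\<in>G. g x > 0)})"

text \<open>Subanalytic sets are, locally, projections of relatively compact semianalytic subsets
  of some \<open>X \<times> \<real>\<^sup>m\<close>.\<close>

definition subanalytic :: "'a mfd \<Rightarrow> 'a set \<Rightarrow> bool" where
  "subanalytic X A \<longleftrightarrow>
     A \<subseteq> topspace (mtop X) \<and>
     (\<forall>p\<in>topspace (mtop X). \<exists>U m B. openin (mtop X) U \<and> p \<in> U \<and>
        semianalytic (prod_mfd X (Rn_mfd m)) B \<and>
        relatively_compact_in (mtop (prod_mfd X (Rn_mfd m))) B
          (topspace (mtop (prod_mfd X (Rn_mfd m)))) \<and>
        A \<inter> U = fst ` B)"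

definition Op_sa :: "'a mfd \<Rightarrow> 'a set set" where
  "Op_sa X = {U. openin (mtop X) U \<and> subanalytic X U}"

definition Op_sa_c :: "'a mfd \<Rightarrow> 'a set set" where
  "Op_sa_c X = {U \<in> Op_sa X. relatively_compact_in (mtop X) U (topspace (mtop X))}"


section \<open>Actions of the positive reals\<close>

definition analytic_action :: "'a mfd \<Rightarrow> ('a \<times> real \<Rightarrow> 'a) \<Rightarrow> bool" where
  "analytic_action X \<mu> \<longleftrightarrow>
     analytic_map_on (prod_mfd X Rpos_mfd) X (topspace (mtop X) \<times> {0<..}) \<mu> \<and>
     (\<forall>x\<in>topspace (mtop X). \<mu> (x, 1) = x) \<and>
     (\<forall>x\<in>topspace (mtop X). \<forall>s>0. \<forall>t>0. \<mu> (\<mu> (x, s), t) = \<mu> (x, s * t))"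

definition Rpos_sat :: "('a \<times> real \<Rightarrow> 'a) \<Rightarrow> 'a set \<Rightarrow> 'a set" where
  "Rpos_sat \<mu> S = \<mu> ` (S \<times> {0<..})"

definition conic_set :: "('a \<times> real \<Rightarrow> 'a) \<Rightarrow> 'a set \<Rightarrow> bool" where
  "conic_set \<mu> S \<longleftrightarrow> S = Rpos_sat \<mu> S"

definition Rpos_connected :: "'a mfd \<Rightarrow> ('a \<times> real \<Rightarrow> 'a) \<Rightarrow> 'a set \<Rightarrow> bool" where
  "Rpos_connected X \<mu> S \<longleftrightarrow>
     (\<forall>x\<in>topspace (mtop X).
        S \<inter> Rpos_sat \<mu> {x} = {} \<or> connectedin (mtop X) (S \<inter> Rpos_sat \<mu> {x}))"


section \<open>Sites of open sets\<close>

text \<open>In a site whose underlying category is a set of subsets ordered by inclusion and closed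
  under intersection, the fibre product of \<open>V\<close> and \<open>W\<close> over any \<open>U\<close> is
  \<open>V \<inter> W\<close>. The members of a covering of \<open>U\<close> are subsets of \<open>U\<close>.\<close>

record 'a site =
  opens :: "'a set set"
  covers :: "'a set \<Rightarrow> 'a set set set"

definition site_sa :: "'a mfd \<Rightarrow> 'a site" where
  "site_sa X =
     \<lparr>opens = Op_sa X,
      covers = (\<lambda>U. {S. S \<subseteq> Op_sa X \<and> (\<forall>V\<in>S. V \<subseteq> U) \<and>
        (\<forall>C. compactin (mtop X) C \<longrightarrow> (\<exists>S0\<subseteq>S. finite S0 \<and> C \<inter> \<Union>S0 = C \<inter> U))})\<rparr>"

definition site_sa_conic :: "'a mfd \<Rightarrow> ('a \<times> real \<Rightarrow> 'a) \<Rightarrow> 'a site" where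
  "site_sa_conic X \<mu> =
     \<lparr>opens = {U \<in> Op_sa X. conic_set \<mu> U},
      covers = (\<lambda>U. {S \<in> covers (site_sa X) U. \<forall>V\<in>S. conic_set \<mu> V})\<rparr>"


section \<open>Sheaves of modules\<close>

definition linear_map ::
    "('k, 'z) ring_scheme \<Rightarrow> ('k, 'p) module \<Rightarrow> ('k, 'q) module \<Rightarrow> ('p \<Rightarrow> 'q) \<Rightarrow> bool" where
  "linear_map K M N f \<longleftrightarrow>
     f \<in> carrier M \<rightarrow> carrier N \<and>
     (\<forall>x\<in>carrier M. \<forall>y\<in>carrier M. f (x \<oplus>\<^bsub>M\<^esub> y) = f x \<oplus>\<^bsub>N\<^esub> f y) \<and>
     (\<forall>a\<in>carrier K. \<forall>x\<in>carrier M. f (a \<odot>\<^bsub>M\<^esub> x) = a \<odot>\<^bsub>N\<^esub> f x)"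

record ('a, 'k, 'p) psh =
  sec :: "'a set \<Rightarrow> ('k, 'p) module"
  res :: "'a set \<Rightarrow> 'a set \<Rightarrow> 'p \<Rightarrow> 'p"

definition is_presheaf :: "('k, 'z) ring_scheme \<Rightarrow> 'a site \<Rightarrow> ('a, 'k, 'p) psh \<Rightarrow> bool" where
  "is_presheaf K S F \<longleftrightarrow>
     (\<forall>U\<in>opens S. Module.module K (sec F U)) \<and>
     (\<forall>U\<in>opens S. \<forall>V\<in>opens S. V \<subseteq> U \<longrightarrow> linear_map K (sec F U) (sec F V) (res F U V)) \<and>
     (\<forall>U\<in>opens S. \<forall>s\<in>carrier (sec F U). res F U U s = s) \<and>
     (\<forall>U\<in>opens S. \<forall>V\<in>opens S. \<forall>W\<in>opens S. W \<subseteq> V \<and> V \<subseteq> U \<longrightarrow>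
        (\<forall>s\<in>carrier (sec F U). res F V W (res F U V s) = res F U W s))"

definition is_sheaf :: "('k, 'z) ring_scheme \<Rightarrow> 'a site \<Rightarrow> ('a, 'k, 'p) psh \<Rightarrow> bool" where
  "is_sheaf K S F \<longleftrightarrow>
     is_presheaf K S F \<and>
     (\<forall>U\<in>opens S. \<forall>\<V>\<in>covers S U. \<forall>s.
        (\<forall>V\<in>\<V>. s V \<in> carrier (sec F V)) \<and>
        (\<forall>V\<in>\<V>. \<forall>W\<in>\<V>. res F V (V \<inter> W) (s V) = res F W (V \<inter> W) (s W)) \<longrightarrow>
        (\<exists>!t. t \<in> carrier (sec F U) \<and> (\<forall>V\<in>\<V>. res F U V t = s V)))"

text \<open>Morphisms are families of linear maps, made extensional so that equal morphisms are
  equal as functions.\<close>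

definition psh_hom ::
    "('k, 'z) ring_scheme \<Rightarrow> 'a site \<Rightarrow> ('a, 'k, 'p) psh \<Rightarrow> ('a, 'k, 'q) psh \<Rightarrow>
     ('a set \<Rightarrow> 'p \<Rightarrow> 'q) set" where
  "psh_hom K S F G =
     {f \<in> extensional (opens S).
        (\<forall>U\<in>opens S. f U \<in> extensional (carrier (sec F U)) \<and>
           linear_map K (sec F U) (sec G U) (f U)) \<and>
        (\<forall>U\<in>opens S. \<forall>V\<in>opens S. V \<subseteq> U \<longrightarrow>
           (\<forall>s\<in>carrier (sec F U). f V (res F U V s) = res G U V (f U s)))}"

definition psh_id :: "'a site \<Rightarrow> ('a, 'k, 'p) psh \<Rightarrow> 'a set \<Rightarrow> 'p \<Rightarrow> 'p" where
  "psh_id S F = (\<lambda>U\<in>opens S. \<lambda>s\<in>carrier (sec F U). s)"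

definition psh_comp ::
    "'a site \<Rightarrow> ('a, 'k, 'p) psh \<Rightarrow> ('a set \<Rightarrow> 'q \<Rightarrow> 'r) \<Rightarrow> ('a set \<Rightarrow> 'p \<Rightarrow> 'q) \<Rightarrow>
     'a set \<Rightarrow> 'p \<Rightarrow> 'r" where
  "psh_comp S F g f = (\<lambda>U\<in>opens S. \<lambda>s\<in>carrier (sec F U). g U (f U s))"

text \<open>The sheaves of modules whose underlying sets of sections are subsets of a given type,
  which plays the role of the universe. On a space that is countable at infinity, the sections of an associated sheaf lie in
  countable products of modules of the universe, so the type has to be closed under these,
  i.e. to admit an injection \<open>(nat \<Rightarrow> 'm) \<Rightarrow> 'm\<close>; any type \<open>'b\<close> embeds into
  such a type, namely \<open>nat \<Rightarrow> 'b\<close>.\<close>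

definition sheaf_cat ::
    "('k, 'z) ring_scheme \<Rightarrow> 'a site \<Rightarrow> (('a, 'k, 'm) psh, 'a set \<Rightarrow> 'm \<Rightarrow> 'm) cat" where
  "sheaf_cat K S =
     \<lparr>Obj = {F. is_sheaf K S F},
      Arr = psh_hom K S,
      Idt = psh_id S,
      Cmp = (\<lambda>F G H g f. psh_comp S F g f)\<rparr>"

definition conic_sheaf :: "'a mfd \<Rightarrow> ('a \<times> real \<Rightarrow> 'a) \<Rightarrow> ('a, 'k, 'm) psh \<Rightarrow> bool" where
  "conic_sheaf X \<mu> F \<longleftrightarrow>
     (\<forall>U\<in>Op_sa_c X. Rpos_connected X \<mu> U \<and> Rpos_sat \<mu> U \<in> Op_sa X \<longrightarrow>
        bij_betw (res F (Rpos_sat \<mu> U) U) (carrier (sec F (Rpos_sat \<mu> U))) (carrier (sec F U)))"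

definition conic_sheaf_cat ::
    "('k, 'z) ring_scheme \<Rightarrow> 'a mfd \<Rightarrow> ('a \<times> real \<Rightarrow> 'a) \<Rightarrow>
     (('a, 'k, 'm) psh, 'a set \<Rightarrow> 'm \<Rightarrow> 'm) cat" where
  "conic_sheaf_cat K X \<mu> = full_subcat (sheaf_cat K (site_sa X)) (conic_sheaf X \<mu>)"


section \<open>Direct and inverse images\<close>

text \<open>Below, the opens of a site \<open>S'\<close> are among those of a site \<open>S\<close>, and the
  morphism of sites \<open>S \<rightarrow> S'\<close> is given by the inclusion of the opens. The direct image of
  a sheaf is then its composition with that inclusion.\<close>

definition direct_image_psh :: "'a site \<Rightarrow> ('a, 'k, 'p) psh \<Rightarrow> ('a, 'k, 'p) psh" where
  "direct_image_psh S' F =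
     \<lparr>sec = (\<lambda>U\<in>opens S'. sec F U),
      res = (\<lambda>U\<in>opens S'. \<lambda>V\<in>opens S'. res F U V)\<rparr>"

definition direct_image ::
    "'a site \<Rightarrow> (('a, 'k, 'm) psh, 'a set \<Rightarrow> 'm \<Rightarrow> 'm, ('a, 'k, 'm) psh, 'a set \<Rightarrow> 'm \<Rightarrow> 'm) funct" where
  "direct_image S' =
     \<lparr>FObj = direct_image_psh S', FArr = (\<lambda>F G f. \<lambda>U\<in>opens S'. f U)\<rparr>"

text \<open>The inverse image presheaf is \<open>U \<mapsto> colim F(V)\<close>, where \<open>V\<close> ranges over
  the opens of \<open>S'\<close> containing \<open>U\<close>. This index set is directed, because the opens
  of \<open>S'\<close> are closed under finite intersections, so the elements of the colimit are
  the classes \<open>germ_at S' F U (V, s)\<close> of pairs \<open>s \<in> F(V)\<close>.\<close>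

definition germ_at ::
    "'a site \<Rightarrow> ('a, 'k, 'p) psh \<Rightarrow> 'a set \<Rightarrow> 'a set \<times> 'p \<Rightarrow> ('a set \<times> 'p) set" where
  "germ_at S' F U = (\<lambda>(V, s).
     {(V', s'). V' \<in> opens S' \<and> U \<subseteq> V' \<and> s' \<in> carrier (sec F V') \<and>
        (\<exists>W\<in>opens S'. U \<subseteq> W \<and> W \<subseteq> V \<inter> V' \<and> res F V W s = res F V' W s')})"

text \<open>The module operations are computed on representatives; the union over all
  representatives is a union of equal classes. The fields \<^const>\<open>mult\<close> and
  \<^const>\<open>one\<close> of the module record play no role.\<close>

definition pullback_sec ::
    "'a site \<Rightarrow> ('a, 'k, 'p) psh \<Rightarrow> 'a set \<Rightarrow> ('k, ('a set \<times> 'p) set) module" where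
  "pullback_sec S' F U =
     \<lparr>carrier = {germ_at S' F U (V, s) | V s. V \<in> opens S' \<and> U \<subseteq> V \<and> s \<in> carrier (sec F V)},
      mult = undefined,
      one = undefined,
      zero = (\<Union>V\<in>{V \<in> opens S'. U \<subseteq> V}. germ_at S' F U (V, \<zero>\<^bsub>sec F V\<^esub>)),
      add = (\<lambda>C D. \<Union>(V, s)\<in>C. \<Union>(V', s')\<in>D.
               germ_at S' F U (V \<inter> V',
                 res F V (V \<inter> V') s \<oplus>\<^bsub>sec F (V \<inter> V')\<^esub> res F V' (V \<inter> V') s')),
      smult = (\<lambda>a C. \<Union>(V, s)\<in>C. germ_at S' F U (V, a \<odot>\<^bsub>sec F V\<^esub> s))\<rparr>"

definition pullback_psh ::
    "'a site \<Rightarrow> ('a, 'k, 'p) psh \<Rightarrow> ('a, 'k, ('a set \<times> 'p) set) psh" where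
  "pullback_psh S' F =
     \<lparr>sec = pullback_sec S' F,
      res = (\<lambda>U U' C. \<Union>(V, s)\<in>C. germ_at S' F U' (V, s))\<rparr>"

definition pullback_arr ::
    "'a site \<Rightarrow> 'a site \<Rightarrow> ('a, 'k, 'p) psh \<Rightarrow> ('a, 'k, 'q) psh \<Rightarrow> ('a set \<Rightarrow> 'p \<Rightarrow> 'q) \<Rightarrow>
     'a set \<Rightarrow> ('a set \<times> 'p) set \<Rightarrow> ('a set \<times> 'q) set" where
  "pullback_arr S S' F G f =
     (\<lambda>U\<in>opens S. \<lambda>C\<in>carrier (pullback_sec S' F U).
        \<Union>(V, s)\<in>C. germ_at S' G U (V, f V s))"

text \<open>The sheaf associated with a presheaf, together with its canonical morphism, is determined
  up to unique isomorphism by its universal property; a choice is made here.\<close>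

definition is_assoc_sheaf ::
    "('k, 'z) ring_scheme \<Rightarrow> 'a site \<Rightarrow> ('a, 'k, 'p) psh \<Rightarrow>
     ('a, 'k, 'm) psh \<Rightarrow> ('a set \<Rightarrow> 'p \<Rightarrow> 'm) \<Rightarrow> bool" where
  "is_assoc_sheaf K S P G \<iota> \<longleftrightarrow>
     is_sheaf K S G \<and> \<iota> \<in> psh_hom K S P G \<and>
     (\<forall>H :: ('a, 'k, 'm) psh. is_sheaf K S H \<longrightarrow>
        (\<forall>f\<in>psh_hom K S P H. \<exists>!g. g \<in> psh_hom K S G H \<and> psh_comp S P g \<iota> = f))"

definition assoc_sheaf ::
    "('k, 'z) ring_scheme \<Rightarrow> 'a site \<Rightarrow> ('a, 'k, 'p) psh \<Rightarrow>
     ('a, 'k, 'm) psh \<times> ('a set \<Rightarrow> 'p \<Rightarrow> 'm)" where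
  "assoc_sheaf K S P = (SOME (G, \<iota>). is_assoc_sheaf K S P G \<iota>)"

definition inverse_image_sheaf ::
    "('k, 'z) ring_scheme \<Rightarrow> 'a site \<Rightarrow> 'a site \<Rightarrow> ('a, 'k, 'm) psh \<Rightarrow> ('a, 'k, 'm) psh" where
  "inverse_image_sheaf K S S' F = fst (assoc_sheaf K S (pullback_psh S' F))"

definition inverse_image_unit ::
    "('k, 'z) ring_scheme \<Rightarrow> 'a site \<Rightarrow> 'a site \<Rightarrow> ('a, 'k, 'm) psh \<Rightarrow>
     'a set \<Rightarrow> ('a set \<times> 'm) set \<Rightarrow> 'm" where
  "inverse_image_unit K S S' F =
     snd (assoc_sheaf K S (pullback_psh S' F) ::
       ('a, 'k, 'm) psh \<times> ('a set \<Rightarrow> ('a set \<times> 'm) set \<Rightarrow> 'm))"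

definition inverse_image ::
    "('k, 'z) ring_scheme \<Rightarrow> 'a site \<Rightarrow> 'a site \<Rightarrow>
     (('a, 'k, 'm) psh, 'a set \<Rightarrow> 'm \<Rightarrow> 'm, ('a, 'k, 'm) psh, 'a set \<Rightarrow> 'm \<Rightarrow> 'm) funct" where
  "inverse_image K S S' =
     \<lparr>FObj = inverse_image_sheaf K S S',
      FArr = (\<lambda>F G f. THE g.
        g \<in> psh_hom K S (inverse_image_sheaf K S S' F) (inverse_image_sheaf K S S' G) \<and>
        psh_comp S (pullback_psh S' F) g (inverse_image_unit K S S' F) =
        psh_comp S (pullback_psh S' F) (inverse_image_unit K S S' G) (pullback_arr S S' F G f))\<rparr>"

end

theory Submission
  imports Defs
begin

text \<open>Write \<open>sat U\<close> for \<open>\<real>\<^sup>+U\<close>. The direct image merely forgets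
the sections over open sets that are not conic, so the theorem says that nothing is lost in this
way on conic sheaves, and that every sheaf on the conic site arises. Call an open set
\<open>basic\<close> if it is subanalytic, relatively compact and
\<open>\<real>\<^sup>+\<close>-connected. By (i), the basic subsets of any \<open>U\<close> cover
\<open>U\<close>.

A conic sheaf \<open>G\<close> satisfies \<open>G(b) = G(sat b)\<close> for basic
\<open>b\<close>, and basic sets form a basis; hence a morphism from \<open>G\<close> to any sheaf
is the same thing as a morphism between the direct images (\<open>hom_extends_from_conic\<close>).

Conversely, a sheaf \<open>F\<close> on the conic site is extended by \<open>L(U) = lim F(sat
b)\<close>, over the basic \<open>b \<subseteq> U\<close>. The difficulty is that \<open>L\<close>
is a sheaf: sections over \<open>sat c\<close> and \<open>sat d\<close> that agree on \<open>sat
(c \<inter> d)\<close> must be shown to agree on the intersection of \<open>sat c\<close> and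
\<open>sat d\<close>, which is larger in general. This is where connectedness enters. Let
\<open>c\<close> and \<open>d\<close> belong to a finite family of open sets covering a basic
\<open>b\<close>. An orbit \<open>o\<close> that meets both meets \<open>b\<close> in a connected
set, so the family contains a chain from \<open>c\<close> to \<open>d\<close> in which consecutive
members meet inside \<open>o\<close> (\<open>overlap_chain\<close>), and agreement propagates
along the chain. There are finitely many chains, so they give a finite covering of the
intersection of \<open>sat c\<close> and \<open>sat d\<close>
(\<open>sections_agree_on_overlaps\<close>). The resulting gluing statement is
\<open>glue_subordinate\<close>.

That \<open>L(W) = F(W)\<close> for conic \<open>W\<close> uses the exhaustion \<open>E\<close> of
(iv): the sets \<open>W \<inter> E n\<close> are again basic, and every basic subset of
\<open>W\<close> lies in one of them, so the limit runs over a sequence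
(\<open>family_unit\<close>). Similarly \<open>L(b) = F(sat b)\<close> for basic \<open>b\<close>,
so \<open>L\<close> is conic. A compatible family is determined by its members on a countable
covering; this puts a copy of \<open>L(U)\<close> inside the type of the sections of
\<open>F\<close> (\<open>families_encoding\<close>).

By the extension property of morphisms, this copy of \<open>L\<close>, with the isomorphism from
\<open>F\<close> to its direct image, has the universal property of the associated sheaf of the
inverse image presheaf. Whichever associated sheaf is chosen is therefore isomorphic to it: it is
conic, and the unit of the adjunction is an isomorphism. The counit is inverse to the extension of
that unit.

All of this needs intersections of subanalytic open sets to be subanalytic: locally the
intersection of two projections is the projection of a fibre product
(\<open>subanalytic_Int\<close>).\<close>

section \<open>Reindexing the variables of an analytic function\<close>

lemma openin_Euclidean_space_box:
  assumes "openin (Euclidean_space n) S" "a \<in> S"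
  obtains r where "r > 0"
    "\<And>x. x \<in> topspace (Euclidean_space n) \<Longrightarrow> (\<And>i. i < n \<Longrightarrow> \<bar>x i - a i\<bar> < r) \<Longrightarrow> x \<in> S"
proof -
  obtain T where T: "openin (powertop_real UNIV) T" and S: "S = T \<inter> {x. \<forall>i\<ge>n. x i = 0}"
    using assms(1) by (auto simp: Euclidean_space_def openin_subtopology)
  obtain Y where Y: "a \<in> Pi\<^sub>E UNIV Y" "\<And>i. openin euclideanreal (Y i)" "Pi\<^sub>E UNIV Y \<subseteq> T"
    using product_topology_open_contains_basis[OF T] assms(2) S by blast
  have "\<exists>e>0. \<forall>t. \<bar>t - a i\<bar> < e \<longrightarrow> t \<in> Y i" for i
  proof -
    have "open (Y i)" "a i \<in> Y i" using Y by auto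
    then show ?thesis by (metis open_real)
  qed
  then obtain e where e: "\<And>i. e i > 0" "\<And>i t. \<bar>t - a i\<bar> < e i \<Longrightarrow> t \<in> Y i" by metis
  define r where "r = Min (insert 1 (e ` {..<n}))"
  have r: "r > 0" "\<And>i. i < n \<Longrightarrow> r \<le> e i"
    by (auto simp: r_def e)
  show thesis
  proof
    fix x assume x: "x \<in> topspace (Euclidean_space n)" "\<And>i. i < n \<Longrightarrow> \<bar>x i - a i\<bar> < r"
    \<comment> \<open>beyond \<open>n\<close> there is nothing to estimate, since both \<open>x\<close> and \<open>a\<close> vanish there\<close>
    have "x i \<in> Y i" for i
    proof (cases "i < n")
      case True
      then show ?thesis using x(2)[OF True] r(2)[OF True] e(2) by fastforce
    next
      case False
      then have "x i = a i" using x(1) assms(2) S by (auto simp: topspace_Euclidean_space)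
      then show ?thesis using Y(1) by auto
    qed
    then show "x \<in> S" using Y(3) S x(1) by (auto simp: topspace_Euclidean_space)
  qed (fact r(1))
qed

lemma real_analytic_at_cong:
  assumes "real_analytic_at n f a" "r > 0"
    and eq: "\<And>x. x \<in> topspace (Euclidean_space n) \<Longrightarrow> (\<And>i. i < n \<Longrightarrow> \<bar>x i - a i\<bar> < r) \<Longrightarrow> f x = g x"
  shows "real_analytic_at n g a"
proof -
  obtain c r' where "r' > 0" and c: "\<forall>x\<in>topspace (Euclidean_space n). (\<forall>i<n. \<bar>x i - a i\<bar> < r') \<longrightarrow>
           ((\<lambda>\<alpha>. c \<alpha> * (\<Prod>i<n. (x i - a i) ^ \<alpha> i)) has_sum f x)
             {\<alpha> :: nat \<Rightarrow> nat. \<forall>i\<ge>n. \<alpha> i = 0}"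
    using assms(1) unfolding real_analytic_at_def by blast
  show ?thesis unfolding real_analytic_at_def
    by (rule exI[of _ c], rule exI[of _ "min r r'"]) (use \<open>r' > 0\<close> \<open>r > 0\<close> c eq in auto)
qed

text \<open>A power series in some of the variables is a power series in all of them, with zero
coefficients at the multi-indices that involve the others.\<close>

lemma real_analytic_at_reindex:
  assumes f: "real_analytic_at k f (\<lambda>i. if i < k then a (\<sigma> i) else 0)"
    and \<sigma>: "inj_on \<sigma> {..<k}" "\<sigma> ` {..<k} \<subseteq> {..<n}"
  shows "real_analytic_at n (\<lambda>y. f (\<lambda>i. if i < k then y (\<sigma> i) else 0)) a"
proof -
  let ?p = "\<lambda>y i. if i < k then y (\<sigma> i) else (0::real)"
  let ?I = "\<lambda>n. {\<alpha> :: nat \<Rightarrow> nat. \<forall>i\<ge>n. \<alpha> i = 0}"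
  obtain c r where r: "r > 0" and c: "\<And>x. x\<in>topspace (Euclidean_space k) \<Longrightarrow> (\<forall>i<k. \<bar>x i - ?p a i\<bar> < r) \<Longrightarrow>
           ((\<lambda>\<alpha>. c \<alpha> * (\<Prod>i<k. (x i - ?p a i) ^ \<alpha> i)) has_sum f x) (?I k)"
    using f unfolding real_analytic_at_def by blast
  \<comment> \<open>the multi-indices involving only the variables selected by \<open>\<sigma>\<close>\<close>
  define J where "J = {\<alpha> \<in> ?I n. \<forall>i. i \<notin> \<sigma> ` {..<k} \<longrightarrow> \<alpha> i = 0}"
  define q where "q = (\<lambda>(\<alpha>::nat\<Rightarrow>nat) i. if i < k then \<alpha> (\<sigma> i) else 0)"
  define c' where "c' = (\<lambda>\<alpha>. if \<alpha> \<in> J then c (q \<alpha>) else 0)"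
  have q: "bij_betw q J (?I k)"
  proof (rule bij_betwI[where g="\<lambda>\<beta> j. if j \<in> \<sigma> ` {..<k} then \<beta> (inv_into {..<k} \<sigma> j) else 0"])
    show "q \<in> J \<rightarrow> ?I k" by (auto simp: q_def)
    show "(\<lambda>\<beta> j. if j \<in> \<sigma> ` {..<k} then \<beta> (inv_into {..<k} \<sigma> j) else 0) \<in> ?I k \<rightarrow> J"
    proof -
      have "j \<notin> \<sigma> ` {..<k}" if "n \<le> j" for j using \<sigma>(2) that by auto
      then show ?thesis by (simp add: J_def)
    qed
  next
    fix \<alpha> assume "\<alpha> \<in> J"
    then show "(\<lambda>j. if j \<in> \<sigma> ` {..<k} then q \<alpha> (inv_into {..<k} \<sigma> j) else 0) = \<alpha>"
      using \<sigma>(1) by (auto simp: J_def q_def fun_eq_iff)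
  next
    fix \<beta> assume "\<beta> \<in> ?I k"
    then show "q (\<lambda>j. if j \<in> \<sigma> ` {..<k} then \<beta> (inv_into {..<k} \<sigma> j) else 0) = \<beta>"
      using \<sigma>(1) by (auto simp: q_def fun_eq_iff)
  qed
  show ?thesis unfolding real_analytic_at_def
  proof (rule exI[of _ c'], rule exI[of _ r], intro conjI ballI impI r)
    fix x assume x: "x \<in> topspace (Euclidean_space n)" "\<forall>i<n. \<bar>x i - a i\<bar> < r"
    have prod: "(\<Prod>i<n. (x i - a i) ^ \<alpha> i) = (\<Prod>i<k. (?p x i - ?p a i) ^ q \<alpha> i)" if "\<alpha> \<in> J" for \<alpha>
    proof -
      have "(\<Prod>i<n. (x i - a i) ^ \<alpha> i) = (\<Prod>i\<in>\<sigma> ` {..<k}. (x i - a i) ^ \<alpha> i)"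
        using that \<sigma>(2) by (intro prod.mono_neutral_right) (auto simp: J_def)
      also have "\<dots> = (\<Prod>i<k. (x (\<sigma> i) - a (\<sigma> i)) ^ \<alpha> (\<sigma> i))"
        using \<sigma>(1) by (simp add: prod.reindex)
      finally show ?thesis by (simp add: q_def)
    qed
    have "((\<lambda>\<alpha>. c \<alpha> * (\<Prod>i<k. (?p x i - ?p a i) ^ \<alpha> i)) has_sum f (?p x)) (?I k)"
      using x \<sigma>(2) by (intro c) (auto simp: topspace_Euclidean_space)
    then have "((\<lambda>\<alpha>. c (q \<alpha>) * (\<Prod>i<k. (?p x i - ?p a i) ^ q \<alpha> i)) has_sum f (?p x)) J"
      by (subst has_sum_reindex_bij_betw[OF q])
    then show "((\<lambda>\<alpha>. c' \<alpha> * (\<Prod>i<n. (x i - a i) ^ \<alpha> i)) has_sum f (?p x)) (?I n)"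
      by (rule iffD1[OF has_sum_cong_neutral, rotated -1]) (auto simp: c'_def prod, auto simp: J_def)
  qed
qed

section \<open>Semianalytic sets and coordinate projections\<close>

text \<open>Coordinate \<open>i\<close> of the image is coordinate \<open>\<sigma> i\<close> of
the argument. With an arbitrary injective \<open>\<sigma>\<close> this covers the projections from
\<open>X \<times> \<real>\<^sup>m \<times> \<real>\<^sup>n\<close> to \<open>X \<times>
\<real>\<^sup>m\<close> and to \<open>X \<times> \<real>\<^sup>n\<close> at once.\<close>

definition coord_proj :: "(nat \<Rightarrow> nat) \<Rightarrow> nat \<Rightarrow> 'a \<times> (nat \<Rightarrow> real) \<Rightarrow> 'a \<times> (nat \<Rightarrow> real)" where
  "coord_proj \<sigma> k = (\<lambda>(x, z). (x, \<lambda>i. if i < k then z (\<sigma> i) else 0))"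

lemma mtop_prod_Rn [simp]: "mtop (prod_mfd X (Rn_mfd m)) = prod_topology (mtop X) (Euclidean_space m)"
  by (simp add: prod_mfd_def Rn_mfd_def)

lemma continuous_map_Euclidean_coord:
  "continuous_map (Euclidean_space n) euclideanreal (\<lambda>x. x i)"
  unfolding Euclidean_space_def
  by (intro continuous_map_from_subtopology continuous_map_product_coordinates) auto

lemma continuous_map_coord_proj:
  "continuous_map (prod_topology T (Euclidean_space l)) (prod_topology T (Euclidean_space k)) (coord_proj \<sigma> k)"
proof -
  have "continuous_map (prod_topology T (Euclidean_space l)) euclideanreal (\<lambda>p. snd p (\<sigma> i))" for i
    using continuous_map_compose[OF continuous_map_snd continuous_map_Euclidean_coord] by (simp add: o_def)
  then have "continuous_map (prod_topology T (Euclidean_space l)) (prod_topology T (Euclidean_space k))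
      (\<lambda>p. (fst p, \<lambda>i. if i < k then snd p (\<sigma> i) else 0))"
    by (intro continuous_map_pairedI continuous_map_fst)
       (simp add: continuous_map_componentwise_Euclidean_space)
  then show ?thesis by (simp add: coord_proj_def case_prod_unfold)
qed

text \<open>In product charts the projection is again a selection of coordinates, namely those of
the chart of \<open>X\<close> followed by those selected by \<open>\<sigma>\<close>, so the claim
reduces to reindexing. The chart of the larger product is only inverted near the given point,
where its image is known to be open.\<close>

lemma analytic_map_on_coord_proj:
  assumes X: "real_analytic_manifold X"
    and \<sigma>: "inj_on \<sigma> {..<k}" "\<sigma> ` {..<k} \<subseteq> {..<l}"
    and f: "analytic_map_on (prod_mfd X (Rn_mfd k)) R_mfd W f"
  shows "analytic_map_on (prod_mfd X (Rn_mfd l)) R_mfd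
           {p \<in> topspace (mtop (prod_mfd X (Rn_mfd l))). coord_proj \<sigma> k p \<in> W} (f \<circ> coord_proj \<sigma> k)"
    (is "analytic_map_on ?Z _ ?W _")
proof -
  let ?Y = "prod_mfd X (Rn_mfd k)"
  have opW: "openin (mtop ?Y) W" and cf: "continuous_map (subtopology (mtop ?Y) W) euclideanreal f"
    using f by (auto simp: analytic_map_on_def open_interval_mfd_def)
  have opW': "openin (mtop ?Z) ?W"
    using openin_continuous_map_preimage[OF continuous_map_coord_proj opW[simplified]] by simp
  have cf': "continuous_map (subtopology (mtop ?Z) ?W) euclideanreal (f \<circ> coord_proj \<sigma> k)"
  proof (rule continuous_map_compose[OF _ cf])
    show "continuous_map (subtopology (mtop ?Z) ?W) (subtopology (mtop ?Y) W) (coord_proj \<sigma> k)"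
      using continuous_map_coord_proj[of "mtop X" l k \<sigma>]
      by (auto simp: continuous_map_in_subtopology continuous_map_from_subtopology)
  qed
  have "real_analytic_at N (\<lambda>y. (f \<circ> coord_proj \<sigma> k) (inv_into U \<phi> y)) (\<phi> p)"
    if p: "p \<in> ?W" "p \<in> U" and ch: "(N, U, \<phi>) \<in> atlas ?Z" for p N U \<phi>
  proof -
    obtain n D \<psi> where c: "(n, D, \<psi>) \<in> atlas X" and N: "N = n + l"
      and U: "U = D \<times> topspace (Euclidean_space l)"
      and \<phi>: "\<phi> = (\<lambda>(x, y) i. if i < n then \<psi> x i else y (i - n))"
      using ch by (auto simp: prod_mfd_def Rn_mfd_def prod_chart_def)
    define \<phi>1 where "\<phi>1 = (\<lambda>(x, y) i. if i < n then \<psi> x i else y (i - n) :: real)"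
    define U1 where "U1 = D \<times> topspace (Euclidean_space k)"
    have ch1: "(n + k, U1, \<phi>1) \<in> atlas ?Y"
      using c by (force simp: prod_mfd_def Rn_mfd_def prod_chart_def U1_def \<phi>1_def)
    have "is_chart (mtop X) (n, D, \<psi>)" using X c by (auto simp: real_analytic_manifold_def)
    then have \<psi>op: "openin (Euclidean_space n) (\<psi> ` D)" and "D \<subseteq> topspace (mtop X)"
      and hom: "homeomorphic_map (subtopology (mtop X) D) (subtopology (Euclidean_space n) (\<psi> ` D)) \<psi>"
      by (auto simp: is_chart_def openin_subset)
    then have \<psi>inj: "inj_on \<psi> D"
      using homeomorphic_imp_injective_map[OF hom] by (simp add: inf_absorb2)
    have \<psi>0: "\<psi> u i = 0" if "u \<in> D" "n \<le> i" for u i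
      using openin_subset[OF \<psi>op] that by (auto simp: topspace_Euclidean_space)
    have inj: "inj_on (\<lambda>(x, y) i. if i < n then \<psi> x i else y (i - n) :: real) (D \<times> Q)" for Q
    proof (rule inj_onI, clarify)
      fix x y x' y' assume x: "x \<in> D" "x' \<in> D" and
        eq: "(\<lambda>i. if i < n then \<psi> x i else y (i - n)) = (\<lambda>i. if i < n then \<psi> x' i else y' (i - n) :: real)"
      have "\<psi> x i = \<psi> x' i" for i
        using fun_cong[OF eq, of i] \<psi>0 x by (cases "i < n") auto
      then have "x = x'" using \<psi>inj x by (auto dest: inj_onD)
      moreover have "y i = y' i" for i using fun_cong[OF eq, of "n + i"] by simp
      ultimately show "x = x' \<and> y = y'" by auto
    qed
    define \<sigma>' where "\<sigma>' = (\<lambda>i. if i < n then i else n + \<sigma> (i - n))"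
    have \<phi>1: "\<phi>1 (coord_proj \<sigma> k q) = (\<lambda>i. if i < n + k then \<phi> q (\<sigma>' i) else 0)" for q
      by (cases q) (auto simp: \<phi>1_def \<phi> coord_proj_def \<sigma>'_def fun_eq_iff)
    have U1: "coord_proj \<sigma> k q \<in> U1" if "q \<in> U" for q
      using that by (auto simp: U U1_def coord_proj_def topspace_Euclidean_space)
    have ra: "real_analytic_at (n + k) (\<lambda>y. f (inv_into U1 \<phi>1 y)) (\<phi>1 (coord_proj \<sigma> k p))"
    proof -
      have "\<forall>x\<in>W. \<forall>(n, U, \<phi>)\<in>atlas ?Y. \<forall>(m, V, \<psi>)\<in>atlas R_mfd. x \<in> U \<and> f x \<in> V \<longrightarrow>
        (\<forall>j<m. real_analytic_at n (\<lambda>y. \<psi> (f (inv_into U \<phi> y)) j) (\<phi> x))"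
        using f by (simp add: analytic_map_on_def)
      then have "\<forall>(m, V, \<psi>)\<in>atlas R_mfd. coord_proj \<sigma> k p \<in> U1 \<and> f (coord_proj \<sigma> k p) \<in> V \<longrightarrow>
        (\<forall>j<m. real_analytic_at (n+k) (\<lambda>y. \<psi> (f (inv_into U1 \<phi>1 y)) j) (\<phi>1 (coord_proj \<sigma> k p)))"
        using p(1) ch1 by blast
      then show ?thesis using U1[OF p(2)] by (simp add: open_interval_mfd_def)
    qed
    have "real_analytic_at (n + l) (\<lambda>y. f (inv_into U1 \<phi>1 (\<lambda>i. if i < n + k then y (\<sigma>' i) else 0))) (\<phi> p)"
    proof (rule real_analytic_at_reindex)
      show "inj_on \<sigma>' {..<n+k}"
      proof (rule inj_onI)
        fix i j assume ij: "i \<in> {..<n+k}" "j \<in> {..<n+k}" "\<sigma>' i = \<sigma>' j"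
        show "i = j"
        proof (cases "i < n \<or> j < n")
          case True
          then show ?thesis using ij(3) by (auto simp: \<sigma>'_def split: if_splits)
        next
          case False
          then have "\<sigma> (i - n) = \<sigma> (j - n)" using ij(3) by (auto simp: \<sigma>'_def split: if_splits)
          moreover have "i - n \<in> {..<k}" "j - n \<in> {..<k}" using ij False by auto
          ultimately have "i - n = j - n" using \<sigma>(1) by (auto dest: inj_onD)
          then show ?thesis using False by auto
        qed
      qed
      show "\<sigma>' ` {..<n+k} \<subseteq> {..<n+l}"
      proof (rule image_subsetI)
        fix i assume i: "i \<in> {..<n+k}"
        show "\<sigma>' i \<in> {..<n+l}"
        proof (cases "i < n")
          case False
          then have "i - n \<in> {..<k}" using i by auto
          then have "\<sigma> (i - n) \<in> {..<l}" using \<sigma>(2) by blast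
          then show ?thesis using False by (simp add: \<sigma>'_def)
        qed (simp add: \<sigma>'_def)
      qed
    qed (use ra in \<open>simp add: \<phi>1\<close>)
    moreover obtain x z where pxz: "p = (x, z)" "x \<in> D" using p(2) U by auto
    obtain r where r: "r > 0" "\<And>y. y \<in> topspace (Euclidean_space n) \<Longrightarrow>
        (\<And>i. i < n \<Longrightarrow> \<bar>y i - \<psi> x i\<bar> < r) \<Longrightarrow> y \<in> \<psi> ` D"
      using openin_Euclidean_space_box[OF \<psi>op] pxz(2) by blast
    \<comment> \<open>\<open>inv_into U \<phi>\<close> is the inverse chart only on the image of \<open>\<phi>\<close>; the box of size \<open>r\<close> around \<open>\<phi> p\<close> lies in it\<close>
    have "f (inv_into U1 \<phi>1 (\<lambda>i. if i < n + k then y (\<sigma>' i) else 0)) = (f \<circ> coord_proj \<sigma> k) (inv_into U \<phi> y)"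
      if y: "y \<in> topspace (Euclidean_space (n + l))" "\<And>i. i < n + l \<Longrightarrow> \<bar>y i - \<phi> p i\<bar> < r" for y
    proof -
      have "(\<lambda>i. if i < n then y i else 0) \<in> \<psi> ` D"
      proof (rule r(2))
        fix i assume "i < n"
        then show "\<bar>(if i < n then y i else 0) - \<psi> x i\<bar> < r" using y(2)[of i] by (simp add: \<phi> pxz)
      qed (simp add: topspace_Euclidean_space)
      then obtain u where u: "u \<in> D" "\<psi> u = (\<lambda>i. if i < n then y i else 0)" by auto
      let ?q = "(u, \<lambda>i. y (n + i))"
      have q: "?q \<in> U" using u y(1) by (auto simp: U topspace_Euclidean_space)
      have yq: "\<phi> ?q = y" using u by (auto simp: \<phi>)
      have "inv_into U \<phi> y = ?q"
        using inv_into_f_f[OF _ q, of \<phi>] inj yq by (simp add: U \<phi>)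
      moreover have "inv_into U1 \<phi>1 (\<phi>1 (coord_proj \<sigma> k ?q)) = coord_proj \<sigma> k ?q"
        using U1[OF q] inj by (intro inv_into_f_f) (auto simp: U1_def \<phi>1_def)
      ultimately show ?thesis unfolding \<phi>1 yq by simp
    qed
    ultimately show ?thesis unfolding N
      by (rule real_analytic_at_cong[OF _ r(1)])
  qed
  then show ?thesis using opW' cf'
    unfolding analytic_map_on_def by (auto simp: open_interval_mfd_def)
qed

lemma analytic_map_on_subset:
  "analytic_map_on X Y W f \<Longrightarrow> openin (mtop X) W' \<Longrightarrow> W' \<subseteq> W \<Longrightarrow> analytic_map_on X Y W' f"
  unfolding analytic_map_on_def by (meson continuous_map_from_subtopology_mono subsetD)

text \<open>\<open>analytic_system\<close> and \<open>locus\<close> separate the two roles of the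
local data of a semianalytic set: the functions involved, and the set that they cut out.\<close>

definition analytic_system :: "'a mfd \<Rightarrow> 'a set \<Rightarrow> (('a \<Rightarrow> real) set \<times> ('a \<Rightarrow> real) set) set \<Rightarrow> bool" where
  "analytic_system X W F \<longleftrightarrow> finite F \<and>
     (\<forall>(E, G)\<in>F. finite E \<and> finite G \<and> (\<forall>f\<in>E \<union> G. analytic_map_on X R_mfd W f))"

definition locus :: "(('a \<Rightarrow> real) set \<times> ('a \<Rightarrow> real) set) set \<Rightarrow> 'a set" where
  "locus F = {x. \<exists>(E, G)\<in>F. (\<forall>f\<in>E. f x = 0) \<and> (\<forall>g\<in>G. g x > 0)}"

lemma semianalytic_iff_locus:
  "semianalytic X A \<longleftrightarrow> A \<subseteq> topspace (mtop X) \<and>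
     (\<forall>p\<in>topspace (mtop X). \<exists>W F. openin (mtop X) W \<and> p \<in> W \<and> analytic_system X W F \<and>
        A \<inter> W = W \<inter> locus F)"
proof -
  have "{x \<in> W. \<exists>(E, G)\<in>F. (\<forall>f\<in>E. f x = 0) \<and> (\<forall>g\<in>G. g x > 0)} = W \<inter> locus F"
    for W :: "'a set" and F :: "(('a \<Rightarrow> real) set \<times> ('a \<Rightarrow> real) set) set"
    by (simp add: locus_def Collect_conj_eq)
  then show ?thesis
    by (simp only: semianalytic_def analytic_system_def conj_assoc)
qed

lemma analytic_systemD:
  assumes "analytic_system X W F"
  shows "finite F" "(E, G) \<in> F \<Longrightarrow> finite E" "(E, G) \<in> F \<Longrightarrow> finite G"
    "(E, G) \<in> F \<Longrightarrow> f \<in> E \<union> G \<Longrightarrow> analytic_map_on X R_mfd W f"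
  using assms unfolding analytic_system_def by blast+

text \<open>Intersecting two finite unions of solution sets distributes: each pair of members
contributes the union of its equations and of its inequalities.\<close>

lemma semianalytic_Int:
  assumes "semianalytic X A" "semianalytic X B"
  shows "semianalytic X (A \<inter> B)"
  unfolding semianalytic_iff_locus
proof (intro conjI ballI)
  show "A \<inter> B \<subseteq> topspace (mtop X)" using assms by (auto simp: semianalytic_def)
next
  fix p assume p: "p \<in> topspace (mtop X)"
  obtain W F where W: "openin (mtop X) W" "p \<in> W" "analytic_system X W F" "A \<inter> W = W \<inter> locus F"
    using assms(1) p unfolding semianalytic_iff_locus by blast
  obtain W' F' where W': "openin (mtop X) W'" "p \<in> W'" "analytic_system X W' F'" "B \<inter> W' = W' \<inter> locus F'"
    using assms(2) p unfolding semianalytic_iff_locus by blast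
  let ?V = "W \<inter> W'" and ?F = "(\<lambda>((E, G), (E', G')). (E \<union> E', G \<union> G')) ` (F \<times> F')"
  have op: "openin (mtop X) ?V" using W(1) W'(1) by blast
  have locus: "locus ?F = locus F \<inter> locus F'"
  proof (intro equalityI subsetI)
    fix x assume "x \<in> locus ?F"
    then obtain E G E' G' where "(E, G) \<in> F" "(E', G') \<in> F'"
      "\<forall>f\<in>E \<union> E'. f x = 0" "\<forall>g\<in>G \<union> G'. g x > 0" unfolding locus_def by auto
    then show "x \<in> locus F \<inter> locus F'" unfolding locus_def by blast
  next
    fix x assume "x \<in> locus F \<inter> locus F'"
    then obtain E G E' G' where EG: "(E, G) \<in> F" "(E', G') \<in> F'"
      and *: "\<forall>f\<in>E. f x = 0" "\<forall>g\<in>G. g x > 0" "\<forall>f\<in>E'. f x = 0" "\<forall>g\<in>G'. g x > 0"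
      unfolding locus_def by blast
    from EG have "(E \<union> E', G \<union> G') \<in> ?F" by force
    then show "x \<in> locus ?F" unfolding locus_def mem_Collect_eq by (rule rev_bexI) (use * in auto)
  qed
  have "A \<inter> B \<inter> ?V = (A \<inter> W) \<inter> (B \<inter> W')" by blast
  also have "\<dots> = ?V \<inter> locus ?F" unfolding W(4) W'(4) locus by blast
  finally have eq: "A \<inter> B \<inter> ?V = ?V \<inter> locus ?F" .
  have "analytic_system X ?V ?F"
    unfolding analytic_system_def
  proof (intro conjI)
    show "finite ?F" using W(3) W'(3) by (simp add: analytic_systemD(1))
    show "\<forall>(E, G)\<in>?F. finite E \<and> finite G \<and> (\<forall>f\<in>E \<union> G. analytic_map_on X R_mfd ?V f)"
    proof (clarsimp, intro conjI ballI)
      fix E G E' G' f assume EG: "(E, G) \<in> F" "(E', G') \<in> F'"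
      show "finite E" "finite G" "finite E'" "finite G'"
        using analytic_systemD(2,3)[OF W(3)] analytic_systemD(2,3)[OF W'(3)] EG by blast+
      assume "f \<in> E \<union> E' \<union> (G \<union> G')"
      then have "analytic_map_on X R_mfd W f \<or> analytic_map_on X R_mfd W' f"
        using analytic_systemD(4)[OF W(3) EG(1)] analytic_systemD(4)[OF W'(3) EG(2)] by blast
      then show "analytic_map_on X R_mfd ?V f"
        using op by (auto intro: analytic_map_on_subset)
    qed
  qed
  then show "\<exists>W F. openin (mtop X) W \<and> p \<in> W \<and> analytic_system X W F \<and> A \<inter> B \<inter> W = W \<inter> locus F"
    using op W(2) W'(2) eq by blast
qed

lemma semianalytic_coord_proj_vimage:
  assumes X: "real_analytic_manifold X"
    and \<sigma>: "inj_on \<sigma> {..<k}" "\<sigma> ` {..<k} \<subseteq> {..<l}"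
    and B: "semianalytic (prod_mfd X (Rn_mfd k)) B"
  shows "semianalytic (prod_mfd X (Rn_mfd l))
    {p \<in> topspace (mtop (prod_mfd X (Rn_mfd l))). coord_proj \<sigma> k p \<in> B}" (is "semianalytic ?Z ?C")
  unfolding semianalytic_iff_locus
proof (intro conjI ballI)
  show "?C \<subseteq> topspace (mtop ?Z)" by blast
  let ?\<pi> = "coord_proj \<sigma> k"
  let ?Y = "prod_mfd X (Rn_mfd k)"
  fix p assume p: "p \<in> topspace (mtop ?Z)"
  then have "?\<pi> p \<in> topspace (mtop ?Y)"
    using continuous_map_funspace[OF continuous_map_coord_proj[of "mtop X" l k \<sigma>]] by auto
  then obtain W F where W: "openin (mtop ?Y) W" "?\<pi> p \<in> W" "analytic_system ?Y W F" "B \<inter> W = W \<inter> locus F"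
    using B unfolding semianalytic_iff_locus by blast
  let ?W = "{p \<in> topspace (mtop ?Z). ?\<pi> p \<in> W}"
  let ?c = "(`) (\<lambda>f. f \<circ> ?\<pi>)"
  let ?F = "(\<lambda>(E, G). (?c E, ?c G)) ` F"
  have op: "openin (mtop ?Z) ?W"
    using openin_continuous_map_preimage[OF continuous_map_coord_proj] W(1) by simp
  have locus: "x \<in> locus ?F \<longleftrightarrow> ?\<pi> x \<in> locus F" for x
    by (simp add: locus_def split_beta)
  have "?C \<inter> ?W = {x \<in> ?W. ?\<pi> x \<in> B \<inter> W}" by blast
  also have "\<dots> = ?W \<inter> locus ?F" unfolding W(4) using locus by blast
  finally have eq: "?C \<inter> ?W = ?W \<inter> locus ?F" .
  have "analytic_system ?Z ?W ?F"
    unfolding analytic_system_def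
  proof (intro conjI)
    show "finite ?F" using W(3) by (simp add: analytic_systemD(1))
    show "\<forall>(E, G)\<in>?F. finite E \<and> finite G \<and> (\<forall>f\<in>E \<union> G. analytic_map_on ?Z R_mfd ?W f)"
    proof (clarify, intro conjI ballI)
      fix E G f assume EG: "(E, G) \<in> F"
      show "finite (?c E)" "finite (?c G)" using analytic_systemD(2,3)[OF W(3) EG] by blast+
      assume "f \<in> ?c E \<union> ?c G"
      then obtain g where "f = g \<circ> ?\<pi>" "analytic_map_on ?Y R_mfd W g"
        using analytic_systemD(4)[OF W(3) EG] by blast
      then show "analytic_map_on ?Z R_mfd ?W f"
        using analytic_map_on_coord_proj[OF X \<sigma>] by blast
    qed
  qed
  then show "\<exists>W F. openin (mtop ?Z) W \<and> p \<in> W \<and> analytic_system ?Z W F \<and> ?C \<inter> W = W \<inter> locus F"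
    using op p W(2) eq by blast
qed

section \<open>Intersections of subanalytic sets\<close>

lemma relatively_compact_subset_compact:
  assumes "Hausdorff_space T" "compactin T K" "S \<subseteq> K"
  shows "relatively_compact_in T S (topspace T)"
proof -
  have "closedin T K" using assms by (simp add: compactin_imp_closedin)
  then have "T closure_of S \<subseteq> K" using assms(3) by (simp add: closure_of_minimal)
  then show ?thesis
    using assms closed_compactin[OF assms(2)] compactin_subset_topspace[OF assms(2)]
    by (auto simp: relatively_compact_in_def dest: closure_of_subset_topspace[THEN subsetD])
qed

lemma relatively_compact_mono:
  assumes "Hausdorff_space T" "relatively_compact_in T S W" "S' \<subseteq> S"
  shows "relatively_compact_in T S' (topspace T)"
  using assms closure_of_subset[of S T]
  by (intro relatively_compact_subset_compact[where K="T closure_of S"])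
     (auto simp: relatively_compact_in_def)

text \<open>Locally \<open>A\<close> and \<open>A'\<close> are the projections of \<open>B
\<subseteq> X \<times> \<real>\<^sup>m\<close> and \<open>B' \<subseteq> X \<times>
\<real>\<^sup>m\<^sup>'\<close>; their intersection is the projection of the fibre product of
\<open>B\<close> and \<open>B'\<close> over \<open>X\<close>. The fibre product is semianalytic as
an intersection of two preimages, and it lies in a continuous image of the product of the two
compact closures.\<close>

lemma subanalytic_Int:
  assumes X: "real_analytic_manifold X" and A: "subanalytic X A" and A': "subanalytic X A'"
  shows "subanalytic X (A \<inter> A')"
  unfolding subanalytic_def
proof (intro conjI ballI)
  show "A \<inter> A' \<subseteq> topspace (mtop X)" using A by (auto simp: subanalytic_def)
next
  fix p assume p: "p \<in> topspace (mtop X)"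
  let ?P = "\<lambda>m. prod_mfd X (Rn_mfd m)"
  let ?T = "mtop X"
  obtain U m B where U: "openin ?T U" "p \<in> U" and B: "semianalytic (?P m) B"
      "relatively_compact_in (mtop (?P m)) B (topspace (mtop (?P m)))" "A \<inter> U = fst ` B"
    using A p unfolding subanalytic_def by meson
  obtain U' m' B' where U': "openin ?T U'" "p \<in> U'" and B': "semianalytic (?P m') B'"
      "relatively_compact_in (mtop (?P m')) B' (topspace (mtop (?P m')))" "A' \<inter> U' = fst ` B'"
    using A' p unfolding subanalytic_def by meson
  let ?Z = "?P (m + m')"
  let ?\<pi> = "coord_proj (\<lambda>i. i) m" and ?\<pi>' = "coord_proj (\<lambda>i. m + i) m'"
  define C where "C = {q \<in> topspace (mtop ?Z). ?\<pi> q \<in> B} \<inter> {q \<in> topspace (mtop ?Z). ?\<pi>' q \<in> B'}"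
  define join where "join = (\<lambda>((x, y), (x'::'a, y')).
    (x::'a, \<lambda>i. if i < m + m' then (if i < m then y i else y' (i - m)) else (0::real)))"
  have C: "semianalytic ?Z C"
    unfolding C_def
    by (intro semianalytic_Int semianalytic_coord_proj_vimage X B(1) B'(1)) (auto intro: inj_onI)
  have haus: "Hausdorff_space ?T" using X by (simp add: real_analytic_manifold_def)
  have cont: "continuous_map (prod_topology (mtop (?P m)) (mtop (?P m'))) (mtop ?Z) join"
  proof -
    let ?D = "prod_topology (mtop (?P m)) (mtop (?P m'))"
    have c1: "continuous_map ?D ?T (\<lambda>q. fst (fst q))"
      using continuous_map_compose[OF continuous_map_fst continuous_map_fst] by (simp add: o_def)
    have c2: "continuous_map ?D (Euclidean_space m) (\<lambda>q. snd (fst q))"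
      using continuous_map_compose[OF continuous_map_fst continuous_map_snd] by (simp add: o_def)
    have c3: "continuous_map ?D (Euclidean_space m') (\<lambda>q. snd (snd q))"
      using continuous_map_compose[OF continuous_map_snd continuous_map_snd] by (simp add: o_def)
    have c2': "continuous_map ?D euclideanreal (\<lambda>q. snd (fst q) i)" for i
      using continuous_map_compose[OF c2 continuous_map_Euclidean_coord] by (simp add: o_def)
    have c3': "continuous_map ?D euclideanreal (\<lambda>q. snd (snd q) i)" for i
      using continuous_map_compose[OF c3 continuous_map_Euclidean_coord] by (simp add: o_def)
    have "continuous_map ?D euclideanreal (\<lambda>q. if i < m then snd (fst q) i else snd (snd q) (i - m))" for i
      by (cases "i < m") (use c2' c3' in auto)
    then have "continuous_map ?D (mtop ?Z) (\<lambda>q. (fst (fst q),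
        \<lambda>i. if i < m + m' then (if i < m then snd (fst q) i else snd (snd q) (i - m)) else 0))"
      unfolding mtop_prod_Rn
      by (intro continuous_map_pairedI c1[unfolded mtop_prod_Rn])
         (simp add: continuous_map_componentwise_Euclidean_space)
    then show ?thesis by (simp add: join_def case_prod_unfold)
  qed
  have join\<pi>: "join (?\<pi> q, ?\<pi>' q) = q" if "q \<in> topspace (mtop ?Z)" for q
    using that by (cases q) (auto simp: join_def coord_proj_def topspace_Euclidean_space fun_eq_iff)
  let ?K = "mtop (?P m) closure_of B" and ?K' = "mtop (?P m') closure_of B'"
  have "compactin (mtop ?Z) (join ` (?K \<times> ?K'))"
    by (rule image_compactin[OF _ cont])
       (use B(2) B'(2) in \<open>simp only: compactin_Times relatively_compact_in_def\<close>, simp)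
  moreover have "B \<subseteq> ?K" "B' \<subseteq> ?K'"
    using B(2) B'(2) by (simp_all only: relatively_compact_in_def closure_of_subset)
  then have "C \<subseteq> join ` (?K \<times> ?K')"
    using join\<pi> by (force simp: C_def intro!: image_eqI)
  moreover have "Hausdorff_space (mtop ?Z)"
    by (simp add: Hausdorff_space_prod_topology haus Hausdorff_Euclidean_space)
  ultimately have rc: "relatively_compact_in (mtop ?Z) C (topspace (mtop ?Z))"
    by (blast intro: relatively_compact_subset_compact)
  have "fst ` C = fst ` B \<inter> fst ` B'"
  proof (intro equalityI subsetI)
    fix x assume "x \<in> fst ` C"
    then obtain z where "?\<pi> (x, z) \<in> B" "?\<pi>' (x, z) \<in> B'" by (auto simp: C_def)
    then show "x \<in> fst ` B \<inter> fst ` B'" by (force simp: coord_proj_def)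
  next
    fix x assume "x \<in> fst ` B \<inter> fst ` B'"
    then obtain y y' where y: "(x, y) \<in> B" "(x, y') \<in> B'" by auto
    then have t: "x \<in> topspace ?T" "\<forall>i\<ge>m. y i = 0" "\<forall>i\<ge>m'. y' i = 0"
      using B(1) B'(1) by (auto simp: semianalytic_def topspace_Euclidean_space)
    let ?q = "join ((x, y), (x, y'))"
    have "?\<pi> ?q = (x, y)" "?\<pi>' ?q = (x, y')"
      using t by (auto simp: join_def coord_proj_def fun_eq_iff)
    moreover have "?q \<in> topspace (mtop ?Z)" using t by (auto simp: join_def topspace_Euclidean_space)
    ultimately have "?q \<in> C" using y by (simp add: C_def)
    moreover have "fst ?q = x" by (simp add: join_def)
    ultimately show "x \<in> fst ` C" by force
  qed
  then have "A \<inter> A' \<inter> (U \<inter> U') = fst ` C" using B(3) B'(3) by blast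
  moreover have "openin ?T (U \<inter> U')" "p \<in> U \<inter> U'" using U U' by blast+
  ultimately show "\<exists>U m B. openin ?T U \<and> p \<in> U \<and> semianalytic (?P m) B \<and>
        relatively_compact_in (mtop (?P m)) B (topspace (mtop (?P m))) \<and> A \<inter> A' \<inter> U = fst ` B"
    using C rc by meson
qed

lemma Op_sa_Int:
  assumes "real_analytic_manifold X" "U \<in> Op_sa X" "V \<in> Op_sa X"
  shows "U \<inter> V \<in> Op_sa X"
  using assms by (auto simp: Op_sa_def subanalytic_Int)

section \<open>Presheaves, morphisms and direct images\<close>

abbreviation sections :: "('a, 'k, 'p) psh \<Rightarrow> 'a set \<Rightarrow> 'p set" ("\<Gamma>") where
  "\<Gamma> F U \<equiv> carrier (sec F U)"

lemma linear_mapD: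
  assumes "linear_map K M N f"
  shows "x \<in> carrier M \<Longrightarrow> f x \<in> carrier N"
    "x \<in> carrier M \<Longrightarrow> y \<in> carrier M \<Longrightarrow> f (x \<oplus>\<^bsub>M\<^esub> y) = f x \<oplus>\<^bsub>N\<^esub> f y"
    "a \<in> carrier K \<Longrightarrow> x \<in> carrier M \<Longrightarrow> f (a \<odot>\<^bsub>M\<^esub> x) = a \<odot>\<^bsub>N\<^esub> f x"
  using assms by (auto simp: linear_map_def)

lemma linear_map_comp:
  "linear_map K L M f \<Longrightarrow> linear_map K M N g \<Longrightarrow> linear_map K L N (g \<circ> f)"
  by (auto simp: linear_map_def Pi_iff)

lemma linear_map_cong:
  assumes "linear_map K M N f" "Module.module K M" "\<And>x. x \<in> carrier M \<Longrightarrow> f x = g x"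
  shows "linear_map K M N g"
proof -
  interpret Module.module K M by fact
  show ?thesis using assms(1,3) by (auto simp: linear_map_def Pi_iff)
qed

lemma presheafD:
  assumes "is_presheaf K S F" and U: "U \<in> opens S"
  shows "Module.module K (sec F U)"
    "V \<in> opens S \<Longrightarrow> V \<subseteq> U \<Longrightarrow> linear_map K (sec F U) (sec F V) (res F U V)"
    "s \<in> \<Gamma> F U \<Longrightarrow> res F U U s = s"
    "V \<in> opens S \<Longrightarrow> W \<in> opens S \<Longrightarrow> W \<subseteq> V \<Longrightarrow> V \<subseteq> U \<Longrightarrow> s \<in> \<Gamma> F U
      \<Longrightarrow> res F V W (res F U V s) = res F U W s"
  using assms(1)[unfolded is_presheaf_def] U by simp_all

lemma presheaf_res_closed:
  "is_presheaf K S F \<Longrightarrow> U \<in> opens S \<Longrightarrow> V \<in> opens S \<Longrightarrow> V \<subseteq> U \<Longrightarrow> s \<in> \<Gamma> F U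
    \<Longrightarrow> res F U V s \<in> \<Gamma> F V"
  by (meson presheafD(2) linear_mapD(1))

lemma presheaf_add_closed:
  assumes "is_presheaf K S F" "U \<in> opens S" "s \<in> \<Gamma> F U" "t \<in> \<Gamma> F U"
  shows "s \<oplus>\<^bsub>sec F U\<^esub> t \<in> \<Gamma> F U"
proof -
  interpret Module.module K "sec F U" using assms by (rule_tac presheafD(1))
  show ?thesis using assms by simp
qed

lemma presheaf_smult_closed:
  assumes "is_presheaf K S F" "U \<in> opens S" "a \<in> carrier K" "s \<in> \<Gamma> F U"
  shows "a \<odot>\<^bsub>sec F U\<^esub> s \<in> \<Gamma> F U"
proof -
  interpret Module.module K "sec F U" using assms by (rule_tac presheafD(1))
  show ?thesis using assms by simp
qed

lemma presheaf_zero_closed: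
  assumes "is_presheaf K S F" "U \<in> opens S"
  shows "\<zero>\<^bsub>sec F U\<^esub> \<in> \<Gamma> F U"
proof -
  interpret Module.module K "sec F U" using assms by (rule_tac presheafD(1))
  show ?thesis by simp
qed

lemma sheaf_presheaf: "is_sheaf K S F \<Longrightarrow> is_presheaf K S F"
  by (simp add: is_sheaf_def)

lemma sheaf_ex1:
  assumes "is_sheaf K S F" "U \<in> opens S" "\<V> \<in> covers S U"
    and "(\<forall>V\<in>\<V>. s V \<in> \<Gamma> F V) \<and>
        (\<forall>V\<in>\<V>. \<forall>W\<in>\<V>. res F V (V \<inter> W) (s V) = res F W (V \<inter> W) (s W))"
  shows "\<exists>!t. t \<in> \<Gamma> F U \<and> (\<forall>V\<in>\<V>. res F U V t = s V)"
  using assms(1)[unfolded is_sheaf_def, THEN conjunct2, rule_format, OF assms(2,3,4)] .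

lemma psh_homI:
  assumes "f \<in> extensional (opens S)"
    and "\<And>U. U \<in> opens S \<Longrightarrow> f U \<in> extensional (\<Gamma> F U)"
    and "\<And>U. U \<in> opens S \<Longrightarrow> linear_map K (sec F U) (sec G U) (f U)"
    and "\<And>U V s. U \<in> opens S \<Longrightarrow> V \<in> opens S \<Longrightarrow> V \<subseteq> U \<Longrightarrow> s \<in> \<Gamma> F U
      \<Longrightarrow> f V (res F U V s) = res G U V (f U s)"
  shows "f \<in> psh_hom K S F G"
  using assms by (auto simp: psh_hom_def)

lemma psh_homD:
  assumes "f \<in> psh_hom K S F G"
  shows "U \<in> opens S \<Longrightarrow> s \<in> \<Gamma> F U \<Longrightarrow> f U s \<in> \<Gamma> G U"
    "U \<in> opens S \<Longrightarrow> linear_map K (sec F U) (sec G U) (f U)"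
    "U \<in> opens S \<Longrightarrow> s \<in> \<Gamma> F U \<Longrightarrow> t \<in> \<Gamma> F U
      \<Longrightarrow> f U (s \<oplus>\<^bsub>sec F U\<^esub> t) = f U s \<oplus>\<^bsub>sec G U\<^esub> f U t"
    "U \<in> opens S \<Longrightarrow> a \<in> carrier K \<Longrightarrow> s \<in> \<Gamma> F U
      \<Longrightarrow> f U (a \<odot>\<^bsub>sec F U\<^esub> s) = a \<odot>\<^bsub>sec G U\<^esub> f U s"
    "U \<in> opens S \<Longrightarrow> V \<in> opens S \<Longrightarrow> V \<subseteq> U \<Longrightarrow> s \<in> \<Gamma> F U
      \<Longrightarrow> f V (res F U V s) = res G U V (f U s)"
proof -
  have *: "\<forall>U\<in>opens S. linear_map K (sec F U) (sec G U) (f U)"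
    "\<forall>U\<in>opens S. \<forall>V\<in>opens S. V \<subseteq> U \<longrightarrow>
           (\<forall>s\<in>\<Gamma> F U. f V (res F U V s) = res G U V (f U s))"
    using assms by (simp_all add: psh_hom_def)
  show "U \<in> opens S \<Longrightarrow> s \<in> \<Gamma> F U \<Longrightarrow> f U s \<in> \<Gamma> G U"
    "U \<in> opens S \<Longrightarrow> linear_map K (sec F U) (sec G U) (f U)"
    "U \<in> opens S \<Longrightarrow> s \<in> \<Gamma> F U \<Longrightarrow> t \<in> \<Gamma> F U
      \<Longrightarrow> f U (s \<oplus>\<^bsub>sec F U\<^esub> t) = f U s \<oplus>\<^bsub>sec G U\<^esub> f U t"
    "U \<in> opens S \<Longrightarrow> a \<in> carrier K \<Longrightarrow> s \<in> \<Gamma> F U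
      \<Longrightarrow> f U (a \<odot>\<^bsub>sec F U\<^esub> s) = a \<odot>\<^bsub>sec G U\<^esub> f U s"
    "U \<in> opens S \<Longrightarrow> V \<in> opens S \<Longrightarrow> V \<subseteq> U \<Longrightarrow> s \<in> \<Gamma> F U
      \<Longrightarrow> f V (res F U V s) = res G U V (f U s)"
    using * linear_mapD[of K "sec F U" "sec G U" "f U"] by simp_all
qed

lemma psh_hom_eqI:
  assumes "f \<in> psh_hom K S F G" "g \<in> psh_hom K S F H"
    and "\<And>U s. U \<in> opens S \<Longrightarrow> s \<in> \<Gamma> F U \<Longrightarrow> f U s = g U s"
  shows "f = g"
proof -
  have "f U = g U" if "U \<in> opens S" for U
    using assms that by (intro extensionalityI[of _ "\<Gamma> F U"]) (auto simp: psh_hom_def)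
  then show ?thesis
    using assms by (intro extensionalityI[of _ "opens S"]) (auto simp: psh_hom_def)
qed

lemma psh_comp_apply:
  "U \<in> opens S \<Longrightarrow> s \<in> \<Gamma> F U \<Longrightarrow> psh_comp S F g f U s = g U (f U s)"
  by (simp add: psh_comp_def)

lemma psh_id_apply:
  "U \<in> opens S \<Longrightarrow> s \<in> \<Gamma> F U \<Longrightarrow> psh_id S F U s = s"
  by (simp add: psh_id_def)

lemma psh_id_in_hom:
  assumes "is_presheaf K S F" shows "psh_id S F \<in> psh_hom K S F F"
proof (rule psh_homI)
  fix U assume U: "U \<in> opens S"
  have "linear_map K (sec F U) (sec F U) (\<lambda>s. s)" by (simp add: linear_map_def)
  then show "linear_map K (sec F U) (sec F U) (psh_id S F U)"
    by (rule linear_map_cong[OF _ presheafD(1)[OF assms U]]) (simp add: psh_id_def U)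
qed (auto simp: psh_id_def presheaf_res_closed[OF assms])

lemma psh_comp_in_hom:
  assumes F: "is_presheaf K S F" and f: "f \<in> psh_hom K S F G" and g: "g \<in> psh_hom K S G H"
  shows "psh_comp S F g f \<in> psh_hom K S F H"
proof (rule psh_homI)
  fix U assume U: "U \<in> opens S"
  show "linear_map K (sec F U) (sec H U) (psh_comp S F g f U)"
    by (rule linear_map_cong[OF linear_map_comp[OF psh_homD(2)[OF f U] psh_homD(2)[OF g U]]
          presheafD(1)[OF F U]]) (simp add: psh_comp_def U)
qed (auto simp: psh_comp_def presheaf_res_closed[OF F] psh_homD[OF f] psh_homD[OF g])

lemma psh_comp_assoc:
  assumes "\<And>U s. U \<in> opens S \<Longrightarrow> s \<in> \<Gamma> F U \<Longrightarrow> f U s \<in> \<Gamma> G U"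
  shows "psh_comp S F h (psh_comp S F g f) = psh_comp S F (psh_comp S G h g) f"
  using assms by (auto simp: psh_comp_def fun_eq_iff restrict_def)

lemma psh_comp_id_left:
  assumes "is_presheaf K S F" "is_presheaf K S G" "f \<in> psh_hom K S F G"
  shows "psh_comp S F (psh_id S G) f = f"
  by (rule psh_hom_eqI[OF psh_comp_in_hom[OF assms(1,3) psh_id_in_hom[OF assms(2)]] assms(3)])
    (simp add: psh_comp_apply psh_id_apply psh_homD(1)[OF assms(3)])

lemma psh_comp_id_right:
  assumes "is_presheaf K S F" "f \<in> psh_hom K S F G"
  shows "psh_comp S F f (psh_id S F) = f"
  by (rule psh_hom_eqI[OF psh_comp_in_hom[OF assms(1) psh_id_in_hom[OF assms(1)] assms(2)] assms(2)])
    (simp add: psh_comp_apply psh_id_apply)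

lemma sheaf_cat_simps:
  "F \<in> Obj (sheaf_cat K S) \<longleftrightarrow> is_sheaf K S F"
  "Arr (sheaf_cat K S) = psh_hom K S"
  "Idt (sheaf_cat K S) = psh_id S"
  "Cmp (sheaf_cat K S) F G H g f = psh_comp S F g f"
  by (simp_all add: sheaf_cat_def)

lemma category_sheaf_cat: "category (sheaf_cat K S)"
  unfolding category_def sheaf_cat_simps
proof (intro conjI ballI, unfold sheaf_cat_simps)
  fix A assume "is_sheaf K S A"
  then show "psh_id S A \<in> psh_hom K S A A" by (intro psh_id_in_hom sheaf_presheaf)
next
  fix A B D f g assume "is_sheaf K S A" "f \<in> psh_hom K S A B" "g \<in> psh_hom K S B D"
  then show "psh_comp S A g f \<in> psh_hom K S A D" by (intro psh_comp_in_hom sheaf_presheaf)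
next
  fix A B f assume "is_sheaf K S A" "is_sheaf K S B" "f \<in> psh_hom K S A B"
  note hyps = sheaf_presheaf[OF this(1)] sheaf_presheaf[OF this(2)] this(3)
  show "psh_comp S A f (psh_id S A) = f" by (rule psh_comp_id_right[OF hyps(1,3)])
  show "psh_comp S A (psh_id S B) f = f" by (rule psh_comp_id_left[OF hyps])
next
  fix A B D E f g h assume f: "f \<in> psh_hom K S A B"
  show "psh_comp S A h (psh_comp S A g f) = psh_comp S A (psh_comp S B h g) f"
    by (rule psh_comp_assoc[OF psh_homD(1)[OF f]])
qed

lemma category_full_subcat: "category C \<Longrightarrow> category (full_subcat C P)"
  unfolding category_def full_subcat_def by simp

lemma direct_image_psh_simps:
  "U \<in> opens S' \<Longrightarrow> sec (direct_image_psh S' F) U = sec F U"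
  "U \<in> opens S' \<Longrightarrow> V \<in> opens S' \<Longrightarrow> res (direct_image_psh S' F) U V = res F U V"
  by (simp_all add: direct_image_psh_def)

text \<open>The action of the direct image on morphisms.\<close>

definition hom_restrict :: "'a site \<Rightarrow> ('a set \<Rightarrow> 'p \<Rightarrow> 'q) \<Rightarrow> 'a set \<Rightarrow> 'p \<Rightarrow> 'q" where
  "hom_restrict S' f = (\<lambda>U\<in>opens S'. f U)"

lemma hom_restrict_apply: "U \<in> opens S' \<Longrightarrow> hom_restrict S' f U = f U"
  by (simp add: hom_restrict_def)

lemma is_presheaf_direct_image:
  "opens S' \<subseteq> opens S \<Longrightarrow> is_presheaf K S F \<Longrightarrow> is_presheaf K S' (direct_image_psh S' F)"
  unfolding is_presheaf_def by (simp add: direct_image_psh_simps subset_iff)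

lemma hom_restrict_in_hom:
  assumes "opens S' \<subseteq> opens S" "f \<in> psh_hom K S F G"
  shows "hom_restrict S' f \<in> psh_hom K S' (direct_image_psh S' F) (direct_image_psh S' G)"
proof -
  have sub: "U \<in> opens S" if "U \<in> opens S'" for U using assms(1) that by blast
  show ?thesis
  proof (rule psh_homI)
    show "hom_restrict S' f \<in> extensional (opens S')" by (simp add: hom_restrict_def)
    fix U assume U: "U \<in> opens S'"
    show "hom_restrict S' f U \<in> extensional (\<Gamma> (direct_image_psh S' F) U)"
      using assms(2) sub[OF U] by (simp add: U hom_restrict_apply direct_image_psh_simps psh_hom_def)
    show "linear_map K (sec (direct_image_psh S' F) U) (sec (direct_image_psh S' G) U) (hom_restrict S' f U)"
      using psh_homD(2)[OF assms(2) sub[OF U]] by (simp add: U hom_restrict_apply direct_image_psh_simps)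
  qed (simp add: hom_restrict_apply direct_image_psh_simps psh_homD(5)[OF assms(2)] sub)
qed

lemma hom_restrict_comp:
  assumes "opens S' \<subseteq> opens S"
  shows "hom_restrict S' (psh_comp S F g f) =
    psh_comp S' (direct_image_psh S' F) (hom_restrict S' g) (hom_restrict S' f)"
proof (intro ext)
  fix U s show "hom_restrict S' (psh_comp S F g f) U s =
    psh_comp S' (direct_image_psh S' F) (hom_restrict S' g) (hom_restrict S' f) U s"
    using assms by (cases "U \<in> opens S'")
      (auto simp: hom_restrict_def psh_comp_def direct_image_psh_simps restrict_def)
qed

lemma hom_restrict_id:
  assumes "opens S' \<subseteq> opens S"
  shows "hom_restrict S' (psh_id S F) = psh_id S' (direct_image_psh S' F)"
proof (intro ext)
  fix U s show "hom_restrict S' (psh_id S F) U s = psh_id S' (direct_image_psh S' F) U s"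
    using assms by (cases "U \<in> opens S'")
      (auto simp: hom_restrict_def psh_id_def direct_image_psh_simps restrict_def)
qed

text \<open>Coverings in the smaller site are coverings in the larger one, so the sheaf condition
is inherited.\<close>

lemma is_sheaf_direct_image:
  assumes sub: "opens S' \<subseteq> opens S" and int: "\<And>U V. U \<in> opens S' \<Longrightarrow> V \<in> opens S' \<Longrightarrow> U \<inter> V \<in> opens S'"
    and cov: "\<And>U \<V>. U \<in> opens S' \<Longrightarrow> \<V> \<in> covers S' U \<Longrightarrow> \<V> \<in> covers S U \<and> \<V> \<subseteq> opens S'"
    and F: "is_sheaf K S F"
  shows "is_sheaf K S' (direct_image_psh S' F)"
  unfolding is_sheaf_def
proof (intro conjI ballI allI impI)
  show "is_presheaf K S' (direct_image_psh S' F)"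
    using is_presheaf_direct_image[OF sub sheaf_presheaf[OF F]] .
next
  fix U \<V> s
  let ?F = "direct_image_psh S' F"
  assume U: "U \<in> opens S'" and V: "\<V> \<in> covers S' U"
    and s: "(\<forall>V\<in>\<V>. s V \<in> \<Gamma> ?F V) \<and>
        (\<forall>V\<in>\<V>. \<forall>W\<in>\<V>. res ?F V (V \<inter> W) (s V) = res ?F W (V \<inter> W) (s W))"
  have V': "\<And>V. V \<in> \<V> \<Longrightarrow> V \<in> opens S'" using cov[OF U V] by blast
  have "(\<forall>V\<in>\<V>. s V \<in> \<Gamma> F V) \<and>
        (\<forall>V\<in>\<V>. \<forall>W\<in>\<V>. res F V (V \<inter> W) (s V) = res F W (V \<inter> W) (s W))"
  proof (intro conjI ballI)
    fix V assume V: "V \<in> \<V>"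
    have "s V \<in> \<Gamma> ?F V" using s V by blast
    then show "s V \<in> \<Gamma> F V" by (simp only: direct_image_psh_simps V'[OF V])
    fix W assume W: "W \<in> \<V>"
    have "res ?F V (V \<inter> W) (s V) = res ?F W (V \<inter> W) (s W)" using s V W by blast
    then show "res F V (V \<inter> W) (s V) = res F W (V \<inter> W) (s W)"
      by (simp only: direct_image_psh_simps V'[OF V] V'[OF W] int)
  qed
  then have "\<exists>!t. t \<in> \<Gamma> F U \<and> (\<forall>V\<in>\<V>. res F U V t = s V)"
    by (rule sheaf_ex1[OF F _ conjunct1[OF cov[OF U V]], rotated -1]) (use U sub in blast)
  then show "\<exists>!t. t \<in> \<Gamma> ?F U \<and> (\<forall>V\<in>\<V>. res ?F U V t = s V)"
    using U V' by (simp add: direct_image_psh_simps)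
qed

section \<open>Morphisms out of an inverse image presheaf\<close>

lemma germ_at_iff:
  "(V', s') \<in> germ_at S' F U (V, s) \<longleftrightarrow> V' \<in> opens S' \<and> U \<subseteq> V' \<and> s' \<in> \<Gamma> F V' \<and>
     (\<exists>W\<in>opens S'. U \<subseteq> W \<and> W \<subseteq> V \<inter> V' \<and> res F V W s = res F V' W s')"
  by (simp add: germ_at_def)

text \<open>The adjunction between the inverse image presheaf and the direct image, in both
directions. A morphism out of the colimits \<open>colim F(V)\<close> is determined by its values
on the germs of sections over \<open>V\<close> itself; conversely, a family of maps \<open>F(V)
\<rightarrow> H(V)\<close> is extended to germs over smaller open sets by restricting in
\<open>H\<close>.\<close>

definition hom_flat ::
    "'a site \<Rightarrow> ('a, 'k, 'p) psh \<Rightarrow> ('a set \<Rightarrow> ('a set \<times> 'p) set \<Rightarrow> 'q) \<Rightarrow> 'a set \<Rightarrow> 'p \<Rightarrow> 'q" where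
  "hom_flat S' F f = (\<lambda>V\<in>opens S'. \<lambda>s\<in>\<Gamma> F V. f V (germ_at S' F V (V, s)))"

definition hom_sharp ::
    "'a site \<Rightarrow> 'a site \<Rightarrow> ('a, 'k, 'p) psh \<Rightarrow> ('a, 'k, 'q) psh \<Rightarrow> ('a set \<Rightarrow> 'p \<Rightarrow> 'q) \<Rightarrow>
     'a set \<Rightarrow> ('a set \<times> 'p) set \<Rightarrow> 'q" where
  "hom_sharp S S' F H h = (\<lambda>U\<in>opens S. \<lambda>C\<in>carrier (pullback_sec S' F U).
     THE t. \<exists>V s. V \<in> opens S' \<and> U \<subseteq> V \<and> s \<in> \<Gamma> F V \<and> C = germ_at S' F U (V, s) \<and>
       t = res H V U (h V s))"

locale site_inclusion =
  fixes S S' :: "'a site"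
  assumes opens_sub: "opens S' \<subseteq> opens S"
    and opens_Int: "U \<in> opens S' \<Longrightarrow> V \<in> opens S' \<Longrightarrow> U \<inter> V \<in> opens S'"

locale presheaf_on_target = site_inclusion S S' for S S' :: "'a site" +
  fixes K :: "('k, 'z) ring_scheme" and F :: "('a, 'k, 'p) psh"
  assumes F: "is_presheaf K S' F"
begin

lemma germ_self:
  assumes "V \<in> opens S'" "U \<subseteq> V" "s \<in> \<Gamma> F V"
  shows "(V, s) \<in> germ_at S' F U (V, s)"
  unfolding germ_at_iff using assms by blast

text \<open>Equality of germs is transitive because the opens of the smaller site are closed under
intersection: two witnesses of equality are both restricted to their intersection.\<close>

lemma germ_subset:
  assumes V: "V \<in> opens S'" "s \<in> \<Gamma> F V" and V': "V' \<in> opens S'" "s' \<in> \<Gamma> F V'"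
    and W: "W \<in> opens S'" "U \<subseteq> W" "W \<subseteq> V" "W \<subseteq> V'" and eq: "res F V W s = res F V' W s'"
  shows "germ_at S' F U (V, s) \<subseteq> germ_at S' F U (V', s')"
proof (rule subrelI)
  fix V2 s2 assume "(V2, s2) \<in> germ_at S' F U (V, s)"
  then obtain W2 where V2: "V2 \<in> opens S'" "U \<subseteq> V2" "s2 \<in> \<Gamma> F V2"
    and W2: "W2 \<in> opens S'" "U \<subseteq> W2" "W2 \<subseteq> V" "W2 \<subseteq> V2" and eq2: "res F V W2 s = res F V2 W2 s2"
    unfolding germ_at_iff by blast
  let ?W = "W \<inter> W2"
  have o: "?W \<in> opens S'" using W W2 opens_Int by blast
  have "res F V' ?W s' = res F W ?W (res F V' W s')"
    by (rule presheafD(4)[OF F V'(1) W(1) o _ W(4) V'(2), symmetric]) blast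
  also have "\<dots> = res F V ?W s"
    unfolding eq[symmetric] by (rule presheafD(4)[OF F V(1) W(1) o _ W(3) V(2)]) blast
  also have "\<dots> = res F W2 ?W (res F V W2 s)"
    by (rule presheafD(4)[OF F V(1) W2(1) o _ W2(3) V(2), symmetric]) blast
  also have "\<dots> = res F V2 ?W s2"
    unfolding eq2 by (rule presheafD(4)[OF F V2(1) W2(1) o _ W2(4) V2(3)]) blast
  finally have "res F V' ?W s' = res F V2 ?W s2" .
  moreover have "U \<subseteq> ?W" "?W \<subseteq> V' \<inter> V2" using W W2 by blast+
  ultimately show "(V2, s2) \<in> germ_at S' F U (V', s')"
    unfolding germ_at_iff using V2 o by blast
qed

lemma germ_eqI:
  assumes "V \<in> opens S'" "s \<in> \<Gamma> F V" "V' \<in> opens S'" "s' \<in> \<Gamma> F V'"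
    and "W \<in> opens S'" "U \<subseteq> W" "W \<subseteq> V" "W \<subseteq> V'" and "res F V W s = res F V' W s'"
  shows "germ_at S' F U (V, s) = germ_at S' F U (V', s')"
  using assms by (intro equalityI germ_subset[where W=W]) (assumption | rule sym)+

lemma germ_memberE:
  assumes "(V', s') \<in> germ_at S' F U (V, s)"
  obtains W where "V' \<in> opens S'" "U \<subseteq> V'" "s' \<in> \<Gamma> F V'"
    "W \<in> opens S'" "U \<subseteq> W" "W \<subseteq> V" "W \<subseteq> V'" "res F V W s = res F V' W s'"
  using assms unfolding germ_at_iff by blast

lemma UN_germ:
  assumes "V \<in> opens S'" "U \<subseteq> V" "s \<in> \<Gamma> F V"
    and "\<And>V' s'. (V', s') \<in> germ_at S' F U (V, s) \<Longrightarrow> \<phi> V' s' = \<phi>0"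
  shows "(\<Union>(V', s')\<in>germ_at S' F U (V, s). \<phi> V' s') = \<phi>0"
  using germ_self[OF assms(1-3)] assms(4) by blast

lemma pullback_carrierI:
  "V \<in> opens S' \<Longrightarrow> U \<subseteq> V \<Longrightarrow> s \<in> \<Gamma> F V \<Longrightarrow> germ_at S' F U (V, s) \<in> carrier (pullback_sec S' F U)"
  unfolding pullback_sec_def by auto

lemma pullback_carrierE:
  assumes "C \<in> carrier (pullback_sec S' F U)"
  obtains V s where "V \<in> opens S'" "U \<subseteq> V" "s \<in> \<Gamma> F V" "C = germ_at S' F U (V, s)"
  using assms unfolding pullback_sec_def by auto

lemma pullback_res_germ:
  assumes V: "V \<in> opens S'" "U \<subseteq> V" "s \<in> \<Gamma> F V" and U': "U' \<subseteq> U"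
  shows "res (pullback_psh S' F) U U' (germ_at S' F U (V, s)) = germ_at S' F U' (V, s)"
proof -
  have "(\<Union>(V', s')\<in>germ_at S' F U (V, s). germ_at S' F U' (V', s')) = germ_at S' F U' (V, s)"
  proof (rule UN_germ[OF V])
    fix V' s' assume "(V', s') \<in> germ_at S' F U (V, s)"
    then obtain W where W: "V' \<in> opens S'" "U \<subseteq> V'" "s' \<in> \<Gamma> F V'"
      "W \<in> opens S'" "U \<subseteq> W" "W \<subseteq> V" "W \<subseteq> V'" "res F V W s = res F V' W s'" by (rule germ_memberE)
    show "germ_at S' F U' (V', s') = germ_at S' F U' (V, s)"
      by (rule germ_eqI[OF W(1,3) V(1,3) W(4) _ W(7,6) W(8)[symmetric]]) (use W(5) U' in blast)
  qed
  then show ?thesis by (simp add: pullback_psh_def)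
qed

text \<open>The operations of the inverse image presheaf are unions over all representatives; they
can be computed on any representatives, since changing these does not change the germ of the
result.\<close>

lemma pullback_add_germ:
  assumes V: "V \<in> opens S'" "U \<subseteq> V" "s \<in> \<Gamma> F V"
    and V': "V' \<in> opens S'" "U \<subseteq> V'" "s' \<in> \<Gamma> F V'"
  shows "germ_at S' F U (V, s) \<oplus>\<^bsub>pullback_sec S' F U\<^esub> germ_at S' F U (V', s') =
    germ_at S' F U (V \<inter> V', res F V (V \<inter> V') s \<oplus>\<^bsub>sec F (V \<inter> V')\<^esub> res F V' (V \<inter> V') s')"
proof -
  let ?g = "\<lambda>V s V' s'. germ_at S' F U (V \<inter> V', res F V (V \<inter> V') s \<oplus>\<^bsub>sec F (V \<inter> V')\<^esub> res F V' (V \<inter> V') s')"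
  have closed: "V \<inter> V' \<in> opens S'" "res F V (V \<inter> V') s \<oplus>\<^bsub>sec F (V \<inter> V')\<^esub> res F V' (V \<inter> V') s' \<in> \<Gamma> F (V \<inter> V')"
    "res F V (V \<inter> V') s \<in> \<Gamma> F (V \<inter> V')" "res F V' (V \<inter> V') s' \<in> \<Gamma> F (V \<inter> V')"
    if "V \<in> opens S'" "s \<in> \<Gamma> F V" "V' \<in> opens S'" "s' \<in> \<Gamma> F V'" for V s V' s'
  proof -
    show o: "V \<inter> V' \<in> opens S'" using that opens_Int by blast
    show "res F V (V \<inter> V') s \<in> \<Gamma> F (V \<inter> V')" "res F V' (V \<inter> V') s' \<in> \<Gamma> F (V \<inter> V')"
      using presheaf_res_closed[OF F] that o by simp_all
    then show "res F V (V \<inter> V') s \<oplus>\<^bsub>sec F (V \<inter> V')\<^esub> res F V' (V \<inter> V') s' \<in> \<Gamma> F (V \<inter> V')"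
      by (rule presheaf_add_closed[OF F o])
  qed
  have res: "res F (V \<inter> V') W (res F V (V \<inter> V') s \<oplus>\<^bsub>sec F (V \<inter> V')\<^esub> res F V' (V \<inter> V') s') =
      res F V W s \<oplus>\<^bsub>sec F W\<^esub> res F V' W s'"
    if "V \<in> opens S'" "s \<in> \<Gamma> F V" "V' \<in> opens S'" "s' \<in> \<Gamma> F V'"
      "W \<in> opens S'" "W \<subseteq> V" "W \<subseteq> V'" for V s V' s' W
  proof -
    have W: "W \<subseteq> V \<inter> V'" using that by blast
    note c = closed[OF that(1-4)]
    show ?thesis
      unfolding linear_mapD(2)[OF presheafD(2)[OF F c(1) that(5) W] c(3,4)]
      by (simp only: presheafD(4)[OF F that(1) c(1) that(5) W _ that(2)] presheafD(4)[OF F that(3) c(1) that(5) W _ that(4)] Int_lower1 Int_lower2)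
  qed
  have "(\<Union>(V1, s1)\<in>germ_at S' F U (V, s). \<Union>(V1', s1')\<in>germ_at S' F U (V', s'). ?g V1 s1 V1' s1') = ?g V s V' s'"
  proof (rule UN_germ[OF V], rule UN_germ[OF V'])
    fix V1 s1 V1' s1'
    assume "(V1, s1) \<in> germ_at S' F U (V, s)" and "(V1', s1') \<in> germ_at S' F U (V', s')"
    from this(1) obtain W where W: "V1 \<in> opens S'" "U \<subseteq> V1" "s1 \<in> \<Gamma> F V1"
      "W \<in> opens S'" "U \<subseteq> W" "W \<subseteq> V" "W \<subseteq> V1" "res F V W s = res F V1 W s1" by (rule germ_memberE)
    from \<open>(V1', s1') \<in> _\<close> obtain W' where W': "V1' \<in> opens S'" "U \<subseteq> V1'" "s1' \<in> \<Gamma> F V1'"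
      "W' \<in> opens S'" "U \<subseteq> W'" "W' \<subseteq> V'" "W' \<subseteq> V1'" "res F V' W' s' = res F V1' W' s1'" by (rule germ_memberE)
    let ?W = "W \<inter> W'"
    have o: "?W \<in> opens S'" using W W' opens_Int by blast
    have sub: "?W \<subseteq> W" "?W \<subseteq> W'" "?W \<subseteq> V" "?W \<subseteq> V1" "?W \<subseteq> V'" "?W \<subseteq> V1'" "U \<subseteq> ?W"
      "?W \<subseteq> V \<inter> V'" "?W \<subseteq> V1 \<inter> V1'" using W W' by blast+
    have 1: "res F V ?W s = res F V1 ?W s1"
      using presheafD(4)[OF F V(1) W(4) o sub(1) W(6) V(3)] presheafD(4)[OF F W(1,4) o sub(1) W(7,3)] W(8) by simp
    have 2: "res F V' ?W s' = res F V1' ?W s1'"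
      using presheafD(4)[OF F V'(1) W'(4) o sub(2) W'(6) V'(3)] presheafD(4)[OF F W'(1,4) o sub(2) W'(7,3)] W'(8) by simp
    note c1 = closed[OF W(1,3) W'(1,3)] and c = closed[OF V(1,3) V'(1,3)]
    show "?g V1 s1 V1' s1' = ?g V s V' s'"
    proof (rule germ_eqI[OF c1(1,2) c(1,2) o sub(7,9,8)])
      show "res F (V1 \<inter> V1') ?W (res F V1 (V1 \<inter> V1') s1 \<oplus>\<^bsub>sec F (V1 \<inter> V1')\<^esub> res F V1' (V1 \<inter> V1') s1') =
        res F (V \<inter> V') ?W (res F V (V \<inter> V') s \<oplus>\<^bsub>sec F (V \<inter> V')\<^esub> res F V' (V \<inter> V') s')"
        unfolding res[OF W(1,3) W'(1,3) o sub(4,6)] res[OF V(1,3) V'(1,3) o sub(3,5)] 1 2 ..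
    qed
  qed
  then show ?thesis by (simp add: pullback_sec_def)
qed

lemma pullback_smult_germ:
  assumes V: "V \<in> opens S'" "U \<subseteq> V" "s \<in> \<Gamma> F V" and a: "a \<in> carrier K"
  shows "a \<odot>\<^bsub>pullback_sec S' F U\<^esub> germ_at S' F U (V, s) = germ_at S' F U (V, a \<odot>\<^bsub>sec F V\<^esub> s)"
proof -
  have "(\<Union>(V', s')\<in>germ_at S' F U (V, s). germ_at S' F U (V', a \<odot>\<^bsub>sec F V'\<^esub> s')) =
      germ_at S' F U (V, a \<odot>\<^bsub>sec F V\<^esub> s)"
  proof (rule UN_germ[OF V])
    fix V' s' assume "(V', s') \<in> germ_at S' F U (V, s)"
    then obtain W where W: "V' \<in> opens S'" "U \<subseteq> V'" "s' \<in> \<Gamma> F V'"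
      "W \<in> opens S'" "U \<subseteq> W" "W \<subseteq> V" "W \<subseteq> V'" "res F V W s = res F V' W s'" by (rule germ_memberE)
    show "germ_at S' F U (V', a \<odot>\<^bsub>sec F V'\<^esub> s') = germ_at S' F U (V, a \<odot>\<^bsub>sec F V\<^esub> s)"
      by (rule germ_eqI[OF W(1) presheaf_smult_closed[OF F W(1) a W(3)] V(1) presheaf_smult_closed[OF F V(1) a V(3)] W(4,5,7,6)])
        (simp only: linear_mapD(3)[OF presheafD(2)[OF F W(1,4,7)] a W(3)] linear_mapD(3)[OF presheafD(2)[OF F V(1) W(4,6)] a V(3)] W(8))
  qed
  then show ?thesis by (simp add: pullback_sec_def)
qed

lemma hom_flat_apply:
  "V \<in> opens S' \<Longrightarrow> s \<in> \<Gamma> F V \<Longrightarrow> hom_flat S' F f V s = f V (germ_at S' F V (V, s))"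
  by (simp add: hom_flat_def)

text \<open>A germ over \<open>U\<close> of a section over \<open>V\<close> is the restriction of
its germ over \<open>V\<close>, so naturality expresses every value of a morphism through its
adjoint.\<close>

lemma hom_on_germ:
  assumes f: "f \<in> psh_hom K S (pullback_psh S' F) H"
    and U: "U \<in> opens S" and V: "V \<in> opens S'" "U \<subseteq> V" "s \<in> \<Gamma> F V"
  shows "f U (germ_at S' F U (V, s)) = res H V U (hom_flat S' F f V s)"
proof -
  have VS: "V \<in> opens S" using V opens_sub by blast
  have "germ_at S' F V (V, s) \<in> \<Gamma> (pullback_psh S' F) V"
    using V pullback_carrierI by (simp add: pullback_psh_def)
  from psh_homD(5)[OF f VS U V(2) this]
  show ?thesis
    by (simp only: pullback_res_germ[OF V(1) subset_refl V(3,2)] hom_flat_apply[OF V(1,3)])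
qed

lemma hom_flat_in_hom:
  assumes f: "f \<in> psh_hom K S (pullback_psh S' F) H"
  shows "hom_flat S' F f \<in> psh_hom K S' F (direct_image_psh S' H)"
proof (rule psh_homI)
  show "hom_flat S' F f \<in> extensional (opens S')" by (simp add: hom_flat_def)
  fix V assume V: "V \<in> opens S'"
  then have VS: "V \<in> opens S" using opens_sub by blast
  show "hom_flat S' F f V \<in> extensional (\<Gamma> F V)" by (simp add: hom_flat_def V)
  have g: "germ_at S' F V (V, s) \<in> \<Gamma> (pullback_psh S' F) V" if "s \<in> \<Gamma> F V" for s
    using V that pullback_carrierI by (simp add: pullback_psh_def)
  show "linear_map K (sec F V) (sec (direct_image_psh S' H) V) (hom_flat S' F f V)"
    unfolding linear_map_def direct_image_psh_simps(1)[OF V]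
  proof (intro conjI ballI funcsetI)
    fix s assume s: "s \<in> \<Gamma> F V"
    show "hom_flat S' F f V s \<in> \<Gamma> H V"
      unfolding hom_flat_apply[OF V s] by (rule psh_homD(1)[OF f VS g[OF s]])
    { fix t assume t: "t \<in> \<Gamma> F V"
      have st: "s \<oplus>\<^bsub>sec F V\<^esub> t \<in> \<Gamma> F V" by (rule presheaf_add_closed[OF F V s t])
      have "germ_at S' F V (V, s \<oplus>\<^bsub>sec F V\<^esub> t) = germ_at S' F V (V, s) \<oplus>\<^bsub>sec (pullback_psh S' F) V\<^esub> germ_at S' F V (V, t)"
        using pullback_add_germ[OF V subset_refl s V subset_refl t] presheafD(3)[OF F V] s t
        by (simp add: pullback_psh_def)
      then show "hom_flat S' F f V (s \<oplus>\<^bsub>sec F V\<^esub> t) = hom_flat S' F f V s \<oplus>\<^bsub>sec H V\<^esub> hom_flat S' F f V t"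
        unfolding hom_flat_apply[OF V s] hom_flat_apply[OF V t] hom_flat_apply[OF V st]
        using psh_homD(3)[OF f VS g[OF s] g[OF t]] by simp }
    { fix a assume a: "a \<in> carrier K"
      have as: "a \<odot>\<^bsub>sec F V\<^esub> s \<in> \<Gamma> F V" by (rule presheaf_smult_closed[OF F V a s])
      have "germ_at S' F V (V, a \<odot>\<^bsub>sec F V\<^esub> s) = a \<odot>\<^bsub>sec (pullback_psh S' F) V\<^esub> germ_at S' F V (V, s)"
        using pullback_smult_germ[OF V subset_refl s a] by (simp add: pullback_psh_def)
      then show "hom_flat S' F f V (a \<odot>\<^bsub>sec F V\<^esub> s) = a \<odot>\<^bsub>sec H V\<^esub> hom_flat S' F f V s"
        unfolding hom_flat_apply[OF V s] hom_flat_apply[OF V as]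
        using psh_homD(4)[OF f VS a g[OF s]] by simp }
  qed
  fix W s assume W: "W \<in> opens S'" "W \<subseteq> V" and s: "s \<in> \<Gamma> F V"
  have WS: "W \<in> opens S" using W opens_sub by blast
  have rs: "res F V W s \<in> \<Gamma> F W" by (rule presheaf_res_closed[OF F V W s])
  have "germ_at S' F W (W, res F V W s) = germ_at S' F W (V, s)"
    by (rule germ_eqI[OF W(1) rs V s W(1) subset_refl subset_refl W(2)]) (rule presheafD(3)[OF F W(1) rs])
  then have "hom_flat S' F f W (res F V W s) = f W (germ_at S' F W (V, s))"
    by (simp only: hom_flat_apply[OF W(1) rs])
  then show "hom_flat S' F f W (res F V W s) = res (direct_image_psh S' H) V W (hom_flat S' F f V s)"
    by (simp only: direct_image_psh_simps(2)[OF V W(1)] hom_on_germ[OF f WS V W(2) s])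
qed

lemma hom_flat_inj:
  assumes f: "f \<in> psh_hom K S (pullback_psh S' F) H" and g: "g \<in> psh_hom K S (pullback_psh S' F) H"
    and eq: "hom_flat S' F f = hom_flat S' F g"
  shows "f = g"
proof (rule psh_hom_eqI[OF f g])
  fix U C assume U: "U \<in> opens S" and "C \<in> \<Gamma> (pullback_psh S' F) U"
  then have "C \<in> carrier (pullback_sec S' F U)" by (simp add: pullback_psh_def)
  then obtain V s where V: "V \<in> opens S'" "U \<subseteq> V" "s \<in> \<Gamma> F V" and C: "C = germ_at S' F U (V, s)"
    by (rule pullback_carrierE)
  show "f U C = g U C" unfolding C hom_on_germ[OF f U V] hom_on_germ[OF g U V] eq ..
qed

lemma hom_sharp_germ:
  assumes H: "is_presheaf K S H" and h: "h \<in> psh_hom K S' F (direct_image_psh S' H)"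
    and U: "U \<in> opens S" and V: "V \<in> opens S'" "U \<subseteq> V" "s \<in> \<Gamma> F V"
  shows "hom_sharp S S' F H h U (germ_at S' F U (V, s)) = res H V U (h V s)"
proof -
  have "(THE t. \<exists>V' s'. V' \<in> opens S' \<and> U \<subseteq> V' \<and> s' \<in> \<Gamma> F V' \<and>
      germ_at S' F U (V, s) = germ_at S' F U (V', s') \<and> t = res H V' U (h V' s')) = res H V U (h V s)"
  proof (rule the_equality)
    fix t assume "\<exists>V' s'. V' \<in> opens S' \<and> U \<subseteq> V' \<and> s' \<in> \<Gamma> F V' \<and>
      germ_at S' F U (V, s) = germ_at S' F U (V', s') \<and> t = res H V' U (h V' s')"
    then obtain V' s' where V': "V' \<in> opens S'" "U \<subseteq> V'" "s' \<in> \<Gamma> F V'"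
      and eq: "germ_at S' F U (V, s) = germ_at S' F U (V', s')" and t: "t = res H V' U (h V' s')" by blast
    have "(V', s') \<in> germ_at S' F U (V, s)" unfolding eq by (rule germ_self[OF V'])
    then obtain W where W: "W \<in> opens S'" "U \<subseteq> W" "W \<subseteq> V" "W \<subseteq> V'" "res F V W s = res F V' W s'"
      by (rule germ_memberE)
    have *: "res H V U (h V s) = res H W U (h W (res F V W s))"
      if V: "V \<in> opens S'" "W \<subseteq> V" "s \<in> \<Gamma> F V" for V s
    proof -
      have S: "V \<in> opens S" "W \<in> opens S" using V W opens_sub by blast+
      have hs: "h V s \<in> \<Gamma> H V"
        using psh_homD(1)[OF h V(1,3)] by (simp only: direct_image_psh_simps V(1))
      have "h W (res F V W s) = res H V W (h V s)"
        using psh_homD(5)[OF h V(1) W(1) V(2,3)] by (simp only: direct_image_psh_simps V(1) W(1))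
      then show ?thesis using presheafD(4)[OF H S U W(2) V(2) hs] by simp
    qed
    show "t = res H V U (h V s)"
      unfolding t *[OF V(1) W(3) V(3)] *[OF V'(1) W(4) V'(3)] W(5) ..
  qed (use V in blast)
  then show ?thesis using U V pullback_carrierI[OF V] by (simp add: hom_sharp_def)
qed

lemma hom_flat_sharp:
  assumes H: "is_presheaf K S H" and h: "h \<in> psh_hom K S' F (direct_image_psh S' H)"
  shows "hom_flat S' F (hom_sharp S S' F H h) = h"
proof (intro ext)
  fix V s
  show "hom_flat S' F (hom_sharp S S' F H h) V s = h V s"
  proof (cases "V \<in> opens S' \<and> s \<in> \<Gamma> F V")
    case True
    then have V: "V \<in> opens S'" "s \<in> \<Gamma> F V" and VS: "V \<in> opens S" using opens_sub by auto
    have "h V s \<in> \<Gamma> H V"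
      using psh_homD(1)[OF h V] by (simp only: direct_image_psh_simps V(1))
    then show ?thesis
      by (simp only: hom_flat_apply[OF V] hom_sharp_germ[OF H h VS V(1) subset_refl V(2)] presheafD(3)[OF H VS])
  next
    case False
    then show ?thesis using h by (auto simp: hom_flat_def psh_hom_def restrict_def extensional_def)
  qed
qed

lemma hom_sharp_in_hom:
  assumes H: "is_presheaf K S H" and h: "h \<in> psh_hom K S' F (direct_image_psh S' H)"
  shows "hom_sharp S S' F H h \<in> psh_hom K S (pullback_psh S' F) H"
proof (rule psh_homI)
  let ?g = "hom_sharp S S' F H h"
  note gg = hom_sharp_germ[OF H h]
  have hc: "h V s \<in> \<Gamma> H V" if "V \<in> opens S'" "s \<in> \<Gamma> F V" for V s
    using psh_homD(1)[OF h that] by (simp only: direct_image_psh_simps that(1))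
  show "?g \<in> extensional (opens S)" by (simp add: hom_sharp_def)
  fix U assume U: "U \<in> opens S"
  have sec: "sec (pullback_psh S' F) U = pullback_sec S' F U" for U by (simp add: pullback_psh_def)
  show "?g U \<in> extensional (\<Gamma> (pullback_psh S' F) U)" by (simp add: hom_sharp_def U sec)
  show "linear_map K (sec (pullback_psh S' F) U) (sec H U) (?g U)"
    unfolding linear_map_def sec
  proof (intro conjI ballI funcsetI)
    fix C assume "C \<in> carrier (pullback_sec S' F U)"
    then obtain V s where V: "V \<in> opens S'" "U \<subseteq> V" "s \<in> \<Gamma> F V" and C: "C = germ_at S' F U (V, s)"
      by (rule pullback_carrierE)
    have VS: "V \<in> opens S" using V opens_sub by blast
    show "?g U C \<in> \<Gamma> H U"
      unfolding C gg[OF U V] by (rule presheaf_res_closed[OF H VS U V(2) hc[OF V(1,3)]])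
    { fix D assume "D \<in> carrier (pullback_sec S' F U)"
      then obtain V' s' where V': "V' \<in> opens S'" "U \<subseteq> V'" "s' \<in> \<Gamma> F V'" and D: "D = germ_at S' F U (V', s')"
        by (rule pullback_carrierE)
      let ?W = "V \<inter> V'" and ?s = "res F V (V \<inter> V') s" and ?s' = "res F V' (V \<inter> V') s'"
      have W: "?W \<in> opens S'" "U \<subseteq> ?W" using V V' opens_Int by blast+
      have VS': "V' \<in> opens S" and WS: "?W \<in> opens S" using V' W opens_sub by blast+
      have s: "?s \<in> \<Gamma> F ?W" by (rule presheaf_res_closed[OF F V(1) W(1) _ V(3)]) blast
      have s': "?s' \<in> \<Gamma> F ?W" by (rule presheaf_res_closed[OF F V'(1) W(1) _ V'(3)]) blast
      have hs: "h ?W ?s = res H V ?W (h V s)"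
        using psh_homD(5)[OF h V(1) W(1) _ V(3)] by (simp add: direct_image_psh_simps V(1) W(1))
      have hs': "h ?W ?s' = res H V' ?W (h V' s')"
        using psh_homD(5)[OF h V'(1) W(1) _ V'(3)] by (simp add: direct_image_psh_simps V'(1) W(1))
      have "?g U (C \<oplus>\<^bsub>pullback_sec S' F U\<^esub> D) = res H ?W U (h ?W (?s \<oplus>\<^bsub>sec F ?W\<^esub> ?s'))"
        unfolding C D pullback_add_germ[OF V V'] by (rule gg[OF U W presheaf_add_closed[OF F W(1) s s']])
      also have "\<dots> = res H ?W U (h ?W ?s \<oplus>\<^bsub>sec H ?W\<^esub> h ?W ?s')"
        using psh_homD(3)[OF h W(1) s s'] by (simp only: direct_image_psh_simps W(1))
      also have "\<dots> = res H ?W U (h ?W ?s) \<oplus>\<^bsub>sec H U\<^esub> res H ?W U (h ?W ?s')"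
        by (rule linear_mapD(2)[OF presheafD(2)[OF H WS U W(2)] hc[OF W(1) s] hc[OF W(1) s']])
      also have "\<dots> = res H V U (h V s) \<oplus>\<^bsub>sec H U\<^esub> res H V' U (h V' s')"
        unfolding hs hs' using presheafD(4)[OF H VS WS U W(2) _ hc[OF V(1,3)]]
          presheafD(4)[OF H VS' WS U W(2) _ hc[OF V'(1,3)]] by simp
      finally show "?g U (C \<oplus>\<^bsub>pullback_sec S' F U\<^esub> D) = ?g U C \<oplus>\<^bsub>sec H U\<^esub> ?g U D"
        unfolding C D gg[OF U V] gg[OF U V'] . }
    { fix a assume a: "a \<in> carrier K"
      have "?g U (a \<odot>\<^bsub>pullback_sec S' F U\<^esub> C) = res H V U (h V (a \<odot>\<^bsub>sec F V\<^esub> s))"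
        unfolding C pullback_smult_germ[OF V a]
        by (rule gg[OF U V(1,2) presheaf_smult_closed[OF F V(1) a V(3)]])
      also have "\<dots> = res H V U (a \<odot>\<^bsub>sec H V\<^esub> h V s)"
        using psh_homD(4)[OF h V(1) a V(3)] by (simp only: direct_image_psh_simps V(1))
      also have "\<dots> = a \<odot>\<^bsub>sec H U\<^esub> res H V U (h V s)"
        by (rule linear_mapD(3)[OF presheafD(2)[OF H VS U V(2)] a hc[OF V(1,3)]])
      finally show "?g U (a \<odot>\<^bsub>pullback_sec S' F U\<^esub> C) = a \<odot>\<^bsub>sec H U\<^esub> ?g U C"
        unfolding C gg[OF U V] . }
  qed
  fix U' C assume U': "U' \<in> opens S" "U' \<subseteq> U" and "C \<in> \<Gamma> (pullback_psh S' F) U"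
  then have "C \<in> carrier (pullback_sec S' F U)" by (simp only: sec)
  then obtain V s where V: "V \<in> opens S'" "U \<subseteq> V" "s \<in> \<Gamma> F V" and C: "C = germ_at S' F U (V, s)"
    by (rule pullback_carrierE)
  have VS: "V \<in> opens S" using V opens_sub by blast
  have UV': "U' \<subseteq> V" using U' V by blast
  show "?g U' (res (pullback_psh S' F) U U' C) = res H U U' (?g U C)"
    unfolding C pullback_res_germ[OF V U'(2)] gg[OF U'(1) V(1) UV' V(3)] gg[OF U V]
    by (rule presheafD(4)[OF H VS U U'(1,2) V(2) hc[OF V(1,3)], symmetric])
qed

lemma hom_flat_comp:
  assumes f: "f \<in> psh_hom K S (pullback_psh S' F) G" 
  shows "hom_flat S' F (psh_comp S (pullback_psh S' F) g f) = psh_comp S' F (hom_restrict S' g) (hom_flat S' F f)"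
proof (intro ext)
  fix V s
  show "hom_flat S' F (psh_comp S (pullback_psh S' F) g f) V s = psh_comp S' F (hom_restrict S' g) (hom_flat S' F f) V s"
  proof (cases "V \<in> opens S' \<and> s \<in> \<Gamma> F V")
    case True
    then have V: "V \<in> opens S'" "s \<in> \<Gamma> F V" and VS: "V \<in> opens S" using opens_sub by auto
    have "germ_at S' F V (V, s) \<in> \<Gamma> (pullback_psh S' F) V"
      using V pullback_carrierI by (simp add: pullback_psh_def)
    then show ?thesis
      by (simp only: hom_flat_apply[OF V] psh_comp_apply[OF VS] psh_comp_apply[OF V] hom_restrict_apply[OF V(1)])
  qed (auto simp: hom_flat_def psh_comp_def)
qed

lemma pullback_arr_germ:
  assumes G: "is_presheaf K S' G" and f: "f \<in> psh_hom K S' F G"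
    and U: "U \<in> opens S" and V: "V \<in> opens S'" "U \<subseteq> V" "s \<in> \<Gamma> F V"
  shows "pullback_arr S S' F G f U (germ_at S' F U (V, s)) = germ_at S' G U (V, f V s)"
proof -
  interpret G: presheaf_on_target S S' K G by unfold_locales (fact G)
  have "(\<Union>(V', s')\<in>germ_at S' F U (V, s). germ_at S' G U (V', f V' s')) = germ_at S' G U (V, f V s)"
  proof (rule UN_germ[OF V])
    fix V' s' assume "(V', s') \<in> germ_at S' F U (V, s)"
    then obtain W where W: "V' \<in> opens S'" "U \<subseteq> V'" "s' \<in> \<Gamma> F V'"
      "W \<in> opens S'" "U \<subseteq> W" "W \<subseteq> V" "W \<subseteq> V'" "res F V W s = res F V' W s'" by (rule germ_memberE)
    show "germ_at S' G U (V', f V' s') = germ_at S' G U (V, f V s)"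
      by (rule G.germ_eqI[OF W(1) psh_homD(1)[OF f W(1,3)] V(1) psh_homD(1)[OF f V(1,3)] W(4,5,7,6)])
        (simp only: psh_homD(5)[OF f W(1,4,7,3), symmetric] psh_homD(5)[OF f V(1) W(4,6) V(3), symmetric] W(8))
  qed
  then show ?thesis using U pullback_carrierI[OF V] by (simp add: pullback_arr_def)
qed

text \<open>A map given on germs by restricting the values of a morphism is the adjoint of that
morphism. In particular it is linear and natural, which spares a direct verification for the two
composites below.\<close>

lemma psh_comp_eq_hom_sharp:
  assumes H: "is_presheaf K S H" and h: "h \<in> psh_hom K S' F (direct_image_psh S' H)"
    and germ: "\<And>U V s. U \<in> opens S \<Longrightarrow> V \<in> opens S' \<Longrightarrow> U \<subseteq> V \<Longrightarrow> s \<in> \<Gamma> F V \<Longrightarrow>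
      g U (i U (germ_at S' F U (V, s))) = res H V U (h V s)"
  shows "psh_comp S (pullback_psh S' F) g i = hom_sharp S S' F H h"
proof (intro ext)
  fix U C
  show "psh_comp S (pullback_psh S' F) g i U C = hom_sharp S S' F H h U C"
  proof (cases "U \<in> opens S \<and> C \<in> carrier (pullback_sec S' F U)")
    case True
    then have U: "U \<in> opens S" and C': "C \<in> \<Gamma> (pullback_psh S' F) U" by (simp_all add: pullback_psh_def)
    from True obtain V s where V: "V \<in> opens S'" "U \<subseteq> V" "s \<in> \<Gamma> F V" and C: "C = germ_at S' F U (V, s)"
      using pullback_carrierE by blast
    show ?thesis
      unfolding psh_comp_apply[OF U C'] unfolding C hom_sharp_germ[OF H h U V] germ[OF U V] ..
  qed (auto simp: psh_comp_def hom_sharp_def pullback_psh_def)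
qed

lemma psh_comp_pullback_in_hom:
  assumes H: "is_presheaf K S H"
    and i: "i \<in> psh_hom K S (pullback_psh S' F) G" and g: "g \<in> psh_hom K S G H"
  shows "psh_comp S (pullback_psh S' F) g i \<in> psh_hom K S (pullback_psh S' F) H"
proof -
  let ?h = "psh_comp S' F (hom_restrict S' g) (hom_flat S' F i)"
  note fi = hom_flat_in_hom[OF i]
  have h: "?h \<in> psh_hom K S' F (direct_image_psh S' H)"
    by (rule psh_comp_in_hom[OF F fi hom_restrict_in_hom[OF opens_sub g]])
  have "psh_comp S (pullback_psh S' F) g i = hom_sharp S S' F H ?h"
  proof (rule psh_comp_eq_hom_sharp[OF H h])
    fix U V s assume U: "U \<in> opens S" and V: "V \<in> opens S'" "U \<subseteq> V" "s \<in> \<Gamma> F V"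
    have VS: "V \<in> opens S" using V opens_sub by blast
    have ts: "hom_flat S' F i V s \<in> \<Gamma> G V"
      using psh_homD(1)[OF fi V(1,3)] by (simp only: direct_image_psh_simps V(1))
    show "g U (i U (germ_at S' F U (V, s))) = res H V U (?h V s)"
      unfolding hom_on_germ[OF i U V] psh_comp_apply[OF V(1,3)] hom_restrict_apply[OF V(1)]
      by (rule psh_homD(5)[OF g VS U V(2) ts])
  qed
  with hom_sharp_in_hom[OF H h] show ?thesis by simp
qed

lemma hom_comp_pullback_arr:
  assumes G: "is_presheaf K S' G" and f: "f \<in> psh_hom K S' F G" and H: "is_presheaf K S H"
    and i: "i \<in> psh_hom K S (pullback_psh S' G) H"
  shows "psh_comp S (pullback_psh S' F) i (pullback_arr S S' F G f) \<in> psh_hom K S (pullback_psh S' F) H"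
    and "hom_flat S' F (psh_comp S (pullback_psh S' F) i (pullback_arr S S' F G f)) =
      psh_comp S' F (hom_flat S' G i) f"
proof -
  interpret G: presheaf_on_target S S' K G by unfold_locales (fact G)
  let ?h = "psh_comp S' F (hom_flat S' G i) f"
  have h: "?h \<in> psh_hom K S' F (direct_image_psh S' H)"
    by (rule psh_comp_in_hom[OF F f G.hom_flat_in_hom[OF i]])
  have eq: "psh_comp S (pullback_psh S' F) i (pullback_arr S S' F G f) = hom_sharp S S' F H ?h"
  proof (rule psh_comp_eq_hom_sharp[OF H h])
    fix U V s assume U: "U \<in> opens S" and V: "V \<in> opens S'" "U \<subseteq> V" "s \<in> \<Gamma> F V"
    show "i U (pullback_arr S S' F G f U (germ_at S' F U (V, s))) = res H V U (?h V s)"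
      unfolding pullback_arr_germ[OF G f U V] G.hom_on_germ[OF i U V(1,2) psh_homD(1)[OF f V(1,3)]]
        psh_comp_apply[OF V(1,3)] ..
  qed
  show "psh_comp S (pullback_psh S' F) i (pullback_arr S S' F G f) \<in> psh_hom K S (pullback_psh S' F) H"
    unfolding eq by (rule hom_sharp_in_hom[OF H h])
  show "hom_flat S' F (psh_comp S (pullback_psh S' F) i (pullback_arr S S' F G f)) = ?h"
    unfolding eq by (rule hom_flat_sharp[OF H h])
qed

end

section \<open>Conic and basic open sets\<close>

locale open_site =
  fixes S :: "'a site"
  assumes Int_in: "U \<in> opens S \<Longrightarrow> V \<in> opens S \<Longrightarrow> U \<inter> V \<in> opens S"
    and cover_opens: "\<V> \<in> covers S U \<Longrightarrow> V \<in> \<V> \<Longrightarrow> V \<in> opens S"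
    and cover_subset: "\<V> \<in> covers S U \<Longrightarrow> V \<in> \<V> \<Longrightarrow> V \<subseteq> U"
begin

lemma sheaf_eqI:
  assumes F: "is_sheaf K S F" and U: "U \<in> opens S" and V: "\<V> \<in> covers S U"
    and s: "s \<in> \<Gamma> F U" and t: "t \<in> \<Gamma> F U"
    and eq: "\<And>V. V \<in> \<V> \<Longrightarrow> res F U V s = res F U V t"
  shows "s = t"
proof -
  note P = sheaf_presheaf[OF F]
  have "\<exists>!u. u \<in> \<Gamma> F U \<and> (\<forall>V\<in>\<V>. res F U V u = res F U V s)"
  proof (rule sheaf_ex1[OF F U V], intro conjI ballI)
    fix V' assume V': "V' \<in> \<V>"
    note VS = cover_opens[OF V V'] cover_subset[OF V V']
    show "res F U V' s \<in> \<Gamma> F V'" by (rule presheaf_res_closed[OF P U VS s])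
    fix W assume W': "W \<in> \<V>"
    note WS = cover_opens[OF V W'] cover_subset[OF V W']
    note o = Int_in[OF VS(1) WS(1)]
    show "res F V' (V' \<inter> W) (res F U V' s) = res F W (V' \<inter> W) (res F U W s)"
      using presheafD(4)[OF P U VS(1) o _ VS(2) s] presheafD(4)[OF P U WS(1) o _ WS(2) s] by simp
  qed
  then show ?thesis using s t eq by metis
qed

lemma finite_Inter_in:
  assumes "finite Q" "Q \<subseteq> opens S" "U \<in> opens S"
  shows "U \<inter> \<Inter>Q \<in> opens S"
  using assms
proof (induction Q)
  case (insert V Q)
  then have "V \<inter> (U \<inter> \<Inter>Q) \<in> opens S" using Int_in by simp
  moreover have "V \<inter> (U \<inter> \<Inter>Q) = U \<inter> \<Inter>(insert V Q)" by blast
  ultimately show ?case by simp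
qed simp

end

text \<open>The sequence \<open>E\<close> is the exhaustion of (iv).\<close>

locale conic_setting =
  fixes X :: "'a mfd" and \<mu> :: "'a \<times> real \<Rightarrow> 'a" and E :: "nat \<Rightarrow> 'a set"
  assumes X: "real_analytic_manifold X"
    and \<mu>: "analytic_action X \<mu>"
    and fin_cover: "U \<in> Op_sa_c X \<Longrightarrow> \<exists>T\<in>covers (site_sa X) U. finite T \<and> (\<forall>V\<in>T. Rpos_connected X \<mu> V)"
    and sat_Op: "U \<in> Op_sa_c X \<Longrightarrow> Rpos_sat \<mu> U \<in> Op_sa X"
    and E_cover: "range E \<in> covers (site_sa X) (topspace (mtop X))"
    and E_conn: "Rpos_connected X \<mu> (E n)"
    and E_rc: "relatively_compact_in (mtop X) (E n) (E (Suc n))"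
begin

abbreviation "sat \<equiv> Rpos_sat \<mu>"
abbreviation "pts \<equiv> topspace (mtop X)"
abbreviation "S \<equiv> site_sa X"
abbreviation "S' \<equiv> site_sa_conic X \<mu>"

definition basic :: "'a set set" where
  "basic = {b \<in> Op_sa_c X. Rpos_connected X \<mu> b}"

definition basic_in :: "'a set \<Rightarrow> 'a set set" where
  "basic_in U = {b \<in> basic. b \<subseteq> U}"

lemma mem_sat: "x \<in> sat A \<longleftrightarrow> (\<exists>y\<in>A. \<exists>t>0. x = \<mu> (y, t))"
  by (auto simp: Rpos_sat_def)

lemma action_one: "x \<in> pts \<Longrightarrow> \<mu> (x, 1) = x"
  and action_mult: "x \<in> pts \<Longrightarrow> s > 0 \<Longrightarrow> t > 0 \<Longrightarrow> \<mu> (\<mu> (x, s), t) = \<mu> (x, s * t)"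
  using \<mu> by (auto simp: analytic_action_def)

lemma action_closed: "x \<in> pts \<Longrightarrow> t > 0 \<Longrightarrow> \<mu> (x, t) \<in> pts"
proof -
  assume x: "x \<in> pts" "t > 0"
  have "continuous_map (subtopology (mtop (prod_mfd X Rpos_mfd)) (pts \<times> {0<..})) (mtop X) \<mu>"
    using \<mu> by (simp add: analytic_action_def analytic_map_on_def)
  from continuous_map_funspace[OF this] show ?thesis
    using x by (auto simp: prod_mfd_def open_interval_mfd_def)
qed

lemma sat_mono: "A \<subseteq> B \<Longrightarrow> sat A \<subseteq> sat B"
  by (auto simp: Rpos_sat_def)

lemma sat_Union: "sat (\<Union>T) = (\<Union>c\<in>T. sat c)"
  by (auto simp: Rpos_sat_def)

lemma subset_sat: "A \<subseteq> pts \<Longrightarrow> A \<subseteq> sat A"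
proof
  fix x assume "A \<subseteq> pts" "x \<in> A"
  then show "x \<in> sat A" unfolding mem_sat using action_one by (metis subsetD zero_less_one)
qed

lemma sat_pts: "A \<subseteq> pts \<Longrightarrow> sat A \<subseteq> pts"
  using action_closed by (auto simp: mem_sat subset_iff)

lemma sat_sat:
  assumes "A \<subseteq> pts" shows "sat (sat A) = sat A"
proof
  show "sat (sat A) \<subseteq> sat A"
  proof
    fix x assume "x \<in> sat (sat A)"
    then obtain y s t where y: "y \<in> A" "s > 0" "t > 0" "x = \<mu> (\<mu> (y, s), t)" by (auto simp: mem_sat)
    then have "x = \<mu> (y, s * t)" "s * t > 0" using action_mult assms by auto
    then show "x \<in> sat A" unfolding mem_sat using y(1) by blast
  qed
qed (rule subset_sat[OF sat_pts[OF assms]])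

lemma sat_sym:
  assumes "y \<in> pts" "x \<in> sat {y}" shows "y \<in> sat {x}"
proof -
  obtain t where t: "t > 0" "x = \<mu> (y, t)" using assms(2) by (auto simp: mem_sat)
  have "\<mu> (x, 1 / t) = y" using action_mult[of y t "1 / t"] action_one assms(1) t by simp
  then show ?thesis unfolding mem_sat using t by (metis singletonI zero_less_divide_1_iff)
qed

text \<open>Saturation is membership along orbits because orbits are equivalence classes: the
action of \<open>t\<close> is undone by that of \<open>1 / t\<close>.\<close>

lemma mem_sat_orbit:
  assumes "A \<subseteq> pts" "x \<in> pts"
  shows "x \<in> sat A \<longleftrightarrow> A \<inter> sat {x} \<noteq> {}"
proof
  assume "x \<in> sat A"
  then obtain y t where y: "y \<in> A" "t > 0" "x = \<mu> (y, t)" by (auto simp: mem_sat)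
  then have "x \<in> sat {y}" by (auto simp: mem_sat)
  then have "y \<in> sat {x}" using sat_sym y assms by blast
  then show "A \<inter> sat {x} \<noteq> {}" using y by blast
next
  assume "A \<inter> sat {x} \<noteq> {}"
  then obtain y where y: "y \<in> A" "y \<in> sat {x}" by blast
  then have "x \<in> sat {y}" using sat_sym assms by blast
  then show "x \<in> sat A" using sat_mono[of "{y}" A] y by blast
qed

lemma Op_subset: "U \<in> Op_sa X \<Longrightarrow> U \<subseteq> pts"
  by (simp add: Op_sa_def subanalytic_def)

lemma Op_open: "U \<in> Op_sa X \<Longrightarrow> openin (mtop X) U"
  by (simp add: Op_sa_def)

lemma Op_c_Op: "U \<in> Op_sa_c X \<Longrightarrow> U \<in> Op_sa X"
  by (simp add: Op_sa_c_def)

lemma hausdorff: "Hausdorff_space (mtop X)"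
  using X by (simp add: real_analytic_manifold_def)

lemma Op_c_mono: "U \<in> Op_sa_c X \<Longrightarrow> W \<in> Op_sa X \<Longrightarrow> W \<subseteq> U \<Longrightarrow> W \<in> Op_sa_c X"
  using relatively_compact_mono[OF hausdorff] by (auto simp: Op_sa_c_def)

lemma Op_c_Int: "U \<in> Op_sa_c X \<Longrightarrow> W \<in> Op_sa X \<Longrightarrow> W \<inter> U \<in> Op_sa_c X"
  by (rule Op_c_mono[of U]) (auto intro: Op_sa_Int[OF X] Op_c_Op)

lemma opens_sa [simp]: "opens S = Op_sa X"
  by (simp add: site_sa_def)

lemma conic_opens_iff: "U \<in> opens S' \<longleftrightarrow> U \<in> Op_sa X \<and> sat U = U"
  by (auto simp: site_sa_conic_def conic_set_def)

lemma covers_iff: "T \<in> covers S U \<longleftrightarrow> T \<subseteq> Op_sa X \<and> (\<forall>V\<in>T. V \<subseteq> U) \<and>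
    (\<forall>C. compactin (mtop X) C \<longrightarrow> (\<exists>T0\<subseteq>T. finite T0 \<and> C \<inter> \<Union>T0 = C \<inter> U))"
  by (simp add: site_sa_def)

lemma conic_covers_iff: "T \<in> covers S' U \<longleftrightarrow> T \<in> covers S U \<and> (\<forall>V\<in>T. sat V = V)"
  by (auto simp: site_sa_conic_def conic_set_def)

sublocale S: open_site S
  by unfold_locales (auto simp: covers_iff Op_sa_Int[OF X])

text \<open>An orbit that meets the conic set \<open>W\<close> lies in it.\<close>

lemma sat_Int_conic:
  assumes "A \<subseteq> pts" "W \<subseteq> pts" "sat W = W"
  shows "sat (W \<inter> A) = W \<inter> sat A"
proof
  have "sat (W \<inter> A) \<subseteq> sat W" by (rule sat_mono) blast
  moreover have "sat (W \<inter> A) \<subseteq> sat A" by (rule sat_mono) blast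
  ultimately show "sat (W \<inter> A) \<subseteq> W \<inter> sat A" using assms(3) by simp
next
  show "W \<inter> sat A \<subseteq> sat (W \<inter> A)"
  proof
    fix x assume x: "x \<in> W \<inter> sat A"
    then have xp: "x \<in> pts" using assms(2) by blast
    have "A \<inter> sat {x} \<noteq> {}" using mem_sat_orbit[OF assms(1) xp] x by blast
    moreover have "sat {x} \<subseteq> sat W" by (rule sat_mono) (use x in blast)
    then have "sat {x} \<subseteq> W" using assms(3) by simp
    ultimately have "(W \<inter> A) \<inter> sat {x} \<noteq> {}" by blast
    then show "x \<in> sat (W \<inter> A)" using mem_sat_orbit[OF _ xp, of "W \<inter> A"] assms(1) by blast
  qed
qed

sublocale S': open_site S'
proof
  fix U V assume "U \<in> opens S'" "V \<in> opens S'"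
  then have UV: "U \<in> Op_sa X" "sat U = U" "V \<in> Op_sa X" "sat V = V" by (simp_all add: conic_opens_iff)
  then show "U \<inter> V \<in> opens S'"
    using sat_Int_conic[of V U] Op_subset by (simp add: conic_opens_iff Op_sa_Int[OF X])
next
  fix \<V> U V assume "\<V> \<in> covers S' U" "V \<in> \<V>"
  then show "V \<in> opens S'" "V \<subseteq> U" by (auto simp: conic_covers_iff covers_iff conic_opens_iff)
qed

sublocale site_inclusion S S'
  by unfold_locales (use S'.Int_in conic_opens_iff in auto)

lemma conic_Op: "U \<in> opens S' \<Longrightarrow> U \<in> Op_sa X"
  by (simp add: conic_opens_iff)

lemma sat_opens: "U \<in> Op_sa_c X \<Longrightarrow> sat U \<in> opens S'"
  using sat_Op sat_sat Op_subset Op_c_Op by (simp add: conic_opens_iff)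

lemma sat_subset_conic: "A \<subseteq> W \<Longrightarrow> W \<in> opens S' \<Longrightarrow> sat A \<subseteq> W"
  using sat_mono[of A W] by (simp add: conic_opens_iff)

lemma finite_cover:
  assumes "finite T" "T \<subseteq> opens S" "\<Union>T = U"
  shows "T \<in> covers S U"
  using assms unfolding covers_iff by auto

lemma finite_cover_conic:
  assumes "finite T" "T \<subseteq> opens S'" "\<Union>T = U"
  shows "T \<in> covers S' U"
  using finite_cover[OF assms(1) _ assms(3)] assms(2) by (simp add: conic_covers_iff conic_opens_iff subset_iff)

lemma cover_compact:
  assumes "T \<in> covers S U" "compactin (mtop X) C"
  obtains T0 where "T0 \<subseteq> T" "finite T0" "C \<inter> \<Union>T0 = C \<inter> U"
proof -
  have "\<exists>T0\<subseteq>T. finite T0 \<and> C \<inter> \<Union>T0 = C \<inter> U"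
    by (rule assms(1)[unfolded covers_iff, THEN conjunct2, THEN conjunct2, rule_format, OF assms(2)])
  then show thesis using that by (elim exE conjE)
qed

lemma cover_Union:
  assumes "T \<in> covers S U" "U \<subseteq> pts" shows "\<Union>T = U"
proof
  show "\<Union>T \<subseteq> U" using S.cover_subset[OF assms(1)] by blast
  show "U \<subseteq> \<Union>T"
  proof
    fix x assume x: "x \<in> U"
    then have "compactin (mtop X) {x}" using assms(2) by auto
    then obtain T0 where "T0 \<subseteq> T" "finite T0" "{x} \<inter> \<Union>T0 = {x} \<inter> U"
      by (rule cover_compact[OF assms(1)])
    then show "x \<in> \<Union>T" using x by blast
  qed
qed

lemma basic_Op_c: "b \<in> basic \<Longrightarrow> b \<in> Op_sa_c X"
  by (simp add: basic_def)

lemma basic_Op: "b \<in> basic \<Longrightarrow> b \<in> Op_sa X"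
  by (simp add: basic_Op_c Op_c_Op)

lemma basic_sat: "b \<in> basic \<Longrightarrow> sat b \<in> opens S'"
  by (simp add: basic_Op_c sat_opens)

lemma basic_pts: "b \<in> basic \<Longrightarrow> b \<subseteq> pts"
  by (simp add: basic_Op Op_subset)

lemma finite_basic_cover:
  assumes "U \<in> Op_sa_c X"
  obtains T where "finite T" "T \<subseteq> basic_in U" "\<Union>T = U"
proof -
  obtain T where T: "T \<in> covers S U" "finite T" "\<forall>V\<in>T. Rpos_connected X \<mu> V"
    using fin_cover[OF assms] by blast
  have "T \<subseteq> basic_in U"
  proof
    fix V assume "V \<in> T"
    then have "V \<in> Op_sa X" "V \<subseteq> U" using S.cover_opens[OF T(1)] S.cover_subset[OF T(1)] by auto
    then show "V \<in> basic_in U" using Op_c_mono[OF assms] T(3) \<open>V \<in> T\<close> by (simp add: basic_in_def basic_def)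
  qed
  then show thesis using that T cover_Union[OF T(1)] Op_subset Op_c_Op assms by blast
qed

lemma E_Op_c: "E n \<in> Op_sa_c X"
proof -
  have "E n \<in> Op_sa X" using S.cover_opens[OF E_cover] by simp
  moreover have "relatively_compact_in (mtop X) (E n) pts"
    using E_rc[of n] by (simp add: relatively_compact_in_def closure_of_subset_topspace)
  ultimately show ?thesis by (simp add: Op_sa_c_def)
qed

lemma E_basic: "E n \<in> basic"
  using E_Op_c E_conn by (simp add: basic_def)

lemma E_mono: "m \<le> n \<Longrightarrow> E m \<subseteq> E n"
proof (rule lift_Suc_mono_le)
  fix n
  have "E n \<subseteq> pts" "mtop X closure_of E n \<subseteq> E (Suc n)"
    using E_rc[of n] by (simp_all add: relatively_compact_in_def)
  then show "E n \<subseteq> E (Suc n)" using closure_of_subset by fast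
qed

lemma compact_in_E:
  assumes "compactin (mtop X) C" obtains n where "C \<subseteq> E n"
proof -
  obtain T0 where T0: "T0 \<subseteq> range E" "finite T0" "C \<inter> \<Union>T0 = C \<inter> pts"
    by (rule cover_compact[OF E_cover assms])
  then obtain I where I: "finite I" "T0 = E ` I" by (meson finite_subset_image)
  have "C \<subseteq> pts" using assms by (rule compactin_subset_topspace)
  then have "C \<subseteq> \<Union>(E ` I)" using T0 I by blast
  also have "\<dots> \<subseteq> E (Max (insert 0 I))"
    by (rule UN_least, rule E_mono, rule Max_ge) (use I(1) in simp_all)
  finally show thesis by (rule that)
qed

lemma Op_c_in_E:
  assumes "U \<in> Op_sa_c X" obtains n where "U \<subseteq> E n"
proof -
  have "compactin (mtop X) (mtop X closure_of U)" "U \<subseteq> mtop X closure_of U"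
    using assms closure_of_subset[of U "mtop X"] by (auto simp: Op_sa_c_def relatively_compact_in_def)
  then show thesis using compact_in_E that by (metis subset_trans)
qed

text \<open>On a compact set, contained in some \<open>E n\<close>, the finite covering by basic
sets of the relatively compact set \<open>U \<inter> E n\<close> does the work.\<close>

lemma basic_in_cover:
  assumes "U \<in> Op_sa X" shows "basic_in U \<in> covers S U"
  unfolding covers_iff
proof (intro conjI allI impI)
  show "basic_in U \<subseteq> Op_sa X" using basic_Op by (auto simp: basic_in_def)
  show "\<forall>V\<in>basic_in U. V \<subseteq> U" by (auto simp: basic_in_def)
  fix C assume "compactin (mtop X) C"
  then obtain n where n: "C \<subseteq> E n" by (rule compact_in_E)
  obtain T where T: "finite T" "T \<subseteq> basic_in (U \<inter> E n)" "\<Union>T = U \<inter> E n"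
    using finite_basic_cover[OF Op_c_Int[OF E_Op_c assms]] by blast
  then show "\<exists>T0\<subseteq>basic_in U. finite T0 \<and> C \<inter> \<Union>T0 = C \<inter> U"
    using n by (intro exI[of _ T]) (auto simp: basic_in_def)
qed

text \<open>An orbit either lies in the conic set \<open>W\<close> or avoids it, so cutting with
\<open>W\<close> preserves \<open>\<real>\<^sup>+\<close>-connectedness.\<close>

lemma conic_Int_E:
  assumes W: "W \<in> opens S'"
  shows "W \<inter> E n \<in> basic" "sat (W \<inter> E n) = W \<inter> sat (E n)"
proof -
  have W': "W \<in> Op_sa X" "sat W = W" using W by (simp_all add: conic_opens_iff)
  have "W \<inter> E n \<in> Op_sa_c X" by (rule Op_c_Int[OF E_Op_c W'(1)])
  moreover have "Rpos_connected X \<mu> (W \<inter> E n)"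
    unfolding Rpos_connected_def
  proof
    fix x assume x: "x \<in> pts"
    show "W \<inter> E n \<inter> sat {x} = {} \<or> connectedin (mtop X) (W \<inter> E n \<inter> sat {x})"
    proof (cases "W \<inter> E n \<inter> sat {x} = {}")
      case False
      then have "x \<in> sat W" using mem_sat_orbit[OF Op_subset[OF W'(1)] x] by blast
      then have "sat {x} \<subseteq> W" using sat_subset_conic[OF _ W, of "{x}"] W' by simp
      then have "W \<inter> E n \<inter> sat {x} = E n \<inter> sat {x}" by blast
      then show ?thesis using E_conn[of n] x unfolding Rpos_connected_def by metis
    qed blast
  qed
  ultimately show "W \<inter> E n \<in> basic" by (simp add: basic_def)
  show "sat (W \<inter> E n) = W \<inter> sat (E n)"
    by (rule sat_Int_conic) (use W' Op_subset basic_pts[OF E_basic] in auto)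
qed

lemma conic_exhaustion:
  assumes W: "W \<in> opens S'"
  shows "range (\<lambda>n. sat (W \<inter> E n)) \<in> covers S' W"
proof -
  have o: "sat (W \<inter> E n) \<in> opens S'" for n by (rule basic_sat[OF conic_Int_E(1)[OF W]])
  have s: "sat (W \<inter> E n) \<subseteq> W" for n using conic_Int_E(2)[OF W] by blast
  have "\<exists>T0\<subseteq>range (\<lambda>n. sat (W \<inter> E n)). finite T0 \<and> C \<inter> \<Union>T0 = C \<inter> W"
    if C: "compactin (mtop X) C" for C
  proof -
    obtain n where n: "C \<subseteq> E n" using C by (rule compact_in_E)
    have "C \<inter> W \<subseteq> sat (W \<inter> E n)"
      using n subset_sat[OF basic_pts[OF E_basic]] conic_Int_E(2)[OF W] by blast
    then show ?thesis using s by (intro exI[of _ "{sat (W \<inter> E n)}"]) blast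
  qed
  then show ?thesis using o s unfolding conic_covers_iff covers_iff by (auto simp: conic_opens_iff)
qed

text \<open>The members of \<open>T\<close> reachable from \<open>c\<close> through the relation,
and the others, give two open sets whose traces on the orbit of \<open>x\<close> are disjoint:
members that meet in a point of the orbit are related. Both traces on \<open>b\<close> are
nonempty if \<open>d\<close> is not reachable, against the connectedness of the trace of
\<open>b\<close>.\<close>

lemma overlap_chain:
  assumes b: "Rpos_connected X \<mu> b" and T: "T \<subseteq> Op_sa X" "\<Union>T = b"
    and cd: "c \<in> T" "d \<in> T" "x \<in> sat c" "x \<in> sat d"
  shows "(c, d) \<in> {(e, f) \<in> T \<times> T. x \<in> sat (e \<inter> f)}\<^sup>*"
proof (rule ccontr)
  let ?r = "{(e, f) \<in> T \<times> T. x \<in> sat (e \<inter> f)}"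
  assume n: "(c, d) \<notin> ?r\<^sup>*"
  have pts: "e \<subseteq> pts" if "e \<in> T" for e using T(1) that Op_subset by blast
  have x: "x \<in> pts" using cd sat_pts[OF pts[OF cd(1)]] by blast
  let ?o = "sat {x}"
  define P where "P = \<Union>{e \<in> T. (c, e) \<in> ?r\<^sup>*}"
  define Q where "Q = \<Union>{e \<in> T. (c, e) \<notin> ?r\<^sup>*}"
  have meet: "e \<inter> ?o \<noteq> {}" if "e \<in> T" "x \<in> sat e" for e
    using mem_sat_orbit[OF pts[OF that(1)] x] that(2) by blast
  have "openin (mtop X) P" "openin (mtop X) Q"
    using T(1) Op_open unfolding P_def Q_def by (auto intro!: openin_Union)
  moreover have "b \<inter> ?o \<subseteq> P \<union> Q" using T(2) unfolding P_def Q_def by blast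
  moreover have "P \<inter> Q \<inter> (b \<inter> ?o) = {}"
  proof (rule ccontr)
    assume "P \<inter> Q \<inter> (b \<inter> ?o) \<noteq> {}"
    then obtain y e f where y: "y \<in> ?o" "e \<in> T" "(c, e) \<in> ?r\<^sup>*" "y \<in> e" "f \<in> T" "(c, f) \<notin> ?r\<^sup>*" "y \<in> f"
      unfolding P_def Q_def by blast
    have "e \<inter> f \<subseteq> pts" using pts[OF y(2)] by blast
    then have "x \<in> sat (e \<inter> f)" using mem_sat_orbit[OF _ x, of "e \<inter> f"] y by blast
    then have "(e, f) \<in> ?r" using y by blast
    then have "(c, f) \<in> ?r\<^sup>*" using y(3) by (rule_tac rtrancl_into_rtrancl)
    then show False using y by blast
  qed
  moreover have "P \<inter> (b \<inter> ?o) \<noteq> {}"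
  proof -
    have "c \<subseteq> P" "c \<subseteq> b" using cd T(2) unfolding P_def by blast+
    then show ?thesis using meet[OF cd(1,3)] by blast
  qed
  moreover have "Q \<inter> (b \<inter> ?o) \<noteq> {}"
  proof -
    have "d \<subseteq> Q" "d \<subseteq> b" using cd n T(2) unfolding Q_def by blast+
    then show ?thesis using meet[OF cd(2,4)] by blast
  qed
  moreover have "connectedin (mtop X) (b \<inter> ?o)"
    using b x calculation(5) unfolding Rpos_connected_def by blast
  ultimately show False unfolding connectedin by blast
qed

section \<open>Gluing sections over saturations\<close>

text \<open>The chain of members of \<open>T\<close> linking \<open>c\<close> to \<open>d\<close>
depends on the point of the intersection, but as \<open>T\<close> is finite there are finitely
many relations \<open>r\<close> on \<open>T\<close>; the points for which all pairs in
\<open>r\<close> are linked form a conic open set \<open>Z r\<close>, on which agreement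
propagates along \<open>r\<close>.\<close>

lemma sections_agree_on_overlaps:
  assumes F: "is_sheaf K S' F" and b: "Rpos_connected X \<mu> b"
    and T: "finite T" "T \<subseteq> Op_sa_c X" "\<Union>T = b"
    and s: "\<And>c. c \<in> T \<Longrightarrow> s c \<in> \<Gamma> F (sat c)"
    and agree: "\<And>c d. c \<in> T \<Longrightarrow> d \<in> T \<Longrightarrow>
      res F (sat c) (sat (c \<inter> d)) (s c) = res F (sat d) (sat (c \<inter> d)) (s d)"
    and c: "c \<in> T" and d: "d \<in> T"
  shows "res F (sat c) (sat c \<inter> sat d) (s c) = res F (sat d) (sat c \<inter> sat d) (s d)"
proof -
  note P = sheaf_presheaf[OF F]
  have TO: "T \<subseteq> Op_sa X" using T(2) Op_c_Op by blast
  have sT: "sat e \<in> opens S'" if "e \<in> T" for e using that T(2) sat_opens by blast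
  have sI: "sat (e \<inter> f) \<in> opens S'" if "e \<in> T" "f \<in> T" for e f
    using that T(2) TO Op_c_Int[of f e] by (intro sat_opens) blast
  let ?U = "sat c \<inter> sat d"
  have U: "?U \<in> opens S'" using sT c d S'.Int_in by blast
  define Z where "Z r = ?U \<inter> \<Inter>((\<lambda>(e, f). sat (e \<inter> f)) ` r)" for r
  have Z: "Z r \<in> opens S'" if "r \<subseteq> T \<times> T" for r
    unfolding Z_def
  proof (rule S'.finite_Inter_in[OF _ _ U])
    show "finite ((\<lambda>(e, f). sat (e \<inter> f)) ` r)"
      using finite_subset[OF that] T(1) by blast
    show "(\<lambda>(e, f). sat (e \<inter> f)) ` r \<subseteq> opens S'" using that sI by auto
  qed
  have step: "Z r \<subseteq> sat e \<and> e \<in> T \<and> res F (sat c) (Z r) (s c) = res F (sat e) (Z r) (s e)"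
    if r: "r \<subseteq> T \<times> T" and ce: "(c, e) \<in> r\<^sup>*" for r e
    using ce
  proof (induction rule: rtrancl_induct)
    case base
    then show ?case using c by (auto simp: Z_def)
  next
    case (step e f)
    have f: "f \<in> T" "e \<in> T" using step.hyps r by blast+
    note o = sI[OF f(2,1)] Z[OF r]
    have Zef: "Z r \<subseteq> sat (e \<inter> f)" using step.hyps(2) unfolding Z_def by blast
    have ef: "sat (e \<inter> f) \<subseteq> sat e" "sat (e \<inter> f) \<subseteq> sat f" by (rule sat_mono, blast)+
    have "res F (sat e) (Z r) (s e) = res F (sat (e \<inter> f)) (Z r) (res F (sat e) (sat (e \<inter> f)) (s e))"
      by (rule presheafD(4)[OF P sT[OF f(2)] o Zef ef(1) s[OF f(2)], symmetric])
    also have "\<dots> = res F (sat f) (Z r) (s f)"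
      unfolding agree[OF f(2,1)] by (rule presheafD(4)[OF P sT[OF f(1)] o Zef ef(2) s[OF f(1)]])
    finally show ?case using step.IH Zef ef(2) f(1) by auto
  qed
  define R where "R = {r. r \<subseteq> T \<times> T \<and> (c, d) \<in> r\<^sup>*}"
  have cov: "Z ` R \<in> covers S' ?U"
  proof (rule finite_cover_conic)
    have "R \<subseteq> Pow (T \<times> T)" by (auto simp: R_def)
    then show "finite (Z ` R)" using T(1) by (meson finite_Pow_iff finite_SigmaI finite_imageI finite_subset)
    show "Z ` R \<subseteq> opens S'" using Z by (auto simp: R_def)
    show "\<Union>(Z ` R) = ?U"
    proof
      show "\<Union>(Z ` R) \<subseteq> ?U" by (auto simp: Z_def)
      show "?U \<subseteq> \<Union>(Z ` R)"
      proof
        fix x assume x: "x \<in> ?U"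
        let ?r = "{(e, f) \<in> T \<times> T. x \<in> sat (e \<inter> f)}"
        have "(c, d) \<in> ?r\<^sup>*" by (rule overlap_chain[OF b TO T(3) c d]) (use x in auto)
        then have "?r \<in> R" by (auto simp: R_def)
        moreover have "x \<in> Z ?r" using x by (auto simp: Z_def)
        ultimately show "x \<in> \<Union>(Z ` R)" by blast
      qed
    qed
  qed
  have Uc: "?U \<subseteq> sat c" and Ud: "?U \<subseteq> sat d" by blast+
  show ?thesis
  proof (rule S'.sheaf_eqI[OF F U cov])
    show "res F (sat c) ?U (s c) \<in> \<Gamma> F ?U"
      by (rule presheaf_res_closed[OF P sT[OF c] U Uc s[OF c]])
    show "res F (sat d) ?U (s d) \<in> \<Gamma> F ?U"
      by (rule presheaf_res_closed[OF P sT[OF d] U Ud s[OF d]])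
    fix V assume "V \<in> Z ` R"
    then obtain r where r: "r \<subseteq> T \<times> T" "(c, d) \<in> r\<^sup>*" "V = Z r" by (auto simp: R_def)
    have VU: "V \<subseteq> ?U" using r(3) by (auto simp: Z_def)
    have V: "V \<in> opens S'" using Z r by blast
    show "res F ?U V (res F (sat c) ?U (s c)) = res F ?U V (res F (sat d) ?U (s d))"
      using presheafD(4)[OF P sT[OF c] U V VU Uc s[OF c]] presheafD(4)[OF P sT[OF d] U V VU Ud s[OF d]]
        step[OF r(1,2)] r(3) by simp
  qed
qed

text \<open>Saturation commutes with unions, so a finite covering of \<open>U\<close> saturates to
a covering of \<open>sat U\<close>.\<close>

lemma sections_sat_eqI:
  assumes F: "is_sheaf K S' F" and T: "finite T" "T \<subseteq> Op_sa_c X" "\<Union>T = U" and U: "U \<in> Op_sa_c X"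
    and W: "W \<in> opens S'" "sat U \<subseteq> W" and W': "W' \<in> opens S'" "sat U \<subseteq> W'"
    and s: "s \<in> \<Gamma> F W" and t: "t \<in> \<Gamma> F W'"
    and eq: "\<And>c. c \<in> T \<Longrightarrow> res F W (sat c) s = res F W' (sat c) t"
  shows "res F W (sat U) s = res F W' (sat U) t"
proof -
  note P = sheaf_presheaf[OF F]
  have cov: "sat ` T \<in> covers S' (sat U)"
    by (rule finite_cover_conic) (use T sat_opens sat_Union[of T] in auto)
  have c: "sat c \<in> opens S'" "sat c \<subseteq> sat U" if "c \<in> T" for c
    using that T sat_opens sat_mono[of c U] by auto
  show ?thesis
  proof (rule S'.sheaf_eqI[OF F sat_opens[OF U] cov])
    show "res F W (sat U) s \<in> \<Gamma> F (sat U)"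
      by (rule presheaf_res_closed[OF P W(1) sat_opens[OF U] W(2) s])
    show "res F W' (sat U) t \<in> \<Gamma> F (sat U)"
      by (rule presheaf_res_closed[OF P W'(1) sat_opens[OF U] W'(2) t])
    fix V assume "V \<in> sat ` T"
    then obtain e where e: "e \<in> T" "V = sat e" by blast
    show "res F (sat U) V (res F W (sat U) s) = res F (sat U) V (res F W' (sat U) t)"
      unfolding e(2) presheafD(4)[OF P W(1) sat_opens[OF U] c(1)[OF e(1)] c(2)[OF e(1)] W(2) s]
        presheafD(4)[OF P W'(1) sat_opens[OF U] c(1)[OF e(1)] c(2)[OF e(1)] W'(2) t]
      by (rule eq[OF e(1)])
  qed
qed

lemma sections_sat_glue:
  assumes F: "is_sheaf K S' F" and b: "b \<in> basic"
    and T: "finite T" "T \<subseteq> Op_sa_c X" "\<Union>T = b"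
    and s: "\<And>c. c \<in> T \<Longrightarrow> s c \<in> \<Gamma> F (sat c)"
    and agree: "\<And>c d. c \<in> T \<Longrightarrow> d \<in> T \<Longrightarrow>
      res F (sat c) (sat (c \<inter> d)) (s c) = res F (sat d) (sat (c \<inter> d)) (s d)"
  shows "\<exists>!t. t \<in> \<Gamma> F (sat b) \<and> (\<forall>c\<in>T. res F (sat b) (sat c) t = s c)"
proof -
  note P = sheaf_presheaf[OF F]
  have conn: "Rpos_connected X \<mu> b" using b by (simp add: basic_def)
  have sT: "sat c \<in> opens S'" if "c \<in> T" for c using that T(2) sat_opens by blast
  have cov: "sat ` T \<in> covers S' (sat b)"
    by (rule finite_cover_conic) (use T sat_opens sat_Union[of T] in auto)
  have overlap: "res F (sat c) (sat c \<inter> sat d) (s c) = res F (sat d) (sat c \<inter> sat d) (s d)"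
    if "c \<in> T" "d \<in> T" for c d
    by (rule sections_agree_on_overlaps[OF F conn T _ _ that]) (erule s, erule (1) agree)
  \<comment> \<open>different members of \<open>T\<close> may have the same saturation; their sections are then equal\<close>
  define \<sigma> where "\<sigma> V = s (SOME c. c \<in> T \<and> sat c = V)" for V
  have \<sigma>: "\<sigma> (sat c) = s c" if c: "c \<in> T" for c
  proof -
    define d where "d = (SOME d. d \<in> T \<and> sat d = sat c)"
    have d: "d \<in> T \<and> sat d = sat c" unfolding d_def by (rule someI[of _ c]) (use c in blast)
    have "res F (sat d) (sat d) (s d) = res F (sat c) (sat c) (s c)"
      using overlap[of d c] c d by simp
    then show ?thesis
      using presheafD(3)[OF P sT[of d] s[of d]] presheafD(3)[OF P sT s, OF c c] d
      by (simp add: \<sigma>_def d_def[symmetric])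
  qed
  have "\<exists>!t. t \<in> \<Gamma> F (sat b) \<and> (\<forall>V\<in>sat ` T. res F (sat b) V t = \<sigma> V)"
  proof (rule sheaf_ex1[OF F basic_sat[OF b] cov], intro conjI ballI)
    fix V assume "V \<in> sat ` T"
    then obtain c where c: "c \<in> T" "V = sat c" by blast
    show "\<sigma> V \<in> \<Gamma> F V" using \<sigma>[OF c(1)] s[OF c(1)] c(2) by simp
    fix W assume "W \<in> sat ` T"
    then obtain d where d: "d \<in> T" "W = sat d" by blast
    show "res F V (V \<inter> W) (\<sigma> V) = res F W (V \<inter> W) (\<sigma> W)"
      unfolding c(2) d(2) \<sigma>[OF c(1)] \<sigma>[OF d(1)] by (rule overlap[OF c(1) d(1)])
  qed
  then show ?thesis by (simp add: \<sigma> cong: ball_cong)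
qed

text \<open>This family of basic sets is closed under passing to smaller ones, so a compatible
family of sections on it can be compared on the basic subsets of an intersection, which need not
itself be basic.\<close>

definition subordinate :: "'a set set \<Rightarrow> 'a set set" where
  "subordinate \<V> = (\<Union>V\<in>\<V>. basic_in V)"

text \<open>Finitely many members of the covering suffice on the compact closure of
\<open>W\<close>, and each of their traces on \<open>W\<close> is a finite union of basic
sets.\<close>

lemma subordinate_finite_cover:
  assumes V: "\<V> \<in> covers S U" and U: "W \<in> Op_sa_c X" "W \<subseteq> U"
  obtains T where "finite T" "T \<subseteq> subordinate \<V>" "\<Union>T = W"
proof -
  have "compactin (mtop X) (mtop X closure_of W)" and cl: "W \<subseteq> mtop X closure_of W"
    using U closure_of_subset[of W "mtop X"] by (auto simp: Op_sa_c_def relatively_compact_in_def)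
  then obtain \<V>0 where V0: "\<V>0 \<subseteq> \<V>" "finite \<V>0" "(mtop X closure_of W) \<inter> \<Union>\<V>0 = (mtop X closure_of W) \<inter> U"
    using cover_compact[OF V] by metis
  have "\<exists>T. finite T \<and> T \<subseteq> basic_in V \<and> \<Union>T = V \<inter> W" if "V \<in> \<V>0" for V
  proof -
    have "V \<in> Op_sa X" using S.cover_opens[OF V] V0(1) that by auto
    then obtain T where "finite T" "T \<subseteq> basic_in (V \<inter> W)" "\<Union>T = V \<inter> W"
      using finite_basic_cover[OF Op_c_Int[OF U(1)]] by metis
    then show ?thesis by (intro exI[of _ T]) (auto simp: basic_in_def)
  qed
  then obtain T where T: "\<And>V. V \<in> \<V>0 \<Longrightarrow> finite (T V) \<and> T V \<subseteq> basic_in V \<and> \<Union>(T V) = V \<inter> W"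
    by metis
  show thesis
  proof
    show "finite (\<Union>(T ` \<V>0))" using T V0(2) by blast
    show "\<Union>(T ` \<V>0) \<subseteq> subordinate \<V>" using T V0(1) by (fastforce simp: subordinate_def)
    have "\<Union>(\<Union>(T ` \<V>0)) = (\<Union>V\<in>\<V>0. \<Union>(T V))" by blast
    also have "\<dots> = (\<Union>V\<in>\<V>0. V \<inter> W)" using T by simp
    also have "\<dots> = W" using V0(3) cl U(2) by blast
    finally show "\<Union>(\<Union>(T ` \<V>0)) = W" .
  qed
qed

lemma subordinate_basic: "c \<in> subordinate \<V> \<Longrightarrow> c \<in> basic"
  by (auto simp: subordinate_def basic_in_def)

lemma subordinate_down: "c \<in> subordinate \<V> \<Longrightarrow> e \<in> basic \<Longrightarrow> e \<subseteq> c \<Longrightarrow> e \<in> subordinate \<V>"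
  by (auto simp: subordinate_def basic_in_def)

text \<open>The local statement behind the sheaf property of the limit over basic sets. Two
members \<open>c\<close>, \<open>d\<close> agree on \<open>sat (c \<inter> d)\<close> because they
agree on the saturation of each basic subset of \<open>c \<inter> d\<close>; a finite part of the
family that covers \<open>b\<close> can then be glued.\<close>

lemma glue_subordinate:
  assumes F: "is_sheaf K S' F" and V: "\<V> \<in> covers S U" and b: "b \<in> basic_in U"
    and s: "\<And>c. c \<in> subordinate \<V> \<Longrightarrow> s c \<in> \<Gamma> F (sat c)"
    and compat: "\<And>c e. c \<in> subordinate \<V> \<Longrightarrow> e \<in> subordinate \<V> \<Longrightarrow> e \<subseteq> c \<Longrightarrow>
      res F (sat c) (sat e) (s c) = s e"
  shows "\<exists>!t. t \<in> \<Gamma> F (sat b) \<and>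
    (\<forall>c\<in>subordinate \<V>. c \<subseteq> b \<longrightarrow> res F (sat b) (sat c) t = s c)"
proof -
  have bb: "b \<in> basic" "b \<subseteq> U" using b by (auto simp: basic_in_def)
  obtain T where T: "finite T" "T \<subseteq> subordinate \<V>" "\<Union>T = b"
    using subordinate_finite_cover[OF V basic_Op_c[OF bb(1)] bb(2)] by blast
  have agree: "res F (sat c) (sat (c \<inter> d)) (s c) = res F (sat d) (sat (c \<inter> d)) (s d)"
    if c: "c \<in> subordinate \<V>" and d: "d \<in> subordinate \<V>" for c d
  proof -
    have cd: "c \<inter> d \<in> Op_sa_c X" using Op_c_Int[OF basic_Op_c basic_Op] c d subordinate_basic by blast
    obtain Q where Q: "finite Q" "Q \<subseteq> basic_in (c \<inter> d)" "\<Union>Q = c \<inter> d" using finite_basic_cover[OF cd] .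
    have e: "e \<in> subordinate \<V>" "e \<subseteq> c" "e \<subseteq> d" "e \<in> Op_sa_c X" if "e \<in> Q" for e
      using that Q(2) subordinate_down[OF c, of e] basic_Op_c by (auto simp: basic_in_def)
    show ?thesis
    proof (rule sections_sat_eqI[OF F Q(1) _ Q(3) cd _ _ _ _ s[OF c] s[OF d]])
      show "Q \<subseteq> Op_sa_c X" using e by blast
      show "sat c \<in> opens S'" "sat d \<in> opens S'" using c d subordinate_basic basic_sat by blast+
      show "sat (c \<inter> d) \<subseteq> sat c" "sat (c \<inter> d) \<subseteq> sat d" by (rule sat_mono, blast)+
      fix e' assume e': "e' \<in> Q"
      show "res F (sat c) (sat e') (s c) = res F (sat d) (sat e') (s d)"
        using compat[OF c e(1,2)[OF e']] compat[OF d e(1,3)[OF e']] by simp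
    qed
  qed
  have ex: "\<exists>!t. t \<in> \<Gamma> F (sat b) \<and> (\<forall>c\<in>T'. res F (sat b) (sat c) t = s c)"
    if "finite T'" "T' \<subseteq> subordinate \<V>" "\<Union>T' = b" for T'
    by (rule sections_sat_glue[OF F bb(1) that(1) _ that(3)])
       (use that(2) s agree subordinate_basic basic_Op_c in blast)+
  obtain t where t: "t \<in> \<Gamma> F (sat b)" "\<forall>c\<in>T. res F (sat b) (sat c) t = s c"
    using ex[OF T] by blast
  show ?thesis
  proof (rule ex1I[of _ t], intro conjI ballI impI t(1))
    fix c assume c: "c \<in> subordinate \<V>" "c \<subseteq> b"
    \<comment> \<open>enlarging the finite covering by \<open>c\<close> does not change the glued section, by uniqueness\<close>
    have "finite (insert c T)" "insert c T \<subseteq> subordinate \<V>" "\<Union>(insert c T) = b" using T c by auto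
    from ex[OF this] obtain t' where t': "t' \<in> \<Gamma> F (sat b)"
      "\<forall>c\<in>insert c T. res F (sat b) (sat c) t' = s c" by blast
    then have "t' = t" using ex[OF T] t by blast
    then show "res F (sat b) (sat c) t = s c" using t' by blast
  next
    fix u assume u: "u \<in> \<Gamma> F (sat b) \<and> (\<forall>c\<in>subordinate \<V>. c \<subseteq> b \<longrightarrow> res F (sat b) (sat c) u = s c)"
    then have "\<forall>c\<in>T. res F (sat b) (sat c) u = s c" using T by blast
    then show "u = t" using ex[OF T] t u by blast
  qed
qed

end

section \<open>Transport of structure and modules of families\<close>

text \<open>Transport along an injection moves the sections of a sheaf into a prescribed
type.\<close>

definition transport_module :: "('p \<Rightarrow> 'q) \<Rightarrow> ('k, 'p) module \<Rightarrow> ('k, 'q) module" where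
  "transport_module e M =
     \<lparr>carrier = e ` carrier M, mult = undefined, one = undefined, zero = e \<zero>\<^bsub>M\<^esub>,
      add = (\<lambda>x y. e (inv_into (carrier M) e x \<oplus>\<^bsub>M\<^esub> inv_into (carrier M) e y)),
      smult = (\<lambda>a x. e (a \<odot>\<^bsub>M\<^esub> inv_into (carrier M) e x))\<rparr>"

lemma transport_module_simps:
  assumes "inj_on e (carrier M)"
  shows "carrier (transport_module e M) = e ` carrier M"
    "\<zero>\<^bsub>transport_module e M\<^esub> = e \<zero>\<^bsub>M\<^esub>"
    "x \<in> carrier M \<Longrightarrow> y \<in> carrier M \<Longrightarrow> e x \<oplus>\<^bsub>transport_module e M\<^esub> e y = e (x \<oplus>\<^bsub>M\<^esub> y)"
    "x \<in> carrier M \<Longrightarrow> a \<odot>\<^bsub>transport_module e M\<^esub> e x = e (a \<odot>\<^bsub>M\<^esub> x)"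
  using assms by (simp_all add: transport_module_def)

lemma module_transport:
  assumes M: "Module.module K M" and e: "inj_on e (carrier M)"
  shows "Module.module K (transport_module e M)"
proof -
  interpret Module.module K M by fact
  note ts = transport_module_simps[OF e]
  show ?thesis
  proof (rule moduleI)
    show "cring K" by (rule R.is_cring)
    show "abelian_group (transport_module e M)"
    proof (rule abelian_groupI)
      fix x assume "x \<in> carrier (transport_module e M)"
      then obtain x' where x: "x' \<in> carrier M" "x = e x'" by (auto simp: ts)
      show "\<exists>y\<in>carrier (transport_module e M). y \<oplus>\<^bsub>transport_module e M\<^esub> x = \<zero>\<^bsub>transport_module e M\<^esub>"
        by (rule bexI[of _ "e (\<ominus>\<^bsub>M\<^esub> x')"]) (simp_all add: ts x M.l_neg)
    qed (auto simp: ts M.add.m_ac)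
  qed (auto simp: ts smult_l_distr smult_r_distr smult_assoc1)
qed

definition transport_psh :: "('a set \<Rightarrow> 'p \<Rightarrow> 'q) \<Rightarrow> ('a, 'k, 'p) psh \<Rightarrow> ('a, 'k, 'q) psh" where
  "transport_psh e P =
     \<lparr>sec = (\<lambda>U. transport_module (e U) (sec P U)),
      res = (\<lambda>U V x. e V (res P U V (inv_into (\<Gamma> P U) (e U) x)))\<rparr>"

lemma transport_psh:
  assumes P: "is_presheaf K S P" and e: "\<And>U. U \<in> opens S \<Longrightarrow> inj_on (e U) (\<Gamma> P U)"
  shows "is_presheaf K S (transport_psh e P)"
    and "(\<lambda>U\<in>opens S. \<lambda>s\<in>\<Gamma> P U. e U s) \<in> psh_hom K S P (transport_psh e P)"
    and "\<And>U. U \<in> opens S \<Longrightarrow> bij_betw (e U) (\<Gamma> P U) (\<Gamma> (transport_psh e P) U)"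
proof -
  let ?G = "transport_psh e P"
  note ts = transport_module_simps[OF e]
  have sec: "sec ?G U = transport_module (e U) (sec P U)" for U by (simp add: transport_psh_def)
  have res: "res ?G U V (e U s) = e V (res P U V s)" if "U \<in> opens S" "s \<in> \<Gamma> P U" for U V s
    using that e by (simp add: transport_psh_def)
  show "is_presheaf K S ?G"
    unfolding is_presheaf_def
  proof (intro conjI ballI impI)
    fix U assume U: "U \<in> opens S"
    show "Module.module K (sec ?G U)" unfolding sec by (rule module_transport[OF presheafD(1)[OF P U] e[OF U]])
    fix s assume "s \<in> \<Gamma> ?G U"
    then obtain s' where "s' \<in> \<Gamma> P U" "s = e U s'" by (auto simp: sec ts(1)[OF U])
    then show "res ?G U U s = s" by (simp add: res U presheafD(3)[OF P U])
  next
    fix U V assume U: "U \<in> opens S" and V: "V \<in> opens S" "V \<subseteq> U"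
    note lin = linear_mapD[OF presheafD(2)[OF P U V]]
    note mc = presheaf_add_closed[OF P U] presheaf_smult_closed[OF P U]
    show "linear_map K (sec ?G U) (sec ?G V) (res ?G U V)"
      unfolding linear_map_def sec
      by (auto simp: ts[OF U] ts[OF V(1)] res[OF U] lin mc)
  next
    fix U V W s assume U: "U \<in> opens S" and V: "V \<in> opens S" and W: "W \<in> opens S" and sub: "W \<subseteq> V \<and> V \<subseteq> U"
      and "s \<in> \<Gamma> ?G U"
    then obtain s' where s': "s' \<in> \<Gamma> P U" "s = e U s'" by (auto simp: sec ts(1)[OF U])
    have sub': "W \<subseteq> V" "V \<subseteq> U" using sub by auto
    show "res ?G V W (res ?G U V s) = res ?G U W s"
      unfolding s'(2) res[OF U s'(1)] res[OF V presheaf_res_closed[OF P U V sub'(2) s'(1)]]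
        presheafD(4)[OF P U V W sub' s'(1)] ..
  qed
  show "(\<lambda>U\<in>opens S. \<lambda>s\<in>\<Gamma> P U. e U s) \<in> psh_hom K S P ?G"
  proof (rule psh_homI)
    fix U assume U: "U \<in> opens S"
    show "linear_map K (sec P U) (sec ?G U) ((\<lambda>U\<in>opens S. \<lambda>s\<in>\<Gamma> P U. e U s) U)"
      unfolding linear_map_def sec
      by (auto simp: U ts[OF U] presheaf_add_closed[OF P U] presheaf_smult_closed[OF P U])
  qed (simp_all add: presheaf_res_closed[OF P] res)
  show "\<And>U. U \<in> opens S \<Longrightarrow> bij_betw (e U) (\<Gamma> P U) (\<Gamma> (transport_psh e P) U)"
    using e by (simp add: sec ts bij_betw_def)
qed

lemma (in open_site) is_sheaf_if_iso:
  assumes P: "is_sheaf K S P" and G: "is_presheaf K S G" and i: "i \<in> psh_hom K S P G"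
    and bij: "\<And>U. U \<in> opens S \<Longrightarrow> bij_betw (i U) (\<Gamma> P U) (\<Gamma> G U)"
  shows "is_sheaf K S G"
  unfolding is_sheaf_def
proof (intro conjI ballI allI impI G)
  fix U \<V> s
  assume U: "U \<in> opens S" and V: "\<V> \<in> covers S U"
    and s: "(\<forall>V\<in>\<V>. s V \<in> \<Gamma> G V) \<and>
        (\<forall>V\<in>\<V>. \<forall>W\<in>\<V>. res G V (V \<inter> W) (s V) = res G W (V \<inter> W) (s W))"
  define r where "r V = inv_into (\<Gamma> P V) (i V) (s V)" for V
  have r: "r V \<in> \<Gamma> P V" "i V (r V) = s V" if "V \<in> \<V>" for V
  proof -
    have "s V \<in> i V ` \<Gamma> P V"
      using bij[OF cover_opens[OF V that]] s that by (auto simp: bij_betw_def)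
    then show "r V \<in> \<Gamma> P V" "i V (r V) = s V"
      unfolding r_def by (rule inv_into_into, rule f_inv_into_f)
  qed
  have ex: "\<exists>!t. t \<in> \<Gamma> P U \<and> (\<forall>V\<in>\<V>. res P U V t = r V)"
  proof (rule sheaf_ex1[OF P U V], intro conjI ballI r(1))
    fix V' W assume V': "V' \<in> \<V>" and W: "W \<in> \<V>"
    note VS = cover_opens[OF V V'] and WS = cover_opens[OF V W]
    note o = Int_in[OF VS WS]
    have "i (V' \<inter> W) (res P V' (V' \<inter> W) (r V')) = i (V' \<inter> W) (res P W (V' \<inter> W) (r W))"
      unfolding psh_homD(5)[OF i VS o Int_lower1 r(1)[OF V']] psh_homD(5)[OF i WS o Int_lower2 r(1)[OF W]]
        r(2)[OF V'] r(2)[OF W] using s V' W by blast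
    then show "res P V' (V' \<inter> W) (r V') = res P W (V' \<inter> W) (r W)"
      using bij[OF o] presheaf_res_closed[OF sheaf_presheaf[OF P] VS o Int_lower1 r(1)[OF V']]
        presheaf_res_closed[OF sheaf_presheaf[OF P] WS o Int_lower2 r(1)[OF W]]
      by (auto simp: bij_betw_def dest: inj_onD)
  qed
  then obtain t where t: "t \<in> \<Gamma> P U" "\<And>V. V \<in> \<V> \<Longrightarrow> res P U V t = r V" by blast
  show "\<exists>!t. t \<in> \<Gamma> G U \<and> (\<forall>V\<in>\<V>. res G U V t = s V)"
  proof (rule ex1I[of _ "i U t"], intro conjI ballI)
    show "i U t \<in> \<Gamma> G U" by (rule psh_homD(1)[OF i U t(1)])
    fix V' assume V': "V' \<in> \<V>"
    show "res G U V' (i U t) = s V'"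
      using psh_homD(5)[OF i U cover_opens[OF V V'] cover_subset[OF V V'] t(1)] t(2)[OF V'] r(2)[OF V'] by simp
  next
    fix u assume u: "u \<in> \<Gamma> G U \<and> (\<forall>V\<in>\<V>. res G U V u = s V)"
    then obtain u' where u': "u' \<in> \<Gamma> P U" "u = i U u'"
      using bij[OF U] by (auto simp: bij_betw_def)
    have "res P U V' u' = r V'" if V': "V' \<in> \<V>" for V'
    proof -
      note VS = cover_opens[OF V V'] cover_subset[OF V V']
      have "i V' (res P U V' u') = i V' (r V')"
        using psh_homD(5)[OF i U VS u'(1)] u u'(2) V' r(2)[OF V'] by simp
      then show ?thesis
        using bij[OF VS(1)] presheaf_res_closed[OF sheaf_presheaf[OF P] U VS u'(1)] r(1)[OF V']
        by (auto simp: bij_betw_def dest: inj_onD)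
    qed
    then have "u' = t" using ex t u'(1) by blast
    then show "u = i U t" using u' by simp
  qed
qed

definition family_module :: "'i set \<Rightarrow> ('i \<Rightarrow> ('k, 'p) module) \<Rightarrow> ('i \<Rightarrow> 'p) set \<Rightarrow> ('k, 'i \<Rightarrow> 'p) module" where
  "family_module I M A =
     \<lparr>carrier = A, mult = undefined, one = undefined, zero = (\<lambda>i\<in>I. \<zero>\<^bsub>M i\<^esub>),
      add = (\<lambda>x y. \<lambda>i\<in>I. x i \<oplus>\<^bsub>M i\<^esub> y i), smult = (\<lambda>a x. \<lambda>i\<in>I. a \<odot>\<^bsub>M i\<^esub> x i)\<rparr>"

lemma family_module_simps:
  "carrier (family_module I M A) = A"
  "\<zero>\<^bsub>family_module I M A\<^esub> = (\<lambda>i\<in>I. \<zero>\<^bsub>M i\<^esub>)"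
  "x \<oplus>\<^bsub>family_module I M A\<^esub> y = (\<lambda>i\<in>I. x i \<oplus>\<^bsub>M i\<^esub> y i)"
  "a \<odot>\<^bsub>family_module I M A\<^esub> x = (\<lambda>i\<in>I. a \<odot>\<^bsub>M i\<^esub> x i)"
  by (simp_all add: family_module_def)

text \<open>Closure of \<open>A\<close> under negation follows from closure under scalar
multiplication by \<open>-1\<close>.\<close>

lemma module_family:
  assumes K: "cring K" and M: "\<And>i. i \<in> I \<Longrightarrow> Module.module K (M i)"
    and A: "A \<subseteq> (\<Pi>\<^sub>E i\<in>I. carrier (M i))" and zero: "(\<lambda>i\<in>I. \<zero>\<^bsub>M i\<^esub>) \<in> A"
    and add: "\<And>x y. x \<in> A \<Longrightarrow> y \<in> A \<Longrightarrow> (\<lambda>i\<in>I. x i \<oplus>\<^bsub>M i\<^esub> y i) \<in> A"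
    and smult: "\<And>a x. a \<in> carrier K \<Longrightarrow> x \<in> A \<Longrightarrow> (\<lambda>i\<in>I. a \<odot>\<^bsub>M i\<^esub> x i) \<in> A"
  shows "Module.module K (family_module I M A)"
proof -
  interpret K: cring K by fact
  have xc: "x i \<in> carrier (M i)" if "x \<in> A" "i \<in> I" for x i using A that by auto
  have ext: "(\<lambda>i\<in>I. x i) = x" if "x \<in> A" for x using A that by (auto simp: extensional_restrict)
  have ag: "abelian_group (M i)" if "i \<in> I" for i using M[OF that] by (rule Module.module.axioms(2))
  have a1: "(x \<oplus>\<^bsub>M i\<^esub> y) \<oplus>\<^bsub>M i\<^esub> z = x \<oplus>\<^bsub>M i\<^esub> (y \<oplus>\<^bsub>M i\<^esub> z)" "x \<oplus>\<^bsub>M i\<^esub> y = y \<oplus>\<^bsub>M i\<^esub> x" "\<zero>\<^bsub>M i\<^esub> \<oplus>\<^bsub>M i\<^esub> x = x"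
    if "i \<in> I" "x \<in> carrier (M i)" "y \<in> carrier (M i)" "z \<in> carrier (M i)" for i x y z
  proof -
    interpret abelian_group "M i" by (rule ag[OF that(1)])
    show "(x \<oplus>\<^bsub>M i\<^esub> y) \<oplus>\<^bsub>M i\<^esub> z = x \<oplus>\<^bsub>M i\<^esub> (y \<oplus>\<^bsub>M i\<^esub> z)" "x \<oplus>\<^bsub>M i\<^esub> y = y \<oplus>\<^bsub>M i\<^esub> x" "\<zero>\<^bsub>M i\<^esub> \<oplus>\<^bsub>M i\<^esub> x = x"
      using that by (simp_all add: add.m_ac)
  qed
  have m1: "(\<ominus>\<^bsub>K\<^esub> \<one>\<^bsub>K\<^esub>) \<odot>\<^bsub>M i\<^esub> x \<oplus>\<^bsub>M i\<^esub> x = \<zero>\<^bsub>M i\<^esub>" if "i \<in> I" "x \<in> carrier (M i)" for i x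
  proof -
    interpret Module.module K "M i" by (rule M[OF that(1)])
    have "(\<ominus>\<^bsub>K\<^esub> \<one>\<^bsub>K\<^esub> \<oplus>\<^bsub>K\<^esub> \<one>\<^bsub>K\<^esub>) \<odot>\<^bsub>M i\<^esub> x = (\<ominus>\<^bsub>K\<^esub> \<one>\<^bsub>K\<^esub>) \<odot>\<^bsub>M i\<^esub> x \<oplus>\<^bsub>M i\<^esub> \<one>\<^bsub>K\<^esub> \<odot>\<^bsub>M i\<^esub> x"
      using that(2) by (intro smult_l_distr) simp_all
    then show ?thesis using that(2) by (simp add: K.l_neg)
  qed
  show ?thesis
  proof (rule moduleI[OF K])
    show "abelian_group (family_module I M A)"
    proof (rule abelian_groupI, unfold family_module_simps)
      fix x y assume x: "x \<in> A" and y: "y \<in> A"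
      show "(\<lambda>i\<in>I. x i \<oplus>\<^bsub>M i\<^esub> y i) = (\<lambda>i\<in>I. y i \<oplus>\<^bsub>M i\<^esub> x i)"
        by (rule restrict_ext) (use a1(2) xc x y in blast)
      fix z assume z: "z \<in> A"
      show "(\<lambda>i\<in>I. (\<lambda>i\<in>I. x i \<oplus>\<^bsub>M i\<^esub> y i) i \<oplus>\<^bsub>M i\<^esub> z i) = (\<lambda>i\<in>I. x i \<oplus>\<^bsub>M i\<^esub> (\<lambda>i\<in>I. y i \<oplus>\<^bsub>M i\<^esub> z i) i)"
        by (rule restrict_ext) (simp add: a1(1) xc[OF x] xc[OF y] xc[OF z])
    next
      fix x assume x: "x \<in> A"
      have "(\<lambda>i\<in>I. (\<lambda>i\<in>I. \<zero>\<^bsub>M i\<^esub>) i \<oplus>\<^bsub>M i\<^esub> x i) = (\<lambda>i\<in>I. x i)"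
        by (rule restrict_ext) (simp add: a1(3)[OF _ xc[OF x] xc[OF x] xc[OF x]])
      then show "(\<lambda>i\<in>I. (\<lambda>i\<in>I. \<zero>\<^bsub>M i\<^esub>) i \<oplus>\<^bsub>M i\<^esub> x i) = x" using ext[OF x] by simp
      show "\<exists>y\<in>A. (\<lambda>i\<in>I. y i \<oplus>\<^bsub>M i\<^esub> x i) = (\<lambda>i\<in>I. \<zero>\<^bsub>M i\<^esub>)"
        by (rule bexI[OF _ smult[OF K.a_inv_closed[OF K.one_closed] x]], rule restrict_ext)
           (simp add: m1 xc[OF x])
    qed (use zero add in auto)
  next
    fix a b x assume a: "a \<in> carrier K" and b: "b \<in> carrier K" and "x \<in> carrier (family_module I M A)"
    then have x: "x \<in> A" by (simp add: family_module_simps)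
    show "(a \<oplus>\<^bsub>K\<^esub> b) \<odot>\<^bsub>family_module I M A\<^esub> x = a \<odot>\<^bsub>family_module I M A\<^esub> x \<oplus>\<^bsub>family_module I M A\<^esub> b \<odot>\<^bsub>family_module I M A\<^esub> x"
      unfolding family_module_simps
      by (rule restrict_ext) (simp add: module.smult_l_distr[OF M a b] xc[OF x])
    show "a \<otimes>\<^bsub>K\<^esub> b \<odot>\<^bsub>family_module I M A\<^esub> x = a \<odot>\<^bsub>family_module I M A\<^esub> (b \<odot>\<^bsub>family_module I M A\<^esub> x)"
      unfolding family_module_simps
      by (rule restrict_ext) (simp add: module.smult_assoc1[OF M a b] xc[OF x])
  next
    fix a x y assume a: "a \<in> carrier K" and "x \<in> carrier (family_module I M A)" "y \<in> carrier (family_module I M A)"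
    then have x: "x \<in> A" and y: "y \<in> A" by (simp_all add: family_module_simps)
    show "a \<odot>\<^bsub>family_module I M A\<^esub> (x \<oplus>\<^bsub>family_module I M A\<^esub> y) = a \<odot>\<^bsub>family_module I M A\<^esub> x \<oplus>\<^bsub>family_module I M A\<^esub> a \<odot>\<^bsub>family_module I M A\<^esub> y"
      unfolding family_module_simps
      by (rule restrict_ext) (simp add: module.smult_r_distr[OF M a] xc[OF x] xc[OF y])
  next
    fix x assume "x \<in> carrier (family_module I M A)"
    then have x: "x \<in> A" by (simp add: family_module_simps)
    have "(\<lambda>i\<in>I. \<one>\<^bsub>K\<^esub> \<odot>\<^bsub>M i\<^esub> x i) = (\<lambda>i\<in>I. x i)"
      by (rule restrict_ext) (simp add: module.smult_one[OF M] xc[OF x])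
    then show "\<one>\<^bsub>K\<^esub> \<odot>\<^bsub>family_module I M A\<^esub> x = x" unfolding family_module_simps using ext[OF x] by simp
  qed (simp add: family_module_simps smult)
qed

section \<open>The conic sheaf defined by a sheaf on the conic site\<close>

lemma linear_map_zero:
  assumes "linear_map K M N f" "Module.module K M" "Module.module K N"
  shows "f \<zero>\<^bsub>M\<^esub> = \<zero>\<^bsub>N\<^esub>"
proof -
  interpret M: Module.module K M by fact
  interpret N: Module.module K N by fact
  have c: "f \<zero>\<^bsub>M\<^esub> \<in> carrier N" by (rule linear_mapD(1)[OF assms(1) M.zero_closed])
  have "f \<zero>\<^bsub>M\<^esub> \<oplus>\<^bsub>N\<^esub> f \<zero>\<^bsub>M\<^esub> = f \<zero>\<^bsub>M\<^esub>"
    using linear_mapD(2)[OF assms(1) M.zero_closed M.zero_closed] by simp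
  then show ?thesis using c by (metis N.add.l_cancel_one')
qed

context conic_setting
begin

text \<open>The elements of the limit of \<open>F(sat b)\<close> over the basic subsets
\<open>b\<close> of \<open>U\<close>.\<close>

definition families :: "('a, 'k, 'p) psh \<Rightarrow> 'a set \<Rightarrow> ('a set \<Rightarrow> 'p) set" where
  "families F U = {s \<in> \<Pi>\<^sub>E b\<in>basic_in U. \<Gamma> F (sat b).
     \<forall>b\<in>basic_in U. \<forall>c\<in>basic_in U. c \<subseteq> b \<longrightarrow> res F (sat b) (sat c) (s b) = s c}"

definition family_psh :: "('a, 'k, 'p) psh \<Rightarrow> ('a, 'k, 'a set \<Rightarrow> 'p) psh" where
  "family_psh F = \<lparr>sec = (\<lambda>U. family_module (basic_in U) (\<lambda>b. sec F (sat b)) (families F U)),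
     res = (\<lambda>U V s. restrict s (basic_in V))\<rparr>"

lemma familiesD:
  assumes "s \<in> families F U"
  shows "b \<in> basic_in U \<Longrightarrow> s b \<in> \<Gamma> F (sat b)"
    "b \<in> basic_in U \<Longrightarrow> c \<in> basic_in U \<Longrightarrow> c \<subseteq> b \<Longrightarrow> res F (sat b) (sat c) (s b) = s c"
    "s \<in> extensional (basic_in U)"
  using assms unfolding families_def by (simp_all add: PiE_mem PiE_iff)

lemma familiesI:
  assumes "s \<in> extensional (basic_in U)"
    "\<And>b. b \<in> basic_in U \<Longrightarrow> s b \<in> \<Gamma> F (sat b)"
    "\<And>b c. b \<in> basic_in U \<Longrightarrow> c \<in> basic_in U \<Longrightarrow> c \<subseteq> b \<Longrightarrow> res F (sat b) (sat c) (s b) = s c"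
  shows "s \<in> families F U"
  using assms unfolding families_def by (simp add: PiE_iff)

lemma basic_in_basic: "b \<in> basic_in U \<Longrightarrow> b \<in> basic"
  by (simp add: basic_in_def)

lemma basic_in_mono: "V \<subseteq> U \<Longrightarrow> basic_in V \<subseteq> basic_in U"
  by (auto simp: basic_in_def)

lemma sec_family_psh: "sec (family_psh F) U = family_module (basic_in U) (\<lambda>b. sec F (sat b)) (families F U)"
  and res_family_psh: "res (family_psh F) U V s = restrict s (basic_in V)"
  and carrier_family_psh: "\<Gamma> (family_psh F) U = families F U"
  by (simp_all add: family_psh_def family_module_simps)

lemma families_restrict:
  assumes "s \<in> families F U" "V \<subseteq> U" shows "restrict s (basic_in V) \<in> families F V"
proof -
  have sub: "b \<in> basic_in U" if "b \<in> basic_in V" for b using basic_in_mono[OF assms(2)] that by blast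
  show ?thesis by (rule familiesI) (simp_all add: familiesD[OF assms(1)] sub)
qed

lemma is_presheaf_family_psh:
  assumes K: "cring K" and F: "is_presheaf K S' F"
  shows "is_presheaf K S (family_psh F)"
  unfolding is_presheaf_def
proof (intro conjI ballI impI)
  have so: "sat b \<in> opens S'" if "b \<in> basic_in U" for b U using basic_sat[OF basic_in_basic[OF that]] .
  have lin: "linear_map K (sec F (sat b)) (sec F (sat c)) (res F (sat b) (sat c))"
    if "b \<in> basic_in U" "c \<in> basic_in U" "c \<subseteq> b" for b c U
    by (rule presheafD(2)[OF F so[OF that(1)] so[OF that(2)] sat_mono[OF that(3)]])
  have add: "(\<lambda>b\<in>basic_in U. x b \<oplus>\<^bsub>sec F (sat b)\<^esub> y b) \<in> families F U"
    if x: "x \<in> families F U" and y: "y \<in> families F U" for x y U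
  proof (rule familiesI)
    fix b assume b: "b \<in> basic_in U"
    show "(\<lambda>b\<in>basic_in U. x b \<oplus>\<^bsub>sec F (sat b)\<^esub> y b) b \<in> \<Gamma> F (sat b)"
      using presheaf_add_closed[OF F so[OF b] familiesD(1)[OF x b] familiesD(1)[OF y b]] b by simp
    fix c assume c: "c \<in> basic_in U" "c \<subseteq> b"
    show "res F (sat b) (sat c) ((\<lambda>b\<in>basic_in U. x b \<oplus>\<^bsub>sec F (sat b)\<^esub> y b) b) = (\<lambda>b\<in>basic_in U. x b \<oplus>\<^bsub>sec F (sat b)\<^esub> y b) c"
      using linear_mapD(2)[OF lin[OF b c] familiesD(1)[OF x b] familiesD(1)[OF y b]]
        familiesD(2)[OF x b c] familiesD(2)[OF y b c] b c by simp
  qed simp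
  have smult: "(\<lambda>b\<in>basic_in U. a \<odot>\<^bsub>sec F (sat b)\<^esub> x b) \<in> families F U"
    if a: "a \<in> carrier K" and x: "x \<in> families F U" for a x U
  proof (rule familiesI)
    fix b assume b: "b \<in> basic_in U"
    show "(\<lambda>b\<in>basic_in U. a \<odot>\<^bsub>sec F (sat b)\<^esub> x b) b \<in> \<Gamma> F (sat b)"
      using presheaf_smult_closed[OF F so[OF b] a familiesD(1)[OF x b]] b by simp
    fix c assume c: "c \<in> basic_in U" "c \<subseteq> b"
    show "res F (sat b) (sat c) ((\<lambda>b\<in>basic_in U. a \<odot>\<^bsub>sec F (sat b)\<^esub> x b) b) = (\<lambda>b\<in>basic_in U. a \<odot>\<^bsub>sec F (sat b)\<^esub> x b) c"
      using linear_mapD(3)[OF lin[OF b c] a familiesD(1)[OF x b]] familiesD(2)[OF x b c] b c by simp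
  qed simp
  {
    fix U :: "'a set"
    show "Module.module K (sec (family_psh F) U)"
      unfolding sec_family_psh
    proof (rule module_family[OF K])
      show "Module.module K (sec F (sat b))" if "b \<in> basic_in U" for b
        by (rule presheafD(1)[OF F so[OF that]])
      show "families F U \<subseteq> (\<Pi>\<^sub>E b\<in>basic_in U. \<Gamma> F (sat b))" by (auto simp: families_def)
      show "(\<lambda>b\<in>basic_in U. \<zero>\<^bsub>sec F (sat b)\<^esub>) \<in> families F U"
      proof (rule familiesI)
        fix b assume b: "b \<in> basic_in U"
        show "(\<lambda>b\<in>basic_in U. \<zero>\<^bsub>sec F (sat b)\<^esub>) b \<in> \<Gamma> F (sat b)"
          using presheaf_zero_closed[OF F so[OF b]] b by simp
        fix c assume c: "c \<in> basic_in U" "c \<subseteq> b"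
        show "res F (sat b) (sat c) ((\<lambda>b\<in>basic_in U. \<zero>\<^bsub>sec F (sat b)\<^esub>) b) = (\<lambda>b\<in>basic_in U. \<zero>\<^bsub>sec F (sat b)\<^esub>) c"
          using linear_map_zero[OF lin[OF b c] presheafD(1)[OF F so[OF b]] presheafD(1)[OF F so[OF c(1)]]] b c by simp
      qed simp
    qed (rule add smult, assumption+)+
    fix V :: "'a set" assume "V \<subseteq> U"
    then have sub: "b \<in> basic_in U" if "b \<in> basic_in V" for b using basic_in_mono that by blast
    show "linear_map K (sec (family_psh F) U) (sec (family_psh F) V) (res (family_psh F) U V)"
      unfolding linear_map_def carrier_family_psh
    proof (intro conjI ballI funcsetI)
      show "res (family_psh F) U V x \<in> families F V" if "x \<in> families F U" for x
        unfolding res_family_psh by (rule families_restrict[OF that \<open>V \<subseteq> U\<close>])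
    qed (auto simp: res_family_psh sec_family_psh family_module_simps sub intro!: restrict_ext)
  }
  fix U s assume "s \<in> \<Gamma> (family_psh F) U"
  then have "s \<in> families F U" by (simp add: carrier_family_psh)
  then show "res (family_psh F) U U s = s"
    unfolding res_family_psh by (rule extensional_restrict[OF familiesD(3)])
next
  fix U V W :: "'a set" and s assume "W \<subseteq> V \<and> V \<subseteq> U"
  then have "basic_in V \<inter> basic_in W = basic_in W" using basic_in_mono by blast
  then show "res (family_psh F) V W (res (family_psh F) U V s) = res (family_psh F) U W s"
    by (simp add: res_family_psh)
qed

lemma families_eqI:
  assumes F: "is_sheaf K S' F" and V: "\<V> \<in> covers S U"
    and s: "s \<in> families F U" and t: "t \<in> families F U"
    and eq: "\<And>c. c \<in> subordinate \<V> \<Longrightarrow> s c = t c"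
  shows "s = t"
proof (rule extensionalityI[OF familiesD(3)[OF s] familiesD(3)[OF t]])
  fix b assume b: "b \<in> basic_in U"
  have sub: "c \<in> basic_in U" if "c \<in> subordinate \<V>" for c
    using that S.cover_subset[OF V] basic_in_mono unfolding subordinate_def by blast
  have "\<exists>!u. u \<in> \<Gamma> F (sat b) \<and> (\<forall>c\<in>subordinate \<V>. c \<subseteq> b \<longrightarrow> res F (sat b) (sat c) u = s c)"
    by (rule glue_subordinate[OF F V b familiesD(1)[OF s sub] familiesD(2)[OF s sub sub]])
  moreover have "\<forall>c\<in>subordinate \<V>. c \<subseteq> b \<longrightarrow> res F (sat b) (sat c) (s b) = s c"
    using familiesD(2)[OF s b sub] by blast
  moreover have "\<forall>c\<in>subordinate \<V>. c \<subseteq> b \<longrightarrow> res F (sat b) (sat c) (t b) = s c"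
    using familiesD(2)[OF t b sub] eq by simp
  ultimately show "s b = t b" using familiesD(1)[OF s b] familiesD(1)[OF t b] by blast
qed

text \<open>Compatible sections over the members of a covering amount to a compatible family on
the subordinate basic sets; each component of the glued family is obtained from
\<open>glue_subordinate\<close>, and the components are compatible by uniqueness.\<close>

lemma is_sheaf_family_psh:
  assumes K: "cring K" and F: "is_sheaf K S' F"
  shows "is_sheaf K S (family_psh F)"
  unfolding is_sheaf_def
proof (intro conjI ballI allI impI)
  note P = sheaf_presheaf[OF F]
  show "is_presheaf K S (family_psh F)" by (rule is_presheaf_family_psh[OF K P])
  fix U \<V> s
  assume U: "U \<in> opens S" and V: "\<V> \<in> covers S U"
    and s: "(\<forall>V\<in>\<V>. s V \<in> \<Gamma> (family_psh F) V) \<and>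
      (\<forall>V\<in>\<V>. \<forall>W\<in>\<V>. res (family_psh F) V (V \<inter> W) (s V) = res (family_psh F) W (V \<inter> W) (s W))"
  have sf: "s V \<in> families F V" if "V \<in> \<V>" for V using s that by (simp add: carrier_family_psh)
  have compat: "s V c = s W c" if VW: "V \<in> \<V>" "W \<in> \<V>" and c: "c \<in> basic_in V" "c \<in> basic_in W" for V W c
  proof -
    have "restrict (s V) (basic_in (V \<inter> W)) = restrict (s W) (basic_in (V \<inter> W))"
      using s[THEN conjunct2, rule_format, OF VW] unfolding res_family_psh .
    moreover have "c \<in> basic_in (V \<inter> W)" using c by (simp add: basic_in_def)
    ultimately show ?thesis by (metis restrict_apply')
  qed
  define \<sigma> where "\<sigma> c = s (SOME V. V \<in> \<V> \<and> c \<in> basic_in V) c" for c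
  have \<sigma>: "\<sigma> c = s V c" if "V \<in> \<V>" "c \<in> basic_in V" for V c
  proof -
    let ?W = "SOME V. V \<in> \<V> \<and> c \<in> basic_in V"
    have "?W \<in> \<V> \<and> c \<in> basic_in ?W" by (rule someI[of _ V]) (use that in blast)
    then show ?thesis unfolding \<sigma>_def using compat that by blast
  qed
  have \<sigma>c: "\<sigma> c \<in> \<Gamma> F (sat c)" if c: "c \<in> subordinate \<V>" for c
  proof -
    obtain V where "V \<in> \<V>" "c \<in> basic_in V" using c by (auto simp: subordinate_def)
    then show ?thesis using \<sigma> familiesD(1)[OF sf] by metis
  qed
  have \<sigma>r: "res F (sat c) (sat e) (\<sigma> c) = \<sigma> e" if c: "c \<in> subordinate \<V>" and e: "e \<in> subordinate \<V>" "e \<subseteq> c" for c e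
  proof -
    obtain V where V': "V \<in> \<V>" "c \<in> basic_in V" using c by (auto simp: subordinate_def)
    then have e': "e \<in> basic_in V" using subordinate_basic[OF e(1)] e(2) by (auto simp: basic_in_def)
    show ?thesis unfolding \<sigma>[OF V'] \<sigma>[OF V'(1) e'] by (rule familiesD(2)[OF sf[OF V'(1)] V'(2) e' e(2)])
  qed
  let ?Q = "\<lambda>b t. t \<in> \<Gamma> F (sat b) \<and> (\<forall>c\<in>subordinate \<V>. c \<subseteq> b \<longrightarrow> res F (sat b) (sat c) t = \<sigma> c)"
  have ex: "\<exists>!t. ?Q b t" if "b \<in> basic_in U" for b
    by (rule glue_subordinate[OF F V that \<sigma>c \<sigma>r])
  define t where "t = (\<lambda>b\<in>basic_in U. THE t. ?Q b t)"
  have t: "?Q b (t b)" if "b \<in> basic_in U" for b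
    using theI'[OF ex[OF that]] that by (simp add: t_def)
  have sat_o: "sat b \<in> opens S'" if "b \<in> basic" for b using basic_sat that .
  have tU: "t \<in> families F U"
  proof (rule familiesI)
    show "t \<in> extensional (basic_in U)" by (simp add: t_def)
    fix b assume b: "b \<in> basic_in U"
    show "t b \<in> \<Gamma> F (sat b)" using t[OF b] by blast
    fix c assume c: "c \<in> basic_in U" "c \<subseteq> b"
    note bo = sat_o[OF basic_in_basic[OF b]] and co = sat_o[OF basic_in_basic[OF c(1)]]
    have "?Q c (res F (sat b) (sat c) (t b))"
    proof (intro conjI ballI impI)
      show "res F (sat b) (sat c) (t b) \<in> \<Gamma> F (sat c)"
        by (rule presheaf_res_closed[OF P bo co sat_mono[OF c(2)]]) (use t[OF b] in blast)
      fix e assume e: "e \<in> subordinate \<V>" "e \<subseteq> c"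
      have "res F (sat c) (sat e) (res F (sat b) (sat c) (t b)) = res F (sat b) (sat e) (t b)"
        by (rule presheafD(4)[OF P bo co sat_o[OF subordinate_basic[OF e(1)]] sat_mono[OF e(2)] sat_mono[OF c(2)]])
           (use t[OF b] in blast)
      then show "res F (sat c) (sat e) (res F (sat b) (sat c) (t b)) = \<sigma> e"
        using t[OF b] e c(2) by auto
    qed
    then show "res F (sat b) (sat c) (t b) = t c" using ex[OF c(1)] t[OF c(1)] by blast
  qed
  have ts: "restrict t (basic_in V) = s V" if V': "V \<in> \<V>" for V
  proof (rule extensionalityI[OF restrict_extensional familiesD(3)[OF sf[OF V']]])
    fix c assume c: "c \<in> basic_in V"
    then have cU: "c \<in> basic_in U" and cV: "c \<in> subordinate \<V>"
      using basic_in_mono[OF S.cover_subset[OF V V']] V' by (auto simp: subordinate_def)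
    \<comment> \<open>\<open>c\<close> is itself one of the subordinate sets contained in \<open>c\<close>\<close>
    have "t c = res F (sat c) (sat c) (t c)"
      using presheafD(3)[OF P sat_o[OF basic_in_basic[OF c]]] t[OF cU] by simp
    also have "\<dots> = \<sigma> c" using t[OF cU] cV by blast
    finally show "restrict t (basic_in V) c = s V c" using \<sigma>[OF V' c] c by simp
  qed
  show "\<exists>!t. t \<in> \<Gamma> (family_psh F) U \<and> (\<forall>V\<in>\<V>. res (family_psh F) U V t = s V)"
    unfolding carrier_family_psh res_family_psh
  proof (rule ex1I[of _ t])
    show "t \<in> families F U \<and> (\<forall>V\<in>\<V>. restrict t (basic_in V) = s V)" using tU ts by blast
    fix u assume u: "u \<in> families F U \<and> (\<forall>V\<in>\<V>. restrict u (basic_in V) = s V)"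
    show "u = t"
    proof (rule families_eqI[OF F V _ tU])
      fix c assume "c \<in> subordinate \<V>"
      then obtain V where V': "V \<in> \<V>" "c \<in> basic_in V" by (auto simp: subordinate_def)
      have "restrict u (basic_in V) c = restrict t (basic_in V) c" using u ts V'(1) by simp
      then show "u c = t c" using V'(2) by simp
    qed (use u in blast)
  qed
qed

text \<open>The canonical map from \<open>F(W)\<close> to the limit over the basic subsets of the
conic set \<open>W\<close>.\<close>

definition family_unit :: "('a, 'k, 'p) psh \<Rightarrow> 'a set \<Rightarrow> 'p \<Rightarrow> 'a set \<Rightarrow> 'p" where
  "family_unit F = (\<lambda>W\<in>opens S'. \<lambda>s\<in>\<Gamma> F W. \<lambda>b\<in>basic_in W. res F W (sat b) s)"

lemma family_unit:
  assumes F: "is_sheaf K S' F"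
  shows "family_unit F \<in> psh_hom K S' F (direct_image_psh S' (family_psh F))"
    and "\<And>W. W \<in> opens S' \<Longrightarrow> bij_betw (family_unit F W) (\<Gamma> F W) (families F W)"
proof -
  note P = sheaf_presheaf[OF F]
  have app: "family_unit F W s = (\<lambda>b\<in>basic_in W. res F W (sat b) s)"
    if "W \<in> opens S'" "s \<in> \<Gamma> F W" for W s using that by (simp add: family_unit_def)
  have so: "sat b \<in> opens S'" "sat b \<subseteq> W" if "b \<in> basic_in W" "W \<in> opens S'" for b W
    using basic_sat[OF basic_in_basic[OF that(1)]] sat_subset_conic[OF _ that(2), of b] that(1)
    by (auto simp: basic_in_def)
  have closed: "(\<lambda>b\<in>basic_in W. res F W (sat b) s) \<in> families F W"
    if W: "W \<in> opens S'" and s: "s \<in> \<Gamma> F W" for W s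
  proof (rule familiesI)
    fix b assume b: "b \<in> basic_in W"
    show "(\<lambda>b\<in>basic_in W. res F W (sat b) s) b \<in> \<Gamma> F (sat b)"
      using presheaf_res_closed[OF P W so[OF b W] s] b by simp
    fix c assume c: "c \<in> basic_in W" "c \<subseteq> b"
    show "res F (sat b) (sat c) ((\<lambda>b\<in>basic_in W. res F W (sat b) s) b) = (\<lambda>b\<in>basic_in W. res F W (sat b) s) c"
      using presheafD(4)[OF P W so(1)[OF b W] so(1)[OF c(1) W] sat_mono[OF c(2)] so(2)[OF b W] s] b c by simp
  qed simp
  show "family_unit F \<in> psh_hom K S' F (direct_image_psh S' (family_psh F))"
  proof (rule psh_homI)
    show "family_unit F \<in> extensional (opens S')" by (simp add: family_unit_def)
    fix W assume W: "W \<in> opens S'"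
    show "family_unit F W \<in> extensional (\<Gamma> F W)" by (simp add: family_unit_def W)
    show "linear_map K (sec F W) (sec (direct_image_psh S' (family_psh F)) W) (family_unit F W)"
      unfolding linear_map_def direct_image_psh_simps(1)[OF W] carrier_family_psh
    proof (intro conjI ballI funcsetI)
      fix s assume s: "s \<in> \<Gamma> F W"
      show "family_unit F W s \<in> families F W" unfolding app[OF W s] by (rule closed[OF W s])
      fix t assume t: "t \<in> \<Gamma> F W"
      show "family_unit F W (s \<oplus>\<^bsub>sec F W\<^esub> t) = family_unit F W s \<oplus>\<^bsub>sec (family_psh F) W\<^esub> family_unit F W t"
        unfolding app[OF W s] app[OF W t] app[OF W presheaf_add_closed[OF P W s t]] sec_family_psh family_module_simps
        by (rule restrict_ext) (simp add: linear_mapD(2)[OF presheafD(2)[OF P W so[OF _ W]] s t])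
    next
      fix a s assume a: "a \<in> carrier K" and s: "s \<in> \<Gamma> F W"
      show "family_unit F W (a \<odot>\<^bsub>sec F W\<^esub> s) = a \<odot>\<^bsub>sec (family_psh F) W\<^esub> family_unit F W s"
        unfolding app[OF W s] app[OF W presheaf_smult_closed[OF P W a s]] sec_family_psh family_module_simps
        by (rule restrict_ext) (simp add: linear_mapD(3)[OF presheafD(2)[OF P W so[OF _ W]] a s])
    qed
    fix V s assume V: "V \<in> opens S'" "V \<subseteq> W" and s: "s \<in> \<Gamma> F W"
    have sub: "b \<in> basic_in W" if "b \<in> basic_in V" for b using basic_in_mono[OF V(2)] that by blast
    show "family_unit F V (res F W V s) = res (direct_image_psh S' (family_psh F)) W V (family_unit F W s)"
      unfolding direct_image_psh_simps(2)[OF W V(1)] res_family_psh app[OF W s]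
        app[OF V(1) presheaf_res_closed[OF P W V s]]
      by (rule restrict_ext) (simp add: sub presheafD(4)[OF P W V(1) so[OF _ V(1)] V(2) s])
  qed
  fix W assume W: "W \<in> opens S'"
  show "bij_betw (family_unit F W) (\<Gamma> F W) (families F W)"
    unfolding bij_betw_def
  proof (intro conjI inj_onI equalityI)
    have cov: "range (\<lambda>n. sat (W \<inter> E n)) \<in> covers S' W" by (rule conic_exhaustion[OF W])
    have WE: "W \<inter> E n \<in> basic_in W" for n using conic_Int_E(1)[OF W] by (simp add: basic_in_def)
    {
      fix s t assume s: "s \<in> \<Gamma> F W" and t: "t \<in> \<Gamma> F W"
        and eq: "family_unit F W s = family_unit F W t"
      show "s = t"
      proof (rule S'.sheaf_eqI[OF F W cov s t])
        fix V assume "V \<in> range (\<lambda>n. sat (W \<inter> E n))"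
        then obtain n where n: "V = sat (W \<inter> E n)" by blast
        show "res F W V s = res F W V t"
          using fun_cong[OF eq, of "W \<inter> E n"] WE by (simp add: app[OF W s] app[OF W t] n)
      qed
    }
    show "family_unit F W ` \<Gamma> F W \<subseteq> families F W"
      using app[OF W] closed[OF W] by auto
    show "families F W \<subseteq> family_unit F W ` \<Gamma> F W"
    proof
      fix s assume s: "s \<in> families F W"
      define n where "n V = (SOME n. V = sat (W \<inter> E n))" for V
      have n: "sat (W \<inter> E (n V)) = V" if "V \<in> range (\<lambda>n. sat (W \<inter> E n))" for V
      proof -
        from that obtain m where "V = sat (W \<inter> E m)" by blast
        then have "V = sat (W \<inter> E (n V))" unfolding n_def by (rule someI)
        then show ?thesis by simp
      qed
      \<comment> \<open>the components at the nested sets \<open>W \<inter> E m\<close> determine all others and are glued over \<open>W\<close>\<close>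
      have nest: "W \<inter> E m \<subseteq> W \<inter> E k" if "m \<le> k" for m k using E_mono[OF that] by blast
      have agree: "res F (sat (W \<inter> E m)) (sat (W \<inter> E m) \<inter> sat (W \<inter> E k)) (s (W \<inter> E m)) =
          res F (sat (W \<inter> E k)) (sat (W \<inter> E m) \<inter> sat (W \<inter> E k)) (s (W \<inter> E k))" if "m \<le> k" for m k
      proof -
        have i: "sat (W \<inter> E m) \<inter> sat (W \<inter> E k) = sat (W \<inter> E m)"
          using sat_mono[OF nest[OF that]] by blast
        show ?thesis unfolding i
          using familiesD(2)[OF s WE WE nest[OF that]] presheafD(3)[OF P so(1)[OF WE W] familiesD(1)[OF s WE]] by simp
      qed
      have "\<exists>!t. t \<in> \<Gamma> F W \<and> (\<forall>V\<in>range (\<lambda>n. sat (W \<inter> E n)). res F W V t = s (W \<inter> E (n V)))"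
      proof (rule sheaf_ex1[OF F W cov], intro conjI ballI)
        fix V assume V: "V \<in> range (\<lambda>n. sat (W \<inter> E n))"
        show "s (W \<inter> E (n V)) \<in> \<Gamma> F V" using familiesD(1)[OF s WE] n[OF V] by metis
        fix V' assume V': "V' \<in> range (\<lambda>n. sat (W \<inter> E n))"
        have "n V \<le> n V' \<or> n V' \<le> n V" by linarith
        then show "res F V (V \<inter> V') (s (W \<inter> E (n V))) = res F V' (V \<inter> V') (s (W \<inter> E (n V')))"
          using agree[of "n V" "n V'"] agree[of "n V'" "n V"] unfolding n[OF V] n[OF V'] by (auto simp: Int_commute)
      qed
      then obtain t where t: "t \<in> \<Gamma> F W"
        "\<forall>V\<in>range (\<lambda>n. sat (W \<inter> E n)). res F W V t = s (W \<inter> E (n V))" by blast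
      have tn: "res F W (sat (W \<inter> E m)) t = s (W \<inter> E m)" for m
      proof -
        let ?V = "sat (W \<inter> E m)"
        have V: "?V \<in> range (\<lambda>n. sat (W \<inter> E n))" by blast
        obtain k where k: "sat (W \<inter> E k) = ?V" "res F W ?V t = s (W \<inter> E k)"
          using n[OF V] t(2) V by blast
        have "res F ?V ?V (s (W \<inter> E k)) = res F ?V ?V (s (W \<inter> E m))"
        proof (cases "k \<le> m")
          case True
          show ?thesis using agree[OF True] unfolding k(1) Int_absorb .
        next
          case False
          then have "m \<le> k" by simp
          show ?thesis using agree[OF \<open>m \<le> k\<close>] unfolding k(1) Int_absorb by (rule sym)
        qed
        then show ?thesis
          using presheafD(3)[OF P so(1)[OF WE W] familiesD(1)[OF s WE], of m]
            presheafD(3)[OF P so(1)[OF WE W] familiesD(1)[OF s WE], of k] unfolding k by simp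
      qed
      have "family_unit F W t = s"
        unfolding app[OF W t(1)]
      proof (rule extensionalityI[OF restrict_extensional familiesD(3)[OF s]])
        fix b assume b: "b \<in> basic_in W"
        obtain m where "b \<subseteq> E m" using Op_c_in_E[OF basic_Op_c[OF basic_in_basic[OF b]]] .
        then have bm: "b \<subseteq> W \<inter> E m" using b by (auto simp: basic_in_def)
        have "res F W (sat b) t = res F (sat (W \<inter> E m)) (sat b) (res F W (sat (W \<inter> E m)) t)"
          by (rule presheafD(4)[OF P W so(1)[OF WE W] so(1)[OF b W] sat_mono[OF bm] so(2)[OF WE W] t(1), symmetric])
        also have "\<dots> = s b" unfolding tn by (rule familiesD(2)[OF s WE b bm])
        finally show "(\<lambda>b\<in>basic_in W. res F W (sat b) t) b = s b" using b by simp
      qed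
      then show "s \<in> family_unit F W ` \<Gamma> F W" using t(1) by blast
    qed
  qed
qed

section \<open>Conic extensions exist\<close>

lemma conic_sheaf_iff:
  "conic_sheaf X \<mu> F \<longleftrightarrow>
     (\<forall>b\<in>basic. bij_betw (res F (sat b) b) (\<Gamma> F (sat b)) (\<Gamma> F b))"
  using sat_Op by (auto simp: conic_sheaf_def basic_def)

lemma conic_sheaf_if_iso:
  assumes P: "conic_sheaf X \<mu> P" and i: "i \<in> psh_hom K S P G"
    and bij: "\<And>U. U \<in> opens S \<Longrightarrow> bij_betw (i U) (\<Gamma> P U) (\<Gamma> G U)"
  shows "conic_sheaf X \<mu> G"
  unfolding conic_sheaf_iff
proof
  fix b assume b: "b \<in> basic"
  have o: "sat b \<in> opens S" "b \<in> opens S" using conic_Op[OF basic_sat[OF b]] basic_Op[OF b] by simp_all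
  note sub = subset_sat[OF basic_pts[OF b]]
  have r: "bij_betw (res P (sat b) b) (\<Gamma> P (sat b)) (\<Gamma> P b)"
    using P b by (simp add: conic_sheaf_iff)
  have "bij_betw (i b \<circ> res P (sat b) b) (\<Gamma> P (sat b)) (\<Gamma> G b)"
    by (rule bij_betw_trans[OF r bij[OF o(2)]])
  then have "bij_betw (res G (sat b) b \<circ> i (sat b)) (\<Gamma> P (sat b)) (\<Gamma> G b)"
    by (rule iffD1[OF bij_betw_cong, rotated]) (simp add: psh_homD(5)[OF i o sub])
  then show "bij_betw (res G (sat b) b) (\<Gamma> G (sat b)) (\<Gamma> G b)"
    using bij_betw_comp_iff[OF bij[OF o(1)]] by blast
qed

text \<open>If \<open>b\<close> is basic, it is the largest basic subset of itself, so the limit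
over \<open>b\<close> is \<open>F(sat b)\<close>; and the limit over the conic set \<open>sat
b\<close> is \<open>F(sat b)\<close> as well.\<close>

lemma conic_family_psh:
  assumes F: "is_sheaf K S' F"
  shows "conic_sheaf X \<mu> (family_psh F)"
  unfolding conic_sheaf_iff carrier_family_psh
proof
  fix b assume b: "b \<in> basic"
  note P = sheaf_presheaf[OF F] and sb = basic_sat[OF b]
  have bb: "b \<in> basic_in b" using b by (simp add: basic_in_def)
  have so: "sat c \<in> opens S'" "sat c \<subseteq> sat b" "c \<subseteq> b" if "c \<in> basic_in b" for c
    using basic_sat[OF basic_in_basic[OF that]] that sat_mono[of c b] by (auto simp: basic_in_def)
  have sub: "c \<in> basic_in (sat b)" if "c \<in> basic_in b" for c
    using that subset_sat[OF basic_pts[OF b]] by (auto simp: basic_in_def)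
  let ?\<rho> = "\<lambda>u. \<lambda>c\<in>basic_in b. res F (sat b) (sat c) u"
  have closed: "?\<rho> u \<in> families F b" if u: "u \<in> \<Gamma> F (sat b)" for u
  proof (rule familiesI)
    fix c assume c: "c \<in> basic_in b"
    show "?\<rho> u c \<in> \<Gamma> F (sat c)" using presheaf_res_closed[OF P sb so(1,2)[OF c] u] c by simp
    fix d assume d: "d \<in> basic_in b" "d \<subseteq> c"
    show "res F (sat c) (sat d) (?\<rho> u c) = ?\<rho> u d"
      using presheafD(4)[OF P sb so(1)[OF c] so(1)[OF d(1)] sat_mono[OF d(2)] so(2)[OF c] u] c d by simp
  qed simp
  have "bij_betw ?\<rho> (\<Gamma> F (sat b)) (families F b)"
  proof (rule bij_betwI[where g = "\<lambda>s. s b"])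
    show "?\<rho> \<in> \<Gamma> F (sat b) \<rightarrow> families F b" using closed by blast
    show "(\<lambda>s. s b) \<in> families F b \<rightarrow> \<Gamma> F (sat b)" using familiesD(1)[OF _ bb] by blast
    show "?\<rho> u b = u" if "u \<in> \<Gamma> F (sat b)" for u
      using presheafD(3)[OF P sb that] bb by simp
    show "?\<rho> (s b) = s" if s: "s \<in> families F b" for s
      by (rule extensionalityI[OF restrict_extensional familiesD(3)[OF s]])
         (simp add: familiesD(2)[OF s bb] so(3))
  qed
  then have "bij_betw (res (family_psh F) (sat b) b \<circ> family_unit F (sat b)) (\<Gamma> F (sat b)) (families F b)"
    by (rule iffD1[OF bij_betw_cong, rotated])
       (auto simp: res_family_psh family_unit_def sb sub intro!: restrict_ext)
  then show "bij_betw (res (family_psh F) (sat b) b) (families F (sat b)) (families F b)"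
    using bij_betw_comp_iff[OF family_unit(2)[OF F sb]] by blast
qed

lemma countable_basic_cover:
  assumes U: "U \<in> Op_sa X"
  obtains D where "countable D" "D \<subseteq> basic_in U" "D \<in> covers S U"
proof -
  have "\<exists>T. finite T \<and> T \<subseteq> basic_in (U \<inter> E n) \<and> \<Union>T = U \<inter> E n" for n
    using finite_basic_cover[OF Op_c_Int[OF E_Op_c U]] by metis
  then obtain T where T: "\<And>n. finite (T n)" "\<And>n. T n \<subseteq> basic_in (U \<inter> E n)" "\<And>n. \<Union>(T n) = U \<inter> E n" by metis
  have sub: "\<Union>(range T) \<subseteq> basic_in U" using T(2) basic_in_mono[OF Int_lower1] by blast
  have "\<exists>T0\<subseteq>\<Union>(range T). finite T0 \<and> C \<inter> \<Union>T0 = C \<inter> U" if C: "compactin (mtop X) C" for C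
  proof -
    obtain n where "C \<subseteq> E n" using compact_in_E[OF C] .
    then have "C \<inter> \<Union>(T n) = C \<inter> U" unfolding T(3) by blast
    moreover have "T n \<subseteq> \<Union>(range T)" by blast
    ultimately show ?thesis using T(1)[of n] by (intro exI[of _ "T n"] conjI)
  qed
  moreover have "\<Union>(range T) \<subseteq> Op_sa X" "\<forall>V\<in>\<Union>(range T). V \<subseteq> U"
    using sub basic_Op by (auto simp: basic_in_def subset_iff)
  ultimately have "\<Union>(range T) \<in> covers S U" unfolding covers_iff by (intro conjI allI impI)
  moreover have "countable (\<Union>(range T))" using T(1) by (simp add: countable_finite)
  ultimately show thesis using that sub by blast
qed

text \<open>By separatedness a compatible family is determined by its components on a countable
covering by basic sets, that is, by a sequence in \<open>'m\<close>.\<close>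

lemma families_encoding:
  fixes F :: "('a, 'k, 'm) psh" and j :: "(nat \<Rightarrow> 'm) \<Rightarrow> 'm"
  assumes F: "is_sheaf K S' F" and j: "inj j" and U: "U \<in> Op_sa X"
  obtains e :: "('a set \<Rightarrow> 'm) \<Rightarrow> 'm" where "inj_on e (families F U)"
proof -
  obtain D where D: "countable D" "D \<subseteq> basic_in U" "D \<in> covers S U" using countable_basic_cover[OF U] .
  have "inj_on (\<lambda>s. j (\<lambda>k. s (from_nat_into D k))) (families F U)"
  proof (rule inj_onI)
    fix s t assume s: "s \<in> families F U" and t: "t \<in> families F U"
      and eq: "j (\<lambda>k. s (from_nat_into D k)) = j (\<lambda>k. t (from_nat_into D k))"
    have "(\<lambda>k. s (from_nat_into D k)) = (\<lambda>k. t (from_nat_into D k))"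
      using eq by (simp only: inj_eq[OF j])
    then have k: "s (from_nat_into D k) = t (from_nat_into D k)" for k
      by (rule fun_cong)
    have d: "s d = t d" if "d \<in> D" for d
      using k[of "to_nat_on D d"] from_nat_into_to_nat_on[OF D(1) that] by simp
    show "s = t"
    proof (rule families_eqI[OF F D(3) s t])
      fix c assume "c \<in> subordinate D"
      then obtain d' where d': "d' \<in> D" "c \<in> basic_in d'" by (auto simp: subordinate_def)
      then have dU: "d' \<in> basic_in U" using D(2) by blast
      then have cU: "c \<in> basic_in U" "c \<subseteq> d'" using d'(2) by (auto simp: basic_in_def)
      show "s c = t c" using familiesD(2)[OF s dU cU] familiesD(2)[OF t dU cU] d[OF d'(1)] by simp
    qed
  qed
  then show thesis by (rule that)
qed

text \<open>The limit over basic sets has all these properties, except that its sections are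
families; the encodings move them into \<open>'m\<close>.\<close>

lemma conic_extension_exists:
  fixes F :: "('a, 'k, 'm) psh" and j :: "(nat \<Rightarrow> 'm) \<Rightarrow> 'm"
  assumes K: "cring K" and F: "is_sheaf K S' F" and j: "inj j"
  obtains G :: "('a, 'k, 'm) psh" and \<theta>
  where "is_sheaf K S G" "conic_sheaf X \<mu> G" "\<theta> \<in> psh_hom K S' F (direct_image_psh S' G)"
    "\<And>W. W \<in> opens S' \<Longrightarrow> bij_betw (\<theta> W) (\<Gamma> F W) (\<Gamma> G W)"
proof -
  let ?P = "family_psh F"
  have P: "is_sheaf K S ?P" by (rule is_sheaf_family_psh[OF K F])
  have "\<exists>e :: ('a set \<Rightarrow> 'm) \<Rightarrow> 'm. inj_on e (families F U)" if "U \<in> opens S" for U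
    using families_encoding[OF F j, of U] that by (metis opens_sa)
  then obtain e :: "'a set \<Rightarrow> ('a set \<Rightarrow> 'm) \<Rightarrow> 'm" where e: "\<And>U. U \<in> opens S \<Longrightarrow> inj_on (e U) (\<Gamma> ?P U)"
    unfolding carrier_family_psh by metis
  let ?G = "transport_psh e ?P" and ?i = "\<lambda>U\<in>opens S. \<lambda>s\<in>\<Gamma> ?P U. e U s"
  have PG: "is_presheaf K S ?G" by (rule transport_psh(1)[OF sheaf_presheaf[OF P] e])
  have i: "?i \<in> psh_hom K S ?P ?G" by (rule transport_psh(2)[OF sheaf_presheaf[OF P] e])
  have bij: "bij_betw (?i U) (\<Gamma> ?P U) (\<Gamma> ?G U)" if U: "U \<in> opens S" for U
  proof -
    have "bij_betw (e U) (\<Gamma> ?P U) (\<Gamma> ?G U)"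
      by (rule transport_psh(3)[OF sheaf_presheaf[OF P] e U])
    then show ?thesis by (rule iffD1[OF bij_betw_cong, rotated]) (use U in simp)
  qed
  let ?\<theta> = "psh_comp S' F (hom_restrict S' ?i) (family_unit F)"
  note u = family_unit[OF F]
  show thesis
  proof
    show "is_sheaf K S ?G" by (rule S.is_sheaf_if_iso[OF P PG i bij])
    show "conic_sheaf X \<mu> ?G" by (rule conic_sheaf_if_iso[OF conic_family_psh[OF F] i bij])
    show "?\<theta> \<in> psh_hom K S' F (direct_image_psh S' ?G)"
      by (rule psh_comp_in_hom[OF sheaf_presheaf[OF F] u(1) hom_restrict_in_hom[OF opens_sub i]])
    fix W assume W: "W \<in> opens S'"
    then have WS: "W \<in> opens S" using opens_sub by blast
    have "bij_betw (?i W \<circ> family_unit F W) (\<Gamma> F W) (\<Gamma> ?G W)"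
      by (rule bij_betw_trans[OF _ bij[OF WS]]) (use u(2)[OF W] in \<open>simp only: carrier_family_psh\<close>)
    then show "bij_betw (?\<theta> W) (\<Gamma> F W) (\<Gamma> ?G W)"
      by (rule iffD1[OF bij_betw_cong, rotated]) (simp add: psh_comp_def hom_restrict_def W)
  qed
qed

section \<open>Morphisms out of a conic sheaf\<close>

text \<open>Over a basic \<open>b\<close> the extension is forced: a section of \<open>G\<close>
over \<open>b\<close> is the restriction of a unique \<open>u\<close> over \<open>sat b\<close>,
and must go to the restriction of \<open>f u\<close>. These values glue in \<open>H\<close>. The
relation \<open>Q\<close> of the proof expresses that \<open>t\<close> has the forced restrictions
to all basic sets; it determines \<open>t\<close>, and linearity and naturality follow by checking
\<open>Q\<close>.\<close>

lemma hom_extends_from_conic: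
  assumes G: "is_sheaf K S G" and conic: "conic_sheaf X \<mu> G" and H: "is_sheaf K S H"
    and f: "f \<in> psh_hom K S' (direct_image_psh S' G) (direct_image_psh S' H)"
  shows "\<exists>!g. g \<in> psh_hom K S G H \<and> hom_restrict S' g = f"
proof -
  note PG = sheaf_presheaf[OF G] and PH = sheaf_presheaf[OF H]
  have so: "sat b \<in> opens S'" "sat b \<in> opens S" "b \<in> opens S" "b \<subseteq> sat b" if "b \<in> basic" for b
    using basic_sat[OF that] conic_Op[OF basic_sat[OF that]] basic_Op[OF that] subset_sat[OF basic_pts[OF that]]
    by simp_all
  have fc: "f W s \<in> \<Gamma> H W" if "W \<in> opens S'" "s \<in> \<Gamma> G W" for W s
    using psh_homD(1)[OF f that(1)] that by (simp only: direct_image_psh_simps)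
  have fnat: "f V (res G W V s) = res H W V (f W s)" if "W \<in> opens S'" "V \<in> opens S'" "V \<subseteq> W" "s \<in> \<Gamma> G W" for W V s
    using psh_homD(5)[OF f that(1-3)] that by (simp only: direct_image_psh_simps)
  have bijG: "bij_betw (res G (sat b) b) (\<Gamma> G (sat b)) (\<Gamma> G b)" if "b \<in> basic" for b
    using conic that by (simp add: conic_sheaf_iff)
  have injG: "u = v" if "b \<in> basic" "u \<in> \<Gamma> G (sat b)" "v \<in> \<Gamma> G (sat b)"
    "res G (sat b) b u = res G (sat b) b v" for b u v
    using bijG[OF that(1)] that(2-4) by (auto simp: bij_betw_def dest: inj_onD)
  define Q where "Q U s t \<longleftrightarrow> t \<in> \<Gamma> H U \<and> (\<forall>b\<in>basic_in U. \<forall>u\<in>\<Gamma> G (sat b).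
      res G (sat b) b u = res G U b s \<longrightarrow> res H U b t = res H (sat b) b (f (sat b) u))" for U s t
  have bU: "b \<in> basic" "b \<subseteq> U" if "b \<in> basic_in U" for b U using that by (auto simp: basic_in_def)
  have lift: "\<exists>u\<in>\<Gamma> G (sat b). res G (sat b) b u = res G U b s"
    if U: "U \<in> opens S" and b: "b \<in> basic_in U" and s: "s \<in> \<Gamma> G U" for U b s
  proof -
    have "res G U b s \<in> \<Gamma> G b" by (rule presheaf_res_closed[OF PG U so(3)[OF bU(1)[OF b]] bU(2)[OF b] s])
    then show ?thesis using bijG[OF bU(1)[OF b]] unfolding bij_betw_def by (metis imageE)
  qed
  have Qc: "t \<in> \<Gamma> H U" if "Q U s t" for U s t using that by (simp add: Q_def)
  have Qr: "res H U b t = res H (sat b) b (f (sat b) u)"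
    if "Q U s t" "b \<in> basic_in U" "u \<in> \<Gamma> G (sat b)" "res G (sat b) b u = res G U b s" for U s t b u
    using that unfolding Q_def by blast
  have Quniq: "t = t'" if U: "U \<in> opens S" and s: "s \<in> \<Gamma> G U" and t: "Q U s t" and t': "Q U s t'" for U s t t'
  proof (rule S.sheaf_eqI[OF H U basic_in_cover Qc[OF t] Qc[OF t']])
    show "U \<in> Op_sa X" using U by simp
    fix b assume b: "b \<in> basic_in U"
    obtain u where u: "u \<in> \<Gamma> G (sat b)" "res G (sat b) b u = res G U b s" using lift[OF U b s] by blast
    show "res H U b t = res H U b t'" using Qr[OF t b u] Qr[OF t' b u] by simp
  qed
  have Qex: "\<exists>t. Q U s t" if U: "U \<in> opens S" and s: "s \<in> \<Gamma> G U" for U s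
  proof -
    obtain u where u: "\<And>b. b \<in> basic_in U \<Longrightarrow> u b \<in> \<Gamma> G (sat b)"
      "\<And>b. b \<in> basic_in U \<Longrightarrow> res G (sat b) b (u b) = res G U b s"
      using lift[OF U _ s] by metis
    define \<beta> where "\<beta> b = res H (sat b) b (f (sat b) (u b))" for b
    have \<beta>c: "\<beta> b \<in> \<Gamma> H b" if b: "b \<in> basic_in U" for b
      unfolding \<beta>_def using so[OF bU(1)[OF b]] fc[OF so(1)[OF bU(1)[OF b]] u(1)[OF b]]
      by (intro presheaf_res_closed[OF PH])
    have \<beta>r: "res H b e (\<beta> b) = \<beta> e" if b: "b \<in> basic_in U" and e: "e \<in> basic" "e \<subseteq> b" for b e
    proof -
      have eU: "e \<in> basic_in U" using e bU(2)[OF b] by (simp add: basic_in_def)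
      note sb = so[OF bU(1)[OF b]] and se = so[OF e(1)] and m = sat_mono[OF e(2)]
      have "res G (sat e) e (res G (sat b) (sat e) (u b)) = res G (sat b) e (u b)"
        by (rule presheafD(4)[OF PG sb(2) se(2,3,4) m u(1)[OF b]])
      also have "\<dots> = res G b e (res G (sat b) b (u b))"
        by (rule presheafD(4)[OF PG sb(2,3) se(3) e(2) sb(4) u(1)[OF b], symmetric])
      also have "\<dots> = res G U e s"
        unfolding u(2)[OF b] by (rule presheafD(4)[OF PG U sb(3) se(3) e(2) bU(2)[OF b] s])
      also have "\<dots> = res G (sat e) e (u e)" by (rule u(2)[OF eU, symmetric])
      finally have ue: "res G (sat b) (sat e) (u b) = u e"
        by (rule injG[OF e(1) presheaf_res_closed[OF PG sb(2) se(2) m u(1)[OF b]] u(1)[OF eU]])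
      note fb = fc[OF sb(1) u(1)[OF b]]
      have "res H b e (\<beta> b) = res H (sat b) e (f (sat b) (u b))"
        unfolding \<beta>_def by (rule presheafD(4)[OF PH sb(2,3) se(3) e(2) sb(4) fb])
      also have "\<dots> = res H (sat e) e (res H (sat b) (sat e) (f (sat b) (u b)))"
        by (rule presheafD(4)[OF PH sb(2) se(2,3,4) m fb, symmetric])
      also have "\<dots> = \<beta> e"
        unfolding fnat[OF sb(1) se(1) m u(1)[OF b], symmetric] ue \<beta>_def ..
      finally show ?thesis .
    qed
    have UO: "U \<in> Op_sa X" using U by simp
    have "\<exists>!t. t \<in> \<Gamma> H U \<and> (\<forall>b\<in>basic_in U. res H U b t = \<beta> b)"
    proof (rule sheaf_ex1[OF H U basic_in_cover[OF UO]], intro conjI ballI \<beta>c)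
      fix b c assume b: "b \<in> basic_in U" and c: "c \<in> basic_in U"
      note b' = so(3)[OF bU(1)[OF b]] and c' = so(3)[OF bU(1)[OF c]]
      have o: "b \<inter> c \<in> opens S" using S.Int_in[OF b' c'] .
      then have oO: "b \<inter> c \<in> Op_sa X" by simp
      show "res H b (b \<inter> c) (\<beta> b) = res H c (b \<inter> c) (\<beta> c)"
      proof (rule S.sheaf_eqI[OF H o basic_in_cover[OF oO]])
        show "res H b (b \<inter> c) (\<beta> b) \<in> \<Gamma> H (b \<inter> c)"
          by (rule presheaf_res_closed[OF PH b' o Int_lower1 \<beta>c[OF b]])
        show "res H c (b \<inter> c) (\<beta> c) \<in> \<Gamma> H (b \<inter> c)"
          by (rule presheaf_res_closed[OF PH c' o Int_lower2 \<beta>c[OF c]])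
        fix e assume e: "e \<in> basic_in (b \<inter> c)"
        note e' = bU[OF e]
        have sub: "e \<subseteq> b" "e \<subseteq> c" using e'(2) by auto
        show "res H (b \<inter> c) e (res H b (b \<inter> c) (\<beta> b)) = res H (b \<inter> c) e (res H c (b \<inter> c) (\<beta> c))"
          unfolding presheafD(4)[OF PH b' o so(3)[OF e'(1)] e'(2) Int_lower1 \<beta>c[OF b]]
            presheafD(4)[OF PH c' o so(3)[OF e'(1)] e'(2) Int_lower2 \<beta>c[OF c]]
            \<beta>r[OF b e'(1) sub(1)] \<beta>r[OF c e'(1) sub(2)] ..
      qed
    qed
    then obtain t where t: "t \<in> \<Gamma> H U" "\<And>b. b \<in> basic_in U \<Longrightarrow> res H U b t = \<beta> b" by blast
    have "Q U s t"
      unfolding Q_def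
    proof (intro conjI ballI impI t(1))
      fix b v assume b: "b \<in> basic_in U" and v: "v \<in> \<Gamma> G (sat b)" "res G (sat b) b v = res G U b s"
      have "v = u b" by (rule injG[OF bU(1)[OF b] v(1) u(1)[OF b]]) (simp only: v(2) u(2)[OF b])
      then show "res H U b t = res H (sat b) b (f (sat b) v)" using t(2)[OF b] by (simp add: \<beta>_def)
    qed
    then show ?thesis ..
  qed
  define g where "g = (\<lambda>U\<in>opens S. \<lambda>s\<in>\<Gamma> G U. THE t. Q U s t)"
  have g: "Q U s (g U s)" if U: "U \<in> opens S" and s: "s \<in> \<Gamma> G U" for U s
  proof -
    have "\<exists>!t. Q U s t" using Qex[OF U s] Quniq[OF U s] by blast
    from theI'[OF this] show ?thesis using U s by (simp add: g_def)
  qed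
  have geq: "g U s = t" if "U \<in> opens S" "s \<in> \<Gamma> G U" "Q U s t" for U s t
    by (rule Quniq[OF that(1,2) g[OF that(1,2)] that(3)])
  have ghom: "g \<in> psh_hom K S G H"
  proof (rule psh_homI)
    show "g \<in> extensional (opens S)" by (simp add: g_def)
    fix U assume U: "U \<in> opens S"
    show "g U \<in> extensional (\<Gamma> G U)" using U by (simp add: g_def)
    show "linear_map K (sec G U) (sec H U) (g U)"
      unfolding linear_map_def
    proof (intro conjI ballI funcsetI)
      fix s assume s: "s \<in> \<Gamma> G U"
      note gs = g[OF U s]
      show "g U s \<in> \<Gamma> H U" by (rule Qc[OF gs])
      { fix s' assume s': "s' \<in> \<Gamma> G U"
        note gs' = g[OF U s']
        show "g U (s \<oplus>\<^bsub>sec G U\<^esub> s') = g U s \<oplus>\<^bsub>sec H U\<^esub> g U s'"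
        proof (rule geq[OF U presheaf_add_closed[OF PG U s s']], unfold Q_def, intro conjI ballI impI)
          show "g U s \<oplus>\<^bsub>sec H U\<^esub> g U s' \<in> \<Gamma> H U"
            by (rule presheaf_add_closed[OF PH U Qc[OF gs] Qc[OF gs']])
          fix b u assume b: "b \<in> basic_in U" and u: "u \<in> \<Gamma> G (sat b)"
            "res G (sat b) b u = res G U b (s \<oplus>\<^bsub>sec G U\<^esub> s')"
          note b' = bU[OF b] and sb = so[OF bU(1)[OF b]]
          obtain v where v: "v \<in> \<Gamma> G (sat b)" "res G (sat b) b v = res G U b s" using lift[OF U b s] by blast
          obtain v' where v': "v' \<in> \<Gamma> G (sat b)" "res G (sat b) b v' = res G U b s'" using lift[OF U b s'] by blast
          have "res G (sat b) b u = res G (sat b) b (v \<oplus>\<^bsub>sec G (sat b)\<^esub> v')"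
            unfolding u(2) linear_mapD(2)[OF presheafD(2)[OF PG sb(2,3,4)] v(1) v'(1)] v(2) v'(2)
            by (rule linear_mapD(2)[OF presheafD(2)[OF PG U sb(3) b'(2)] s s'])
          then have uv: "u = v \<oplus>\<^bsub>sec G (sat b)\<^esub> v'"
            by (rule injG[OF b'(1) u(1) presheaf_add_closed[OF PG sb(2) v(1) v'(1)]])
          have fadd: "f (sat b) u = f (sat b) v \<oplus>\<^bsub>sec H (sat b)\<^esub> f (sat b) v'"
            unfolding uv using psh_homD(3)[OF f sb(1)] v(1) v'(1) by (simp only: direct_image_psh_simps sb(1))
          show "res H U b (g U s \<oplus>\<^bsub>sec H U\<^esub> g U s') = res H (sat b) b (f (sat b) u)"
            unfolding fadd linear_mapD(2)[OF presheafD(2)[OF PH U sb(3) b'(2)] Qc[OF gs] Qc[OF gs']]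
              linear_mapD(2)[OF presheafD(2)[OF PH sb(2,3,4)] fc[OF sb(1) v(1)] fc[OF sb(1) v'(1)]]
              Qr[OF gs b v] Qr[OF gs' b v'] ..
        qed }
      { fix a assume a: "a \<in> carrier K"
        show "g U (a \<odot>\<^bsub>sec G U\<^esub> s) = a \<odot>\<^bsub>sec H U\<^esub> g U s"
        proof (rule geq[OF U presheaf_smult_closed[OF PG U a s]], unfold Q_def, intro conjI ballI impI)
          show "a \<odot>\<^bsub>sec H U\<^esub> g U s \<in> \<Gamma> H U"
            by (rule presheaf_smult_closed[OF PH U a Qc[OF gs]])
          fix b u assume b: "b \<in> basic_in U" and u: "u \<in> \<Gamma> G (sat b)"
            "res G (sat b) b u = res G U b (a \<odot>\<^bsub>sec G U\<^esub> s)"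
          note b' = bU[OF b] and sb = so[OF bU(1)[OF b]]
          obtain v where v: "v \<in> \<Gamma> G (sat b)" "res G (sat b) b v = res G U b s" using lift[OF U b s] by blast
          have "res G (sat b) b u = res G (sat b) b (a \<odot>\<^bsub>sec G (sat b)\<^esub> v)"
            unfolding u(2) linear_mapD(3)[OF presheafD(2)[OF PG sb(2,3,4)] a v(1)] v(2)
            by (rule linear_mapD(3)[OF presheafD(2)[OF PG U sb(3) b'(2)] a s])
          then have uv: "u = a \<odot>\<^bsub>sec G (sat b)\<^esub> v"
            by (rule injG[OF b'(1) u(1) presheaf_smult_closed[OF PG sb(2) a v(1)]])
          have fsm: "f (sat b) u = a \<odot>\<^bsub>sec H (sat b)\<^esub> f (sat b) v"
            unfolding uv using psh_homD(4)[OF f sb(1) a] v(1) by (simp only: direct_image_psh_simps sb(1))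
          show "res H U b (a \<odot>\<^bsub>sec H U\<^esub> g U s) = res H (sat b) b (f (sat b) u)"
            unfolding fsm linear_mapD(3)[OF presheafD(2)[OF PH U sb(3) b'(2)] a Qc[OF gs]]
              linear_mapD(3)[OF presheafD(2)[OF PH sb(2,3,4)] a fc[OF sb(1) v(1)]] Qr[OF gs b v] ..
        qed }
    qed
    fix V s assume V: "V \<in> opens S" "V \<subseteq> U" and s: "s \<in> \<Gamma> G U"
    note gs = g[OF U s]
    show "g V (res G U V s) = res H U V (g U s)"
    proof (rule geq[OF V(1) presheaf_res_closed[OF PG U V s]], unfold Q_def, intro conjI ballI impI)
      show "res H U V (g U s) \<in> \<Gamma> H V" by (rule presheaf_res_closed[OF PH U V Qc[OF gs]])
      fix b u assume b: "b \<in> basic_in V" and u: "u \<in> \<Gamma> G (sat b)"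
        "res G (sat b) b u = res G V b (res G U V s)"
      have b': "b \<in> basic_in U" using b basic_in_mono[OF V(2)] by blast
      note sb = so[OF bU(1)[OF b]]
      have "res G (sat b) b u = res G U b s"
        unfolding u(2) by (rule presheafD(4)[OF PG U V(1) sb(3) bU(2)[OF b] V(2) s])
      from Qr[OF gs b' u(1) this]
      show "res H V b (res H U V (g U s)) = res H (sat b) b (f (sat b) u)"
        unfolding presheafD(4)[OF PH U V(1) sb(3) bU(2)[OF b] V(2) Qc[OF gs]] .
    qed
  qed
  have grestr: "hom_restrict S' g = f"
  proof (rule psh_hom_eqI[OF hom_restrict_in_hom[OF opens_sub ghom] f])
    fix W s assume W: "W \<in> opens S'" and "s \<in> \<Gamma> (direct_image_psh S' G) W"
    then have s: "s \<in> \<Gamma> G W" by (simp only: direct_image_psh_simps)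
    have WS: "W \<in> opens S" using W opens_sub by blast
    have "g W s = f W s"
    proof (rule geq[OF WS s], unfold Q_def, intro conjI ballI impI)
      show "f W s \<in> \<Gamma> H W" by (rule fc[OF W s])
      fix b u assume b: "b \<in> basic_in W" and u: "u \<in> \<Gamma> G (sat b)" "res G (sat b) b u = res G W b s"
      note b' = bU[OF b] and sb = so[OF bU(1)[OF b]]
      note sW = sat_subset_conic[OF b'(2) W]
      have "res G (sat b) b u = res G (sat b) b (res G W (sat b) s)"
        unfolding u(2) by (rule presheafD(4)[OF PG WS sb(2,3,4) sW s, symmetric])
      then have u': "u = res G W (sat b) s"
        by (rule injG[OF b'(1) u(1) presheaf_res_closed[OF PG WS sb(2) sW s]])
      show "res H W b (f W s) = res H (sat b) b (f (sat b) u)"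
        unfolding u' fnat[OF W sb(1) sW s]
        by (rule presheafD(4)[OF PH WS sb(2,3,4) sW fc[OF W s], symmetric])
    qed
    then show "hom_restrict S' g W s = f W s" by (simp only: hom_restrict_apply[OF W])
  qed
  show ?thesis
  proof (rule ex1I[of _ g])
    show "g \<in> psh_hom K S G H \<and> hom_restrict S' g = f" using ghom grestr ..
    fix h assume h: "h \<in> psh_hom K S G H \<and> hom_restrict S' h = f"
    then have hh: "h \<in> psh_hom K S G H" and hf: "\<And>W. W \<in> opens S' \<Longrightarrow> f W = h W"
      using hom_restrict_apply[of _ S' h] by auto
    show "h = g"
    proof (rule psh_hom_eqI[OF hh ghom], rule sym)
      fix U s assume U: "U \<in> opens S" and s: "s \<in> \<Gamma> G U"
      show "g U s = h U s"
      proof (rule geq[OF U s], unfold Q_def, intro conjI ballI impI)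
        show "h U s \<in> \<Gamma> H U" by (rule psh_homD(1)[OF hh U s])
        fix b u assume b: "b \<in> basic_in U" and u: "u \<in> \<Gamma> G (sat b)" "res G (sat b) b u = res G U b s"
        note b' = bU[OF b] and sb = so[OF bU(1)[OF b]]
        show "res H U b (h U s) = res H (sat b) b (f (sat b) u)"
          unfolding hf[OF sb(1)] psh_homD(5)[OF hh U sb(3) b'(2) s, symmetric]
            psh_homD(5)[OF hh sb(2,3,4) u(1), symmetric] u(2) ..
      qed
    qed
  qed
qed

end

section \<open>The inverse image of a sheaf on the conic site\<close>

lemma hom_inverse:
  assumes F: "is_presheaf K S F" and G: "is_presheaf K S G" and i: "i \<in> psh_hom K S F G"
    and bij: "\<And>U. U \<in> opens S \<Longrightarrow> bij_betw (i U) (\<Gamma> F U) (\<Gamma> G U)"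
  obtains h where "h \<in> psh_hom K S G F"
    "\<And>U s. U \<in> opens S \<Longrightarrow> s \<in> \<Gamma> F U \<Longrightarrow> h U (i U s) = s"
    "\<And>U t. U \<in> opens S \<Longrightarrow> t \<in> \<Gamma> G U \<Longrightarrow> i U (h U t) = t"
proof -
  define h where "h = (\<lambda>U\<in>opens S. \<lambda>t\<in>\<Gamma> G U. inv_into (\<Gamma> F U) (i U) t)"
  have hi: "h U (i U s) = s" if U: "U \<in> opens S" and s: "s \<in> \<Gamma> F U" for U s
    using bij[OF U] psh_homD(1)[OF i U s] U s by (simp add: h_def bij_betw_def)
  have ih: "i U (h U t) = t" and hc: "h U t \<in> \<Gamma> F U"
    if U: "U \<in> opens S" and t: "t \<in> \<Gamma> G U" for U t
  proof -
    have im: "t \<in> i U ` \<Gamma> F U" using bij[OF U] t by (simp add: bij_betw_def)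
    have "h U t = inv_into (\<Gamma> F U) (i U) t" using U t by (simp add: h_def)
    then show "i U (h U t) = t" "h U t \<in> \<Gamma> F U"
      using f_inv_into_f[OF im] inv_into_into[OF im] by simp_all
  qed
  have "h \<in> psh_hom K S G F"
  proof (rule psh_homI)
    show "h \<in> extensional (opens S)" by (simp add: h_def)
    fix U assume U: "U \<in> opens S"
    show "h U \<in> extensional (\<Gamma> G U)" using U by (simp add: h_def)
    show "linear_map K (sec G U) (sec F U) (h U)"
      unfolding linear_map_def
    proof (intro conjI ballI funcsetI hc[OF U])
      fix s t assume s: "s \<in> \<Gamma> G U" and t: "t \<in> \<Gamma> G U"
      have "h U (s \<oplus>\<^bsub>sec G U\<^esub> t) = h U (i U (h U s \<oplus>\<^bsub>sec F U\<^esub> h U t))"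
        unfolding psh_homD(3)[OF i U hc[OF U s] hc[OF U t]] ih[OF U s] ih[OF U t] ..
      then show "h U (s \<oplus>\<^bsub>sec G U\<^esub> t) = h U s \<oplus>\<^bsub>sec F U\<^esub> h U t"
        using hi[OF U presheaf_add_closed[OF F U hc[OF U s] hc[OF U t]]] by simp
    next
      fix a s assume a: "a \<in> carrier K" and s: "s \<in> \<Gamma> G U"
      have "h U (a \<odot>\<^bsub>sec G U\<^esub> s) = h U (i U (a \<odot>\<^bsub>sec F U\<^esub> h U s))"
        unfolding psh_homD(4)[OF i U a hc[OF U s]] ih[OF U s] ..
      then show "h U (a \<odot>\<^bsub>sec G U\<^esub> s) = a \<odot>\<^bsub>sec F U\<^esub> h U s"
        using hi[OF U presheaf_smult_closed[OF F U a hc[OF U s]]] by simp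
    qed
    fix V s assume V: "V \<in> opens S" "V \<subseteq> U" and s: "s \<in> \<Gamma> G U"
    have "h V (res G U V s) = h V (i V (res F U V (h U s)))"
      unfolding psh_homD(5)[OF i U V hc[OF U s]] ih[OF U s] ..
    then show "h V (res G U V s) = res F U V (h U s)"
      using hi[OF V(1) presheaf_res_closed[OF F U V hc[OF U s]]] by simp
  qed
  then show thesis using that hi ih by blast
qed

lemma hom_inverse_bij:
  assumes f: "f \<in> psh_hom K S F G" and g: "g \<in> psh_hom K S G F" and U: "U \<in> opens S"
    and gf: "\<And>s. s \<in> \<Gamma> F U \<Longrightarrow> g U (f U s) = s"
    and fg: "\<And>t. t \<in> \<Gamma> G U \<Longrightarrow> f U (g U t) = t"
  shows "bij_betw (f U) (\<Gamma> F U) (\<Gamma> G U)"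
  using psh_homD(1)[OF f U] psh_homD(1)[OF g U] gf fg by (intro bij_betwI[where g = "g U"]) auto

locale conic_setting_universe = conic_setting X \<mu> E
  for X :: "'a mfd" and \<mu> E +
  fixes K :: "('k, 'z) ring_scheme" and j :: "(nat \<Rightarrow> 'm) \<Rightarrow> 'm"
  assumes K: "cring K" and j: "inj j"
begin

definition inv_sheaf :: "('a, 'k, 'm) psh \<Rightarrow> ('a, 'k, 'm) psh" where
  "inv_sheaf F = inverse_image_sheaf K S S' F"

text \<open>The unit of the adjunction, from \<open>F\<close> to the direct image of its inverse
image.\<close>

definition adj_unit :: "('a, 'k, 'm) psh \<Rightarrow> 'a set \<Rightarrow> 'm \<Rightarrow> 'm" where
  "adj_unit F = hom_flat S' F (inverse_image_unit K S S' F)"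

lemma direct_carrier: "U \<in> opens S' \<Longrightarrow> \<Gamma> (direct_image_psh S' F) U = \<Gamma> F U"
  by (simp only: direct_image_psh_simps)

lemma hom_extension:
  fixes G H :: "('a, 'k, 'm) psh"
  assumes G: "is_sheaf K S G" and conic: "conic_sheaf X \<mu> G" and H: "is_sheaf K S H"
    and f: "f \<in> psh_hom K S' (direct_image_psh S' G) (direct_image_psh S' H)"
  obtains g where "g \<in> psh_hom K S G H" "\<And>U s. U \<in> opens S' \<Longrightarrow> s \<in> \<Gamma> G U \<Longrightarrow> g U s = f U s"
proof -
  obtain g where g: "g \<in> psh_hom K S G H" "hom_restrict S' g = f"
    using hom_extends_from_conic[OF G conic H f] by blast
  then show thesis using that[OF g(1)] hom_restrict_apply[of _ S' g] by simp
qed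

lemma hom_eq_on_conic:
  fixes G H :: "('a, 'k, 'm) psh"
  assumes G: "is_sheaf K S G" and conic: "conic_sheaf X \<mu> G" and H: "is_sheaf K S H"
    and f: "f \<in> psh_hom K S G H" and g: "g \<in> psh_hom K S G H"
    and eq: "\<And>U s. U \<in> opens S' \<Longrightarrow> s \<in> \<Gamma> G U \<Longrightarrow> f U s = g U s"
  shows "f = g"
proof -
  note rf = hom_restrict_in_hom[OF opens_sub f] and rg = hom_restrict_in_hom[OF opens_sub g]
  have "hom_restrict S' f = hom_restrict S' g"
    by (rule psh_hom_eqI[OF rf rg]) (simp add: hom_restrict_apply direct_carrier eq)
  then show ?thesis using hom_extends_from_conic[OF G conic H rf] f g by metis
qed

text \<open>By adjunction, morphisms from the inverse image presheaf to \<open>H\<close> are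
morphisms from \<open>F\<close>, hence through \<open>\<theta>\<close> from the direct image of
\<open>G\<close>, to the direct image of \<open>H\<close>; those extend uniquely to
\<open>G\<close>.\<close>

lemma is_assoc_sheaf_conic_extension:
  fixes F G :: "('a, 'k, 'm) psh"
  assumes F: "is_sheaf K S' F" and G: "is_sheaf K S G" and conic: "conic_sheaf X \<mu> G"
    and \<theta>: "\<theta> \<in> psh_hom K S' F (direct_image_psh S' G)"
    and bij: "\<And>W. W \<in> opens S' \<Longrightarrow> bij_betw (\<theta> W) (\<Gamma> F W) (\<Gamma> G W)"
  shows "is_assoc_sheaf K S (pullback_psh S' F) G (hom_sharp S S' F G \<theta>)"
proof -
  note PF = sheaf_presheaf[OF F] and PG = sheaf_presheaf[OF G]
  interpret F: presheaf_on_target S S' K F by unfold_locales (rule PF)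
  have PdG: "is_presheaf K S' (direct_image_psh S' G)"
    by (rule is_presheaf_direct_image[OF opens_sub PG])
  have bij': "bij_betw (\<theta> W) (\<Gamma> F W) (\<Gamma> (direct_image_psh S' G) W)" if "W \<in> opens S'" for W
    using bij[OF that] direct_carrier[OF that, of G] by simp
  obtain \<zeta> where \<zeta>: "\<zeta> \<in> psh_hom K S' (direct_image_psh S' G) F"
      "\<And>U s. U \<in> opens S' \<Longrightarrow> s \<in> \<Gamma> F U \<Longrightarrow> \<zeta> U (\<theta> U s) = s"
      "\<And>U t. U \<in> opens S' \<Longrightarrow> t \<in> \<Gamma> (direct_image_psh S' G) U \<Longrightarrow> \<theta> U (\<zeta> U t) = t"
    using hom_inverse[OF PF PdG \<theta> bij'] by metis
  let ?\<iota> = "hom_sharp S S' F G \<theta>" and ?P = "pullback_psh S' F"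
  have \<iota>: "?\<iota> \<in> psh_hom K S ?P G" by (rule F.hom_sharp_in_hom[OF PG \<theta>])
  have flat: "hom_flat S' F ?\<iota> = \<theta>" by (rule F.hom_flat_sharp[OF PG \<theta>])
  have PP: "psh_comp S ?P g ?\<iota> \<in> psh_hom K S ?P H" if g: "g \<in> psh_hom K S G H" and H: "is_presheaf K S H"
    for g and H :: "('a, 'k, 'm) psh"
    by (rule F.psh_comp_pullback_in_hom[OF H \<iota> g])
  show ?thesis
    unfolding is_assoc_sheaf_def
  proof (intro conjI allI impI ballI G \<iota>)
    fix H :: "('a, 'k, 'm) psh" and f assume H: "is_sheaf K S H" and f: "f \<in> psh_hom K S ?P H"
    note PH = sheaf_presheaf[OF H]
    note ff = F.hom_flat_in_hom[OF f]
    obtain g where g: "g \<in> psh_hom K S G H"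
      "\<And>U s. U \<in> opens S' \<Longrightarrow> s \<in> \<Gamma> G U \<Longrightarrow> g U s = psh_comp S' (direct_image_psh S' G) (hom_flat S' F f) \<zeta> U s"
      using hom_extension[OF G conic H psh_comp_in_hom[OF PdG \<zeta>(1) ff]] by metis
    have iff: "psh_comp S ?P h ?\<iota> = f \<longleftrightarrow> (\<forall>U\<in>opens S'. \<forall>s\<in>\<Gamma> G U. h U s = g U s)"
      if h: "h \<in> psh_hom K S G H" for h
    proof -
      note ch = psh_comp_in_hom[OF PF \<theta> hom_restrict_in_hom[OF opens_sub h]]
      have "psh_comp S ?P h ?\<iota> = f \<longleftrightarrow> psh_comp S' F (hom_restrict S' h) \<theta> = hom_flat S' F f"
        using F.hom_flat_comp[OF \<iota>, of h] F.hom_flat_inj[OF PP[OF h PH] f] flat by auto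
      also have "\<dots> \<longleftrightarrow> (\<forall>U\<in>opens S'. \<forall>s\<in>\<Gamma> F U. h U (\<theta> U s) = hom_flat S' F f U s)"
      proof
        assume eq: "psh_comp S' F (hom_restrict S' h) \<theta> = hom_flat S' F f"
        show "\<forall>U\<in>opens S'. \<forall>s\<in>\<Gamma> F U. h U (\<theta> U s) = hom_flat S' F f U s"
          unfolding eq[symmetric] by (simp add: psh_comp_apply hom_restrict_apply)
      next
        assume "\<forall>U\<in>opens S'. \<forall>s\<in>\<Gamma> F U. h U (\<theta> U s) = hom_flat S' F f U s"
        then show "psh_comp S' F (hom_restrict S' h) \<theta> = hom_flat S' F f"
          by (intro psh_hom_eqI[OF ch ff]) (simp add: psh_comp_apply hom_restrict_apply)
      qed
      also have "\<dots> \<longleftrightarrow> (\<forall>U\<in>opens S'. \<forall>s\<in>\<Gamma> G U. h U s = g U s)"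
      proof (intro iffI ballI)
        fix U s assume eq: "\<forall>U\<in>opens S'. \<forall>s\<in>\<Gamma> F U. h U (\<theta> U s) = hom_flat S' F f U s"
          and U: "U \<in> opens S'" and s: "s \<in> \<Gamma> G U"
        have s': "s \<in> \<Gamma> (direct_image_psh S' G) U" using s by (simp only: direct_carrier[OF U])
        have "h U (\<theta> U (\<zeta> U s)) = hom_flat S' F f U (\<zeta> U s)" using eq U psh_homD(1)[OF \<zeta>(1) U s'] by blast
        then show "h U s = g U s" by (simp only: \<zeta>(3)[OF U s'] g(2)[OF U s] psh_comp_apply[OF U s'])
      next
        fix U s assume eq: "\<forall>U\<in>opens S'. \<forall>s\<in>\<Gamma> G U. h U s = g U s"
          and U: "U \<in> opens S'" and s: "s \<in> \<Gamma> F U"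
        have ts': "\<theta> U s \<in> \<Gamma> (direct_image_psh S' G) U" by (rule psh_homD(1)[OF \<theta> U s])
        then have ts: "\<theta> U s \<in> \<Gamma> G U" by (simp only: direct_carrier[OF U])
        have "h U (\<theta> U s) = g U (\<theta> U s)" using eq U ts by blast
        then show "h U (\<theta> U s) = hom_flat S' F f U s"
          by (simp only: g(2)[OF U ts] psh_comp_apply[OF U ts'] \<zeta>(2)[OF U s])
      qed
      finally show ?thesis .
    qed
    show "\<exists>!g. g \<in> psh_hom K S G H \<and> psh_comp S ?P g ?\<iota> = f"
    proof (rule ex1I[of _ g])
      show "g \<in> psh_hom K S G H \<and> psh_comp S ?P g ?\<iota> = f" using g(1) iff by blast
      fix h assume h: "h \<in> psh_hom K S G H \<and> psh_comp S ?P h ?\<iota> = f"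
      then show "h = g" using iff by (intro hom_eq_on_conic[OF G conic H _ g(1)]) blast+
    qed
  qed
qed

context
  fixes F :: "('a, 'k, 'm) psh"
  assumes F: "is_sheaf K S' F"
begin

lemma is_assoc_sheaf_inverse_image:
  "is_assoc_sheaf K S (pullback_psh S' F) (inv_sheaf F) (inverse_image_unit K S S' F)"
proof -
  obtain G :: "('a, 'k, 'm) psh" and \<theta> where "is_sheaf K S G" "conic_sheaf X \<mu> G"
    "\<theta> \<in> psh_hom K S' F (direct_image_psh S' G)"
    "\<And>W. W \<in> opens S' \<Longrightarrow> bij_betw (\<theta> W) (\<Gamma> F W) (\<Gamma> G W)"
    using conic_extension_exists[OF K F j] by metis
  from is_assoc_sheaf_conic_extension[OF F this]
  have "\<exists>p. case p of (G :: ('a, 'k, 'm) psh, \<iota>) \<Rightarrow> is_assoc_sheaf K S (pullback_psh S' F) G \<iota>" by auto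
  from someI_ex[OF this]
  show ?thesis
    unfolding inv_sheaf_def inverse_image_sheaf_def inverse_image_unit_def assoc_sheaf_def by (simp add: case_prod_unfold)
qed

lemma is_sheaf_inv_sheaf: "is_sheaf K S (inv_sheaf F)"
  and unit_in_hom: "inverse_image_unit K S S' F \<in> psh_hom K S (pullback_psh S' F) (inv_sheaf F)"
  using is_assoc_sheaf_inverse_image by (simp_all add: is_assoc_sheaf_def)

interpretation F: presheaf_on_target S S' K F by unfold_locales (rule sheaf_presheaf[OF F])

lemma adj_unit_in_hom: "adj_unit F \<in> psh_hom K S' F (direct_image_psh S' (inv_sheaf F))"
  unfolding adj_unit_def by (rule F.hom_flat_in_hom[OF unit_in_hom])

lemma adj_unit_closed: "U \<in> opens S' \<Longrightarrow> s \<in> \<Gamma> F U \<Longrightarrow> adj_unit F U s \<in> \<Gamma> (inv_sheaf F) U"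
  using psh_homD(1)[OF adj_unit_in_hom, of U s] direct_carrier[of U "inv_sheaf F"] by simp

lemma assoc_ex1:
  fixes H :: "('a, 'k, 'm) psh"
  assumes H: "is_sheaf K S H" and f: "f \<in> psh_hom K S (pullback_psh S' F) H"
  shows "\<exists>!g. g \<in> psh_hom K S (inv_sheaf F) H \<and> psh_comp S (pullback_psh S' F) g (inverse_image_unit K S S' F) = f"
  using is_assoc_sheaf_inverse_image[unfolded is_assoc_sheaf_def, THEN conjunct2, THEN conjunct2, rule_format, OF H f] .

lemma adj_unit_extend:
  fixes H :: "('a, 'k, 'm) psh"
  assumes H: "is_sheaf K S H" and f: "f \<in> psh_hom K S' F (direct_image_psh S' H)"
  obtains g where "g \<in> psh_hom K S (inv_sheaf F) H"
    "\<And>U s. U \<in> opens S' \<Longrightarrow> s \<in> \<Gamma> F U \<Longrightarrow> g U (adj_unit F U s) = f U s"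
proof -
  note PH = sheaf_presheaf[OF H]
  let ?f = "hom_sharp S S' F H f"
  obtain g where g: "g \<in> psh_hom K S (inv_sheaf F) H"
    "psh_comp S (pullback_psh S' F) g (inverse_image_unit K S S' F) = ?f"
    using assoc_ex1[OF H F.hom_sharp_in_hom[OF PH f]] by blast
  have "psh_comp S' F (hom_restrict S' g) (adj_unit F) = f"
    unfolding adj_unit_def F.hom_flat_comp[OF unit_in_hom, symmetric] g(2) by (rule F.hom_flat_sharp[OF PH f])
  from this[symmetric] have "g U (adj_unit F U s) = f U s" if "U \<in> opens S'" "s \<in> \<Gamma> F U" for U s
    using that by (simp add: psh_comp_apply hom_restrict_apply)
  then show thesis by (rule that[OF g(1)])
qed

lemma adj_unit_hom_eqI:
  fixes H :: "('a, 'k, 'm) psh"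
  assumes H: "is_sheaf K S H" and f: "f \<in> psh_hom K S (inv_sheaf F) H" and g: "g \<in> psh_hom K S (inv_sheaf F) H"
    and eq: "\<And>U s. U \<in> opens S' \<Longrightarrow> s \<in> \<Gamma> F U \<Longrightarrow> f U (adj_unit F U s) = g U (adj_unit F U s)"
  shows "f = g"
proof -
  let ?P = "pullback_psh S' F" and ?u = "inverse_image_unit K S S' F"
  note PH = sheaf_presheaf[OF H]
  have ch: "psh_comp S ?P h ?u \<in> psh_hom K S ?P H" if "h \<in> psh_hom K S (inv_sheaf F) H" for h
    by (rule F.psh_comp_pullback_in_hom[OF PH unit_in_hom that])
  have ch': "psh_comp S' F (hom_restrict S' h) (adj_unit F) \<in> psh_hom K S' F (direct_image_psh S' H)"
    if "h \<in> psh_hom K S (inv_sheaf F) H" for h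
    by (rule psh_comp_in_hom[OF F.F adj_unit_in_hom hom_restrict_in_hom[OF opens_sub that]])
  have "psh_comp S' F (hom_restrict S' f) (adj_unit F) = psh_comp S' F (hom_restrict S' g) (adj_unit F)"
    by (rule psh_hom_eqI[OF ch'[OF f] ch'[OF g]]) (simp add: psh_comp_apply hom_restrict_apply eq)
  then have "hom_flat S' F (psh_comp S ?P f ?u) = hom_flat S' F (psh_comp S ?P g ?u)"
    unfolding F.hom_flat_comp[OF unit_in_hom] adj_unit_def .
  then have "psh_comp S ?P f ?u = psh_comp S ?P g ?u" by (rule F.hom_flat_inj[OF ch[OF f] ch[OF g]])
  then show ?thesis using assoc_ex1[OF H ch[OF g]] f g by metis
qed

text \<open>The chosen associated sheaf is isomorphic to any conic extension \<open>G\<close>: the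
universal property provides a morphism to \<open>G\<close>, the extension of morphisms one from
\<open>G\<close>, and both composites are identities because they are so on the sections coming
from \<open>F\<close>.\<close>

lemma inv_sheaf_conic: "conic_sheaf X \<mu> (inv_sheaf F)"
  and adj_unit_bij: "\<And>W. W \<in> opens S' \<Longrightarrow> bij_betw (adj_unit F W) (\<Gamma> F W) (\<Gamma> (inv_sheaf F) W)"
proof -
  obtain G :: "('a, 'k, 'm) psh" and \<theta> where G: "is_sheaf K S G" "conic_sheaf X \<mu> G"
    and \<theta>: "\<theta> \<in> psh_hom K S' F (direct_image_psh S' G)"
    and bij: "\<And>W. W \<in> opens S' \<Longrightarrow> bij_betw (\<theta> W) (\<Gamma> F W) (\<Gamma> G W)"
    using conic_extension_exists[OF K F j] by metis
  note PG = sheaf_presheaf[OF G(1)] and PI = sheaf_presheaf[OF is_sheaf_inv_sheaf]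
  have PdG: "is_presheaf K S' (direct_image_psh S' G)"
    by (rule is_presheaf_direct_image[OF opens_sub PG])
  have bij': "bij_betw (\<theta> W) (\<Gamma> F W) (\<Gamma> (direct_image_psh S' G) W)" if "W \<in> opens S'" for W
    using bij[OF that] direct_carrier[OF that, of G] by simp
  obtain \<zeta> where \<zeta>: "\<zeta> \<in> psh_hom K S' (direct_image_psh S' G) F"
      "\<And>U s. U \<in> opens S' \<Longrightarrow> s \<in> \<Gamma> F U \<Longrightarrow> \<zeta> U (\<theta> U s) = s"
      "\<And>U t. U \<in> opens S' \<Longrightarrow> t \<in> \<Gamma> (direct_image_psh S' G) U \<Longrightarrow> \<theta> U (\<zeta> U t) = t"
    using hom_inverse[OF F.F PdG \<theta> bij'] by metis
  obtain g where g: "g \<in> psh_hom K S (inv_sheaf F) G"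
    "\<And>U s. U \<in> opens S' \<Longrightarrow> s \<in> \<Gamma> F U \<Longrightarrow> g U (adj_unit F U s) = \<theta> U s"
    using adj_unit_extend[OF G(1) \<theta>] by metis
  note c = psh_comp_in_hom[OF PdG \<zeta>(1) adj_unit_in_hom]
  obtain h where h: "h \<in> psh_hom K S G (inv_sheaf F)"
    "\<And>U s. U \<in> opens S' \<Longrightarrow> s \<in> \<Gamma> G U \<Longrightarrow> h U s = psh_comp S' (direct_image_psh S' G) (adj_unit F) \<zeta> U s"
    using hom_extension[OF G is_sheaf_inv_sheaf c] by metis
  have hG: "h U s = adj_unit F U (\<zeta> U s)" if U: "U \<in> opens S'" and s: "s \<in> \<Gamma> G U" for U s
    using h(2)[OF U s] s psh_comp_apply[OF U, of s "direct_image_psh S' G"] direct_carrier[OF U, of G] by simp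
  have \<zeta>c: "\<zeta> U s \<in> \<Gamma> F U" "\<theta> U (\<zeta> U s) = s" if U: "U \<in> opens S'" and s: "s \<in> \<Gamma> G U" for U s
    using psh_homD(1)[OF \<zeta>(1) U, of s] \<zeta>(3)[OF U, of s] s direct_carrier[OF U, of G] by simp_all
  have \<theta>c: "\<theta> U s \<in> \<Gamma> G U" if U: "U \<in> opens S'" and s: "s \<in> \<Gamma> F U" for U s
    using psh_homD(1)[OF \<theta> U s] direct_carrier[OF U, of G] by simp
  have gh: "psh_comp S G g h = psh_id S G"
  proof (rule hom_eq_on_conic[OF G G(1) psh_comp_in_hom[OF PG h(1) g(1)] psh_id_in_hom[OF PG]])
    fix U s assume U: "U \<in> opens S'" and s: "s \<in> \<Gamma> G U"
    have US: "U \<in> opens S" using U opens_sub by blast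
    show "psh_comp S G g h U s = psh_id S G U s"
      unfolding psh_comp_apply[OF US s] psh_id_apply[OF US s] hG[OF U s] g(2)[OF U \<zeta>c(1)[OF U s]] by (rule \<zeta>c(2)[OF U s])
  qed
  have hg: "psh_comp S (inv_sheaf F) h g = psh_id S (inv_sheaf F)"
  proof (rule adj_unit_hom_eqI[OF is_sheaf_inv_sheaf psh_comp_in_hom[OF PI g(1) h(1)] psh_id_in_hom[OF PI]])
    fix U s assume U: "U \<in> opens S'" and s: "s \<in> \<Gamma> F U"
    have US: "U \<in> opens S" using U opens_sub by blast
    note a = adj_unit_closed[OF U s]
    show "psh_comp S (inv_sheaf F) h g U (adj_unit F U s) = psh_id S (inv_sheaf F) U (adj_unit F U s)"
      unfolding psh_comp_apply[OF US a] psh_id_apply[OF US a] g(2)[OF U s] hG[OF U \<theta>c[OF U s]] \<zeta>(2)[OF U s] ..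
  qed
  have hbij: "bij_betw (h U) (\<Gamma> G U) (\<Gamma> (inv_sheaf F) U)" if U: "U \<in> opens S" for U
  proof (rule hom_inverse_bij[OF h(1) g(1) U])
    show "g U (h U s) = s" if "s \<in> \<Gamma> G U" for s
      using fun_cong[OF fun_cong[OF gh], of U s] U that by (simp only: psh_comp_apply psh_id_apply)
    show "h U (g U t) = t" if "t \<in> \<Gamma> (inv_sheaf F) U" for t
      using fun_cong[OF fun_cong[OF hg], of U t] U that by (simp only: psh_comp_apply psh_id_apply)
  qed
  show "conic_sheaf X \<mu> (inv_sheaf F)" by (rule conic_sheaf_if_iso[OF G(2) h(1) hbij])
  fix W assume W: "W \<in> opens S'"
  then have WS: "W \<in> opens S" using opens_sub by blast
  have "bij_betw (h W \<circ> \<theta> W) (\<Gamma> F W) (\<Gamma> (inv_sheaf F) W)"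
    by (rule bij_betw_trans[OF bij[OF W] hbij[OF WS]])
  then show "bij_betw (adj_unit F W) (\<Gamma> F W) (\<Gamma> (inv_sheaf F) W)"
    by (rule iffD1[OF bij_betw_cong, rotated]) (simp add: hG[OF W \<theta>c[OF W]] \<zeta>(2)[OF W])
qed

end

lemma inverse_image_FArr:
  fixes F G :: "('a, 'k, 'm) psh"
  assumes F: "is_sheaf K S' F" and G: "is_sheaf K S' G" and f: "f \<in> psh_hom K S' F G"
  shows "FArr (inverse_image K S S') F G f \<in> psh_hom K S (inv_sheaf F) (inv_sheaf G)"
    and "\<And>U s. U \<in> opens S' \<Longrightarrow> s \<in> \<Gamma> F U \<Longrightarrow>
      FArr (inverse_image K S S') F G f U (adj_unit F U s) = adj_unit G U (f U s)"
proof -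
  note PF = sheaf_presheaf[OF F] and PG = sheaf_presheaf[OF G]
  interpret F: presheaf_on_target S S' K F by unfold_locales (rule PF)
  note IF = is_sheaf_inv_sheaf[OF F] and IG = is_sheaf_inv_sheaf[OF G]
  let ?r = "psh_comp S (pullback_psh S' F) (inverse_image_unit K S S' G) (pullback_arr S S' F G f)"
  note r = F.hom_comp_pullback_arr[OF PG f sheaf_presheaf[OF IG] unit_in_hom[OF G]]
  note ex = assoc_ex1[OF F IG r(1)]
  have eq: "FArr (inverse_image K S S') F G f = (THE g. g \<in> psh_hom K S (inv_sheaf F) (inv_sheaf G) \<and>
      psh_comp S (pullback_psh S' F) g (inverse_image_unit K S S' F) = ?r)"
    by (simp add: inverse_image_def inv_sheaf_def)
  note g = theI'[OF ex, folded eq]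
  show gh: "FArr (inverse_image K S S') F G f \<in> psh_hom K S (inv_sheaf F) (inv_sheaf G)" using g ..
  fix U s assume U: "U \<in> opens S'" and s: "s \<in> \<Gamma> F U"
  have "psh_comp S' F (hom_restrict S' (FArr (inverse_image K S S') F G f)) (adj_unit F) = psh_comp S' F (adj_unit G) f"
    unfolding adj_unit_def F.hom_flat_comp[OF unit_in_hom[OF F], symmetric] conjunct2[OF g] r(2) ..
  from fun_cong[OF fun_cong[OF this], of U s]
  show "FArr (inverse_image K S S') F G f U (adj_unit F U s) = adj_unit G U (f U s)"
    by (simp only: psh_comp_apply[OF U s] hom_restrict_apply[OF U])
qed

end

section \<open>The equivalence\<close>

lemma conic_sheaf_cat_simps:
  "F \<in> Obj (conic_sheaf_cat K X \<mu>) \<longleftrightarrow> is_sheaf K (site_sa X) F \<and> conic_sheaf X \<mu> F"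
  "Arr (conic_sheaf_cat K X \<mu>) = psh_hom K (site_sa X)"
  "Idt (conic_sheaf_cat K X \<mu>) = psh_id (site_sa X)"
  "Cmp (conic_sheaf_cat K X \<mu>) F G H g f = psh_comp (site_sa X) F g f"
  by (simp_all add: conic_sheaf_cat_def full_subcat_def sheaf_cat_def)

lemma direct_image_simps:
  "FObj (direct_image S') F = direct_image_psh S' F"
  "FArr (direct_image S') F G f = hom_restrict S' f"
  by (simp_all add: direct_image_def hom_restrict_def)

context conic_setting_universe
begin

abbreviation "ConicSh \<equiv> conic_sheaf_cat K X \<mu> :: (('a, 'k, 'm) psh, 'a set \<Rightarrow> 'm \<Rightarrow> 'm) cat"
abbreviation "ShConic \<equiv> sheaf_cat K S' :: (('a, 'k, 'm) psh, 'a set \<Rightarrow> 'm \<Rightarrow> 'm) cat"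
abbreviation "direct \<equiv> direct_image_psh S'"

lemma inverse_image_FObj: "FObj (inverse_image K S S') F = inv_sheaf F"
  by (simp add: inverse_image_def inv_sheaf_def)

lemma direct_sheaf: "is_sheaf K S F \<Longrightarrow> is_sheaf K S' (direct F)"
  by (rule is_sheaf_direct_image[OF opens_sub opens_Int]) (auto simp: conic_covers_iff covers_iff conic_opens_iff)

lemma direct_image_functor: "is_functor ConicSh ShConic (direct_image S')"
  unfolding is_functor_def
proof (intro conjI ballI)
  show "category ConicSh" unfolding conic_sheaf_cat_def by (rule category_full_subcat[OF category_sheaf_cat])
  show "category ShConic" by (rule category_sheaf_cat)
next
  fix A assume "A \<in> Obj ConicSh"
  then have A: "is_sheaf K S A" by (simp add: conic_sheaf_cat_simps)
  show "FObj (direct_image S') A \<in> Obj ShConic"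
    unfolding direct_image_simps sheaf_cat_simps by (rule direct_sheaf[OF A])
  show "FArr (direct_image S') A A (Idt ConicSh A) = Idt ShConic (FObj (direct_image S') A)"
    unfolding direct_image_simps sheaf_cat_simps conic_sheaf_cat_simps by (rule hom_restrict_id[OF opens_sub])
next
  fix A B f assume "f \<in> Arr ConicSh A B"
  then show "FArr (direct_image S') A B f \<in> Arr ShConic (FObj (direct_image S') A) (FObj (direct_image S') B)"
    unfolding direct_image_simps sheaf_cat_simps conic_sheaf_cat_simps by (rule hom_restrict_in_hom[OF opens_sub])
next
  fix A B D f g
  show "FArr (direct_image S') A D (Cmp ConicSh A B D g f) =
    Cmp ShConic (FObj (direct_image S') A) (FObj (direct_image S') B) (FObj (direct_image S') D)
      (FArr (direct_image S') B D g) (FArr (direct_image S') A B f)"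
    unfolding direct_image_simps sheaf_cat_simps conic_sheaf_cat_simps by (rule hom_restrict_comp[OF opens_sub])
qed

lemma inverse_image_functor: "is_functor ShConic ConicSh (inverse_image K S S')"
  unfolding is_functor_def
proof (intro conjI ballI)
  show "category ConicSh" unfolding conic_sheaf_cat_def by (rule category_full_subcat[OF category_sheaf_cat])
  show "category ShConic" by (rule category_sheaf_cat)
next
  fix F assume "F \<in> Obj ShConic"
  then have F: "is_sheaf K S' F" by (simp add: sheaf_cat_simps)
  note IF = is_sheaf_inv_sheaf[OF F] and PI = sheaf_presheaf[OF is_sheaf_inv_sheaf[OF F]]
  show "FObj (inverse_image K S S') F \<in> Obj ConicSh"
    unfolding inverse_image_FObj conic_sheaf_cat_simps using IF inv_sheaf_conic[OF F] ..
  note id = psh_id_in_hom[OF sheaf_presheaf[OF F]]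
  show "FArr (inverse_image K S S') F F (Idt ShConic F) = Idt ConicSh (FObj (inverse_image K S S') F)"
    unfolding inverse_image_FObj conic_sheaf_cat_simps sheaf_cat_simps
  proof (rule adj_unit_hom_eqI[OF F IF inverse_image_FArr(1)[OF F F id] psh_id_in_hom[OF PI]])
    fix U s assume U: "U \<in> opens S'" and s: "s \<in> \<Gamma> F U"
    have US: "U \<in> opens S" using U opens_sub by blast
    show "FArr (inverse_image K S S') F F (psh_id S' F) U (adj_unit F U s) = psh_id S (inv_sheaf F) U (adj_unit F U s)"
      unfolding inverse_image_FArr(2)[OF F F id U s] psh_id_apply[OF U s] psh_id_apply[OF US adj_unit_closed[OF F U s]] ..
  qed
next
  fix F G f assume "F \<in> Obj ShConic" "G \<in> Obj ShConic" "f \<in> Arr ShConic F G"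
  then have "is_sheaf K S' F" "is_sheaf K S' G" "f \<in> psh_hom K S' F G" by (simp_all add: sheaf_cat_simps)
  then show "FArr (inverse_image K S S') F G f \<in> Arr ConicSh (FObj (inverse_image K S S') F) (FObj (inverse_image K S S') G)"
    unfolding inverse_image_FObj conic_sheaf_cat_simps by (rule inverse_image_FArr(1))
next
  fix F G H f g assume "F \<in> Obj ShConic" "G \<in> Obj ShConic" "H \<in> Obj ShConic" "f \<in> Arr ShConic F G" "g \<in> Arr ShConic G H"
  then have F: "is_sheaf K S' F" and G: "is_sheaf K S' G" and H: "is_sheaf K S' H"
    and f: "f \<in> psh_hom K S' F G" and g: "g \<in> psh_hom K S' G H" by (simp_all add: sheaf_cat_simps)
  let ?I = "FArr (inverse_image K S S')"
  note gf = psh_comp_in_hom[OF sheaf_presheaf[OF F] f g]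
  note fI = inverse_image_FArr[OF F G f] and gI = inverse_image_FArr[OF G H g] and gfI = inverse_image_FArr[OF F H gf]
  show "?I F H (Cmp ShConic F G H g f) = Cmp ConicSh (FObj (inverse_image K S S') F) (FObj (inverse_image K S S') G)
      (FObj (inverse_image K S S') H) (?I G H g) (?I F G f)"
    unfolding inverse_image_FObj conic_sheaf_cat_simps sheaf_cat_simps
  proof (rule adj_unit_hom_eqI[OF F is_sheaf_inv_sheaf[OF H] gfI(1) psh_comp_in_hom[OF sheaf_presheaf[OF is_sheaf_inv_sheaf[OF F]] fI(1) gI(1)]])
    fix U s assume U: "U \<in> opens S'" and s: "s \<in> \<Gamma> F U"
    have US: "U \<in> opens S" using U opens_sub by blast
    show "?I F H (psh_comp S' F g f) U (adj_unit F U s) =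
      psh_comp S (inv_sheaf F) (?I G H g) (?I F G f) U (adj_unit F U s)"
      unfolding gfI(2)[OF U s] psh_comp_apply[OF U s] psh_comp_apply[OF US adj_unit_closed[OF F U s]]
        fI(2)[OF U s] gI(2)[OF U psh_homD(1)[OF f U s]] ..
  qed
qed

text \<open>The counit at \<open>A\<close> is the morphism that sends the image of a section
\<open>s\<close> under the unit back to \<open>s\<close>. Its inverse is the unit, extended from
the conic open sets to all of them; this is where \<open>A\<close> has to be conic.\<close>

lemma counit_iso: "naturally_isomorphic ConicSh ConicSh (comp_funct (inverse_image K S S') (direct_image S')) id_funct"
proof -
  have ex: "\<exists>\<epsilon>. is_iso ConicSh (inv_sheaf (direct A)) A \<epsilon> \<and>
      (\<forall>U\<in>opens S'. \<forall>s\<in>\<Gamma> A U. \<epsilon> U (adj_unit (direct A) U s) = s)"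
    if A: "is_sheaf K S A" and cA: "conic_sheaf X \<mu> A" for A
  proof -
    note dA = direct_sheaf[OF A]
    note PA = sheaf_presheaf[OF A] and PI = sheaf_presheaf[OF is_sheaf_inv_sheaf[OF dA]]
    obtain \<epsilon> where \<epsilon>: "\<epsilon> \<in> psh_hom K S (inv_sheaf (direct A)) A"
      "\<And>U s. U \<in> opens S' \<Longrightarrow> s \<in> \<Gamma> (direct A) U \<Longrightarrow> \<epsilon> U (adj_unit (direct A) U s) = psh_id S' (direct A) U s"
      using adj_unit_extend[OF dA A psh_id_in_hom[OF sheaf_presheaf[OF dA]]] by metis
    have \<epsilon>': "\<epsilon> U (adj_unit (direct A) U s) = s" if U: "U \<in> opens S'" and s: "s \<in> \<Gamma> A U" for U s
      using \<epsilon>(2)[OF U, of s] psh_id_apply[OF U, of s "direct A"] direct_carrier[OF U, of A] s by simp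
    obtain \<delta> where \<delta>: "\<delta> \<in> psh_hom K S A (inv_sheaf (direct A))"
      "\<And>U s. U \<in> opens S' \<Longrightarrow> s \<in> \<Gamma> A U \<Longrightarrow> \<delta> U s = adj_unit (direct A) U s"
      using hom_extension[OF A cA is_sheaf_inv_sheaf[OF dA] adj_unit_in_hom[OF dA]] by metis
    have 1: "psh_comp S A \<epsilon> \<delta> = psh_id S A"
    proof (rule hom_eq_on_conic[OF A cA A psh_comp_in_hom[OF PA \<delta>(1) \<epsilon>(1)] psh_id_in_hom[OF PA]])
      fix U s assume U: "U \<in> opens S'" and s: "s \<in> \<Gamma> A U"
      have US: "U \<in> opens S" using U opens_sub by blast
      show "psh_comp S A \<epsilon> \<delta> U s = psh_id S A U s"
        unfolding psh_comp_apply[OF US s] psh_id_apply[OF US s] \<delta>(2)[OF U s] by (rule \<epsilon>'[OF U s])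
    qed
    have 2: "psh_comp S (inv_sheaf (direct A)) \<delta> \<epsilon> = psh_id S (inv_sheaf (direct A))"
    proof (rule adj_unit_hom_eqI[OF dA is_sheaf_inv_sheaf[OF dA] psh_comp_in_hom[OF PI \<epsilon>(1) \<delta>(1)] psh_id_in_hom[OF PI]])
      fix U s assume U: "U \<in> opens S'" and s: "s \<in> \<Gamma> (direct A) U"
      have US: "U \<in> opens S" using U opens_sub by blast
      note a = adj_unit_closed[OF dA U s]
      have s': "s \<in> \<Gamma> A U" using s direct_carrier[OF U, of A] by simp
      show "psh_comp S (inv_sheaf (direct A)) \<delta> \<epsilon> U (adj_unit (direct A) U s) = psh_id S (inv_sheaf (direct A)) U (adj_unit (direct A) U s)"
        unfolding psh_comp_apply[OF US a] psh_id_apply[OF US a] \<epsilon>'[OF U s'] by (rule \<delta>(2)[OF U s'])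
    qed
    have "is_iso ConicSh (inv_sheaf (direct A)) A \<epsilon>"
      unfolding is_iso_def conic_sheaf_cat_simps using \<epsilon>(1) \<delta>(1) 1 2 by blast
    then show ?thesis using \<epsilon>' by blast
  qed
  define \<tau> where "\<tau> A = (SOME \<epsilon>. is_iso ConicSh (inv_sheaf (direct A)) A \<epsilon> \<and>
      (\<forall>U\<in>opens S'. \<forall>s\<in>\<Gamma> A U. \<epsilon> U (adj_unit (direct A) U s) = s))" for A
  have \<tau>: "is_iso ConicSh (inv_sheaf (direct A)) A (\<tau> A)"
    "\<And>U s. U \<in> opens S' \<Longrightarrow> s \<in> \<Gamma> A U \<Longrightarrow> \<tau> A U (adj_unit (direct A) U s) = s"
    if "is_sheaf K S A" "conic_sheaf X \<mu> A" for A
    using someI_ex[OF ex[OF that], folded \<tau>_def] by simp_all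
  show ?thesis
    unfolding naturally_isomorphic_def comp_funct_def id_funct_def funct.simps direct_image_simps inverse_image_FObj
      conic_sheaf_cat_simps
  proof (rule exI[of _ \<tau>], intro conjI ballI)
    fix A assume "A \<in> Obj ConicSh"
    then show "is_iso ConicSh (inv_sheaf (direct A)) A (\<tau> A)" by (intro \<tau>(1)) (simp_all add: conic_sheaf_cat_simps)
  next
    fix A B f assume "A \<in> Obj ConicSh" "B \<in> Obj ConicSh" and f: "f \<in> psh_hom K S A B"
    then have A: "is_sheaf K S A" "conic_sheaf X \<mu> A" and B: "is_sheaf K S B" "conic_sheaf X \<mu> B"
      by (simp_all add: conic_sheaf_cat_simps)
    note dA = direct_sheaf[OF A(1)] and dB = direct_sheaf[OF B(1)]
    note rf = hom_restrict_in_hom[OF opens_sub f]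
    note I = inverse_image_FArr[OF dA dB rf]
    have \<tau>A: "\<tau> A \<in> psh_hom K S (inv_sheaf (direct A)) A" and \<tau>B: "\<tau> B \<in> psh_hom K S (inv_sheaf (direct B)) B"
      using \<tau>(1)[OF A] \<tau>(1)[OF B] by (simp_all add: is_iso_def conic_sheaf_cat_simps)
    note PI = sheaf_presheaf[OF is_sheaf_inv_sheaf[OF dA]]
    show "psh_comp S (inv_sheaf (direct A)) (\<tau> B) (FArr (inverse_image K S S') (direct A) (direct B) (hom_restrict S' f)) =
        psh_comp S (inv_sheaf (direct A)) f (\<tau> A)"
    proof (rule adj_unit_hom_eqI[OF dA B(1) psh_comp_in_hom[OF PI I(1) \<tau>B] psh_comp_in_hom[OF PI \<tau>A f]])
      fix U s assume U: "U \<in> opens S'" and s: "s \<in> \<Gamma> (direct A) U"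
      have US: "U \<in> opens S" using U opens_sub by blast
      have s': "s \<in> \<Gamma> A U" using s direct_carrier[OF U, of A] by simp
      note a = adj_unit_closed[OF dA U s]
      show "psh_comp S (inv_sheaf (direct A)) (\<tau> B) (FArr (inverse_image K S S') (direct A) (direct B) (hom_restrict S' f)) U (adj_unit (direct A) U s) =
          psh_comp S (inv_sheaf (direct A)) f (\<tau> A) U (adj_unit (direct A) U s)"
        unfolding psh_comp_apply[OF US a] I(2)[OF U s] hom_restrict_apply[OF U] \<tau>(2)[OF A U s']
        by (rule \<tau>(2)[OF B U psh_homD(1)[OF f US s']])
    qed
  qed
qed

lemma unit_iso: "naturally_isomorphic ShConic ShConic (comp_funct (direct_image S') (inverse_image K S S')) id_funct"
proof -
  have ex: "\<exists>\<zeta>. is_iso ShConic (direct (inv_sheaf F)) F \<zeta> \<and>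
      (\<forall>U\<in>opens S'. \<forall>s\<in>\<Gamma> F U. \<zeta> U (adj_unit F U s) = s)"
    if F: "is_sheaf K S' F" for F
  proof -
    note PF = sheaf_presheaf[OF F] and PdI = sheaf_presheaf[OF direct_sheaf[OF is_sheaf_inv_sheaf[OF F]]]
    note u = adj_unit_in_hom[OF F]
    have bij: "bij_betw (adj_unit F W) (\<Gamma> F W) (\<Gamma> (direct (inv_sheaf F)) W)" if "W \<in> opens S'" for W
      using adj_unit_bij[OF F that] direct_carrier[OF that, of "inv_sheaf F"] by simp
    obtain \<zeta> where \<zeta>: "\<zeta> \<in> psh_hom K S' (direct (inv_sheaf F)) F"
      "\<And>U s. U \<in> opens S' \<Longrightarrow> s \<in> \<Gamma> F U \<Longrightarrow> \<zeta> U (adj_unit F U s) = s"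
      "\<And>U t. U \<in> opens S' \<Longrightarrow> t \<in> \<Gamma> (direct (inv_sheaf F)) U \<Longrightarrow> adj_unit F U (\<zeta> U t) = t"
      using hom_inverse[OF PF PdI u bij] by metis
    have 1: "psh_comp S' (direct (inv_sheaf F)) (adj_unit F) \<zeta> = psh_id S' (direct (inv_sheaf F))"
      by (rule psh_hom_eqI[OF psh_comp_in_hom[OF PdI \<zeta>(1) u] psh_id_in_hom[OF PdI]])
         (simp add: psh_comp_apply psh_id_apply \<zeta>(3))
    have 2: "psh_comp S' F \<zeta> (adj_unit F) = psh_id S' F"
      by (rule psh_hom_eqI[OF psh_comp_in_hom[OF PF u \<zeta>(1)] psh_id_in_hom[OF PF]])
         (simp add: psh_comp_apply psh_id_apply \<zeta>(2))
    have "is_iso ShConic (direct (inv_sheaf F)) F \<zeta>"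
      unfolding is_iso_def sheaf_cat_simps using \<zeta>(1) u 1 2 by blast
    then show ?thesis using \<zeta>(2) by blast
  qed
  define \<tau> where "\<tau> F = (SOME \<zeta>. is_iso ShConic (direct (inv_sheaf F)) F \<zeta> \<and>
      (\<forall>U\<in>opens S'. \<forall>s\<in>\<Gamma> F U. \<zeta> U (adj_unit F U s) = s))" for F
  have \<tau>: "is_iso ShConic (direct (inv_sheaf F)) F (\<tau> F)"
    "\<And>U s. U \<in> opens S' \<Longrightarrow> s \<in> \<Gamma> F U \<Longrightarrow> \<tau> F U (adj_unit F U s) = s"
    if "is_sheaf K S' F" for F
    using someI_ex[OF ex[OF that], folded \<tau>_def] by simp_all
  show ?thesis
    unfolding naturally_isomorphic_def comp_funct_def id_funct_def funct.simps direct_image_simps inverse_image_FObj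
      sheaf_cat_simps
  proof (rule exI[of _ \<tau>], intro conjI ballI)
    fix F assume "F \<in> Obj ShConic"
    then show "is_iso ShConic (direct (inv_sheaf F)) F (\<tau> F)" by (intro \<tau>(1)) (simp add: sheaf_cat_simps)
  next
    fix F G f assume "F \<in> Obj ShConic" "G \<in> Obj ShConic" and f: "f \<in> psh_hom K S' F G"
    then have F: "is_sheaf K S' F" and G: "is_sheaf K S' G" by (simp_all add: sheaf_cat_simps)
    note I = inverse_image_FArr[OF F G f]
    note rI = hom_restrict_in_hom[OF opens_sub I(1)]
    have \<tau>F: "\<tau> F \<in> psh_hom K S' (direct (inv_sheaf F)) F" and \<tau>G: "\<tau> G \<in> psh_hom K S' (direct (inv_sheaf G)) G"
      using \<tau>(1)[OF F] \<tau>(1)[OF G] by (simp_all add: is_iso_def sheaf_cat_simps)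
    note PdI = sheaf_presheaf[OF direct_sheaf[OF is_sheaf_inv_sheaf[OF F]]]
    show "psh_comp S' (direct (inv_sheaf F)) (\<tau> G) (hom_restrict S' (FArr (inverse_image K S S') F G f)) =
        psh_comp S' (direct (inv_sheaf F)) f (\<tau> F)"
    proof (rule psh_hom_eqI[OF psh_comp_in_hom[OF PdI rI \<tau>G] psh_comp_in_hom[OF PdI \<tau>F f]])
      fix U t assume U: "U \<in> opens S'" and t: "t \<in> \<Gamma> (direct (inv_sheaf F)) U"
      have "t \<in> adj_unit F U ` \<Gamma> F U"
        using adj_unit_bij[OF F U] t direct_carrier[OF U, of "inv_sheaf F"] by (simp add: bij_betw_def)
      then obtain s where s: "s \<in> \<Gamma> F U" "t = adj_unit F U s" by blast
      show "psh_comp S' (direct (inv_sheaf F)) (\<tau> G) (hom_restrict S' (FArr (inverse_image K S S') F G f)) U t =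
          psh_comp S' (direct (inv_sheaf F)) f (\<tau> F) U t"
        unfolding psh_comp_apply[OF U t] hom_restrict_apply[OF U] unfolding s(2) I(2)[OF U s(1)] \<tau>(2)[OF F U s(1)]
        by (rule \<tau>(2)[OF G U psh_homD(1)[OF f U s(1)]])
    qed
  qed
qed

lemma conic_sheaves_equivalence: "inverse_equivalences ConicSh ShConic (direct_image S') (inverse_image K S S')"
  unfolding inverse_equivalences_def
  using direct_image_functor inverse_image_functor counit_iso unit_iso by blast

end

theorem theorem1p2p10:
  fixes K :: "('k, 'z) ring_scheme"
    and X :: "'a mfd"
    and \<mu> :: "'a \<times> real \<Rightarrow> 'a"
  assumes universe: "\<exists>j :: (nat \<Rightarrow> 'm) \<Rightarrow> 'm. inj j"
    and "Ring.field K"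
    and "real_analytic_manifold X"
    and "analytic_action X \<mu>"
    and i: "\<forall>U\<in>Op_sa_c X. \<exists>S\<in>covers (site_sa X) U. finite S \<and> (\<forall>V\<in>S. Rpos_connected X \<mu> V)"
    and ii: "\<forall>U\<in>Op_sa_c X. Rpos_sat \<mu> U \<in> Op_sa X"
    and iii: "\<forall>x\<in>topspace (mtop X). contractible_space (subtopology (mtop X) (Rpos_sat \<mu> {x}))"
    and iv: "\<exists>V :: nat \<Rightarrow> 'a set. range V \<in> covers (site_sa X) (topspace (mtop X)) \<and>
               (\<forall>n. Rpos_connected X \<mu> (V n) \<and> relatively_compact_in (mtop X) (V n) (V (Suc n)))"
  shows "inverse_equivalences
           (conic_sheaf_cat K X \<mu> :: (('a, 'k, 'm) psh, 'a set \<Rightarrow> 'm \<Rightarrow> 'm) cat)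
           (sheaf_cat K (site_sa_conic X \<mu>))
           (direct_image (site_sa_conic X \<mu>))
           (inverse_image K (site_sa X) (site_sa_conic X \<mu>))"
proof -
  obtain j :: "(nat \<Rightarrow> 'm) \<Rightarrow> 'm" where j: "inj j" using universe by blast
  obtain E where E: "range E \<in> covers (site_sa X) (topspace (mtop X))"
    "\<And>n. Rpos_connected X \<mu> (E n)" "\<And>n. relatively_compact_in (mtop X) (E n) (E (Suc n))"
    using iv by blast
  interpret field K by fact
  interpret conic_setting_universe X \<mu> E K j
  proof
    show "\<exists>T\<in>covers (site_sa X) U. finite T \<and> (\<forall>V\<in>T. Rpos_connected X \<mu> V)" if "U \<in> Op_sa_c X" for U
      using i that by blast
    show "Rpos_sat \<mu> U \<in> Op_sa X" if "U \<in> Op_sa_c X" for U using ii that by blast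
  qed (fact assms(3,4) E j)+
  show ?thesis by (rule conic_sheaves_equivalence)
qed

end
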